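(* Let $(F_n)_{n\ge 1}$ be the Fibonacci numbers and let $\mathcal{A} := \{\gcd(n, F_n) : n \text{ a positive integer}\}$. Then $$\#\big(\mathcal{A} \cap [1, x]\big) \ll \frac{x \log \log \log x}{\log \log x}$$ for all sufficiently large $x$; that is, there exist absolute constants $C > 0$ and $x_0$ such that $\#(\mathcal{A} \cap [1,x]) \le C\, \frac{x \log\log\log x}{\log\log x}$ for all real $x \ge x_0$.
   Context: The Fibonacci numbers are defined by $F_1 = F_2 = 1$ and $F_{n+2} = F_{n+1} + F_n$ for every positive integer $n$. The set $\mathcal{A}$ is the set of distinct integers that occur as $\gcd(n,F_n)$ for some positive integer $n$. *)

theory Defs
  imports Complex_Main "HOL-Number_Theory.Fib"
begin

(* The library function fib also has fib 0 = 0; the condition n > 0 restricts to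
   positive indices, so that 0 = gcd 0 (fib 0) is not included. *)
definition fib_gcds :: "nat set" where
  "fib_gcds = {gcd n (fib n) | n. n > 0}"

end

(*
  If m = gcd n (fib n) and 3 * 2^a divides n, then 2^a divides fib n and hence m. A prime r with
  r = -1 (mod 2^a) and r = 2 or 3 (mod 5) divides fib n only if 2^a divides n: the fundamental
  unit has norm -1, which forces L_(r+1) = -2 (mod r). A prime r = 1, 2, 4, 8 (mod 15) modulo
  which u^3 + 3u - 1 does not have three roots divides fib n only if 3 divides n. So m is divisible
  by 2^a or has no prime factor of the first kind or none of the second kind. With 2^a of size
  ln ln x / ln ln ln x, a sieve bounds the number of m <= x in either of the last two classes by
  O(x / ln ln x), provided that the sum of 1/r over each kind of primes up to roughly
  exp (ln x / ln ln ln x) is at least ln ln ln x.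
  For the first kind this needs Dirichlet's theorem modulo 5 * 2^a with good uniformity in a, which
  follows from the nonnegativity of the coefficients of ln of the product of all L-functions.
  For the second kind an upper bound for the primes modulo which the cubic splits suffices, and this
  follows from counting elements of small norm in Z[u].
*)
theory Submission
  imports Defs "HOL-Analysis.Analysis" "HOL-Real_Asymp.Real_Asymp" "HOL-Number_Theory.Number_Theory"
begin

section \<open>Fibonacci and Lucas numbers\<close>

text \<open>The cubic comes from L_(3j) = L_j^3 + 3 L_j for odd j. If r divides
  \<open>fib n\<close>, then 4n is a period of the Lucas numbers modulo r; if also 3 does not divide
  n, then 3j = 1 (mod 4n) is solvable and L_j is a root modulo r. The discriminant -135 = -15 * 3^2
  explains the classes modulo 15: a prime r > 5 in them has 0 or 3 roots. The obstacle in
  Dirichlet's theorem is the size of the loss. As 2^a is about ln ln x / ln ln ln x, a total loss of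
  order a * 2^a is affordable, but not a loss of that order for each of 2^a L-functions. Hence only
  the sum of the ln |L| is bounded below. To move closer to 1, |L(s0)| must exceed the Lipschitz
  error, of order s0 - 1. Conjugate characters share their |L|, so a complex one bears at most half
  of the total deficit, and |L(s0)| is at least of order sqrt (s0 - 1) for fixed a. Real characters
  have no partner, but only seven nonprincipal ones occur, with periods dividing 40, and a finite
  computation gives |L| >= 1/9 for them.\<close>

definition lucas :: "nat \<Rightarrow> int" where
  "lucas n = 2 * int (fib (Suc n)) - int (fib n)"

lemma lucas_0 [simp]: "lucas 0 = 2" and lucas_1 [simp]: "lucas (Suc 0) = 1"
  by (simp_all add: lucas_def)

lemma lucas_Suc_Suc: "lucas (Suc (Suc n)) = lucas (Suc n) + lucas n"
  by (simp add: lucas_def)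

text \<open>For the golden ratio alpha, alpha^n = (L_n + F_n sqrt 5) / 2. This identity and
  \<open>lucas_mult_add\<close> are the two components of alpha^m * alpha^n = alpha^(m+n), and
  \<open>lucas_fib_norm\<close> is the norm of alpha^n.\<close>

lemma fib_mult_lucas_add: "2 * int (fib (m + n)) = int (fib m) * lucas n + lucas m * int (fib n)"
proof (induction m rule: fib.induct)
  case (3 m)
  then show ?case by (simp add: lucas_Suc_Suc distrib_left distrib_right)
qed (simp_all add: lucas_def)

lemma lucas_mult_add: "2 * lucas (m + n) = lucas m * lucas n + 5 * int (fib m) * int (fib n)"
proof (induction m rule: fib.induct)
  case (3 m)
  then show ?case by (simp add: lucas_Suc_Suc distrib_left distrib_right)
qed (simp_all add: lucas_def)

lemma lucas_fib_norm: "lucas n ^ 2 - 5 * int (fib n) ^ 2 = 4 * (-1) ^ n"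
proof (induction n)
  case (Suc n)
  have "2 * int (fib (Suc n)) = int (fib n) + lucas n"
    using fib_mult_lucas_add[of n 1] by simp
  moreover have "2 * lucas (Suc n) = lucas n + 5 * int (fib n)"
    using lucas_mult_add[of n 1] by simp
  ultimately have "(2 * lucas (Suc n))^2 - 5 * (2 * int (fib (Suc n)))^2
      = (lucas n + 5 * int (fib n))^2 - 5 * (int (fib n) + lucas n)^2" by simp
  then have "4 * (lucas (Suc n) ^ 2 - 5 * int (fib (Suc n)) ^ 2)
      = (lucas n + 5 * int (fib n))^2 - 5 * (int (fib n) + lucas n)^2"
    by (simp add: power_mult_distrib)
  also have "\<dots> = - 4 * (lucas n ^ 2 - 5 * int (fib n) ^ 2)"
    by (simp add: power2_eq_square algebra_simps)
  finally show ?case using Suc.IH by simp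
qed simp

lemma fib_double: "int (fib (2 * n)) = int (fib n) * lucas n"
  using fib_mult_lucas_add[of n n] by (simp flip: mult_2)

lemma lucas_double: "lucas (2 * n) = lucas n ^ 2 - 2 * (-1) ^ n"
proof -
  have "2 * lucas (2 * n) = lucas n ^ 2 + 5 * int (fib n) ^ 2"
    using lucas_mult_add[of n n] by (simp add: power2_eq_square flip: mult_2)
  then show ?thesis using lucas_fib_norm[of n] by linarith
qed

lemma lucas_triple: "lucas (3 * n) = lucas n ^ 3 - 3 * (-1) ^ n * lucas n"
proof -
  have "2 * lucas (3 * n) = lucas (2*n) * lucas n + 5 * int (fib (2*n)) * int (fib n)"
    using lucas_mult_add[of "2*n" n] by (simp add: algebra_simps)
  also have "\<dots> = (lucas n ^ 2 - 2 * (-1) ^ n) * lucas n + 5 * int (fib n) ^ 2 * lucas n"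
    by (simp add: fib_double lucas_double power2_eq_square)
  also have "\<dots> = (lucas n ^ 2 - 2 * (-1) ^ n) * lucas n + (lucas n ^ 2 - 4 * (-1)^n) * lucas n"
    using lucas_fib_norm[of n] by (simp add: algebra_simps)
  finally show ?thesis by (simp add: power2_eq_square power3_eq_cube algebra_simps)
qed

text \<open>Modulo r the power alpha^n of the golden ratio becomes the scalar L_n / 2, whose square
  is 1 or -1 by the norm identity; hence alpha^(4n) = 1.\<close>

lemma dvd_fib_imp_lucas_periodic:
  fixes r :: int
  assumes r: "odd r" and n: "r dvd int (fib n)"
  shows "[lucas (j + 4 * n) = lucas j] (mod r)"
proof -
  have f2: "r dvd int (fib (2 * n))" using n by (simp add: fib_double)
  have f4: "r dvd int (fib (4 * n))" using f2 fib_double[of "2*n"] by simp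
  have "5 * int (fib (2*n))^2 = lucas (2*n)^2 - 4"
    using lucas_fib_norm[of "2*n"] by simp
  moreover have "r dvd 5 * int (fib (2*n))^2" using f2 by (simp add: power2_eq_square)
  ultimately have "r dvd lucas (2*n)^2 - 4" by simp
  moreover have "lucas (4*n) = lucas (2*n)^2 - 2"
    using lucas_double[of "2*n"] by simp
  ultimately have l4: "r dvd lucas (4*n) - 2" by simp
  have "2 * (lucas (j + 4*n) - lucas j) = lucas j * (lucas (4*n) - 2) + 5 * int (fib j) * int (fib (4*n))"
    using lucas_mult_add[of j "4*n"] by (simp add: algebra_simps)
  moreover have "r dvd lucas j * (lucas (4*n) - 2) + 5 * int (fib j) * int (fib (4*n))"
    using f4 l4 by (intro dvd_add dvd_mult)
  ultimately have "r dvd 2 * (lucas (j + 4*n) - lucas j)" by simp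
  moreover have "coprime r 2" using r by simp
  ultimately have "r dvd lucas (j + 4*n) - lucas j"
    using coprime_dvd_mult_right_iff by blast
  then show ?thesis by (simp add: cong_iff_dvd_diff)
qed

lemma three_dvd_imp_even_lucas: "3 dvd n \<Longrightarrow> even (lucas n)"
proof (elim dvdE)
  fix k assume "n = 3 * k"
  moreover have "even (lucas (3 * k))"
    by (simp add: lucas_triple)
  ultimately show ?thesis by simp
qed

text \<open>Each doubling F_(2n) = F_n L_n gains a factor 2, because L_n is even when 3 divides
  n.\<close>

lemma pow2_dvd_fib: "2 ^ a dvd fib (3 * 2 ^ a)"
proof (induction a)
  case (Suc a)
  have "int (2 ^ a) dvd int (fib (3 * 2 ^ a))" using Suc by (simp only: int_dvd_int_iff)
  then have "int (2 ^ a) * 2 dvd int (fib (3 * 2 ^ a)) * lucas (3 * 2 ^ a)"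
    by (intro mult_dvd_mono three_dvd_imp_even_lucas) auto
  also have "\<dots> = int (fib (2 * (3 * 2 ^ a)))" by (rule fib_double[symmetric])
  also have "2 * (3 * 2 ^ a) = (3 * 2 ^ Suc a :: nat)" by simp
  finally have "int (2 ^ Suc a) dvd int (fib (3 * 2 ^ Suc a))" by (simp add: mult.commute)
  then show ?case by (simp only: int_dvd_int_iff)
qed simp

lemma fib_dvd_mono: "m dvd n \<Longrightarrow> fib m dvd fib n"
  by (metis fib_gcd gcd_dvd2 gcd_nat.absorb1)

lemma pow2_dvd_gcd_fib:
  assumes "2 ^ a dvd n" "3 dvd n"
  shows "2 ^ a dvd gcd n (fib n)"
proof -
  have "coprime (2 ^ a) (3 :: nat)" by simp
  then have "3 * 2 ^ a dvd n" using assms by (metis divides_mult mult.commute)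
  then have "2 ^ a dvd fib n" using pow2_dvd_fib fib_dvd_mono dvd_trans by blast
  then show ?thesis using assms by simp
qed

section \<open>Binomial expansions and reduction modulo a prime\<close>

lemma lucas_closed_form:
  "real_of_int (lucas n) = ((1 + sqrt 5) / 2) ^ n + ((1 - sqrt 5) / 2) ^ n"
proof (induction n rule: fib.induct)
  case (3 n)
  have *: "((1 + sqrt 5) / 2) ^ 2 = (1 + sqrt 5) / 2 + 1" "((1 - sqrt 5) / 2) ^ 2 = (1 - sqrt 5) / 2 + 1"
    by (simp_all add: power2_eq_square field_simps)
  have "x ^ Suc (Suc n) = x ^ Suc n + x ^ n" if "x ^ 2 = x + 1" for x :: real
  proof -
    have "x ^ Suc (Suc n) = x ^ n * x ^ 2" by (simp add: power2_eq_square)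
    then show ?thesis using that by (simp add: distrib_left)
  qed
  from this[OF *(1)] this[OF *(2)] show ?case
    by (simp only: lucas_Suc_Suc of_int_add 3)
qed (simp_all add: field_simps)

lemma power_sqrt5: "sqrt 5 ^ k = (if even k then 5 ^ (k div 2) else 5 ^ (k div 2) * sqrt 5)"
proof (cases "even k")
  case True
  then have "sqrt 5 ^ k = (sqrt 5 ^ 2) ^ (k div 2)" by (metis dvd_mult_div_cancel power_mult)
  then show ?thesis using True by simp
next
  case False
  then have "sqrt 5 ^ k = (sqrt 5 ^ 2) ^ (k div 2) * sqrt 5"
    by (metis odd_two_times_div_two_succ power_add power_mult power_one_right)
  then show ?thesis using False by simp
qed

lemma binomial_sqrt5:
  "(1 + sqrt 5) ^ n = (\<Sum>k\<le>n. of_nat (n choose k) * sqrt 5 ^ k)"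
  "(1 - sqrt 5) ^ n = (\<Sum>k\<le>n. of_nat (n choose k) * (-1) ^ k * sqrt 5 ^ k)"
  using binomial_ring[of "sqrt 5" 1 n] binomial_ring[of "- sqrt 5" 1 n]
  by (simp_all add: algebra_simps flip: power_mult_distrib)

text \<open>In alpha^n + beta^n the odd powers of sqrt 5 cancel, in \<open>fib_binomial\<close> the
  even ones. For a prime n = r only the outer binomial coefficients survive modulo r.\<close>

lemma lucas_binomial:
  "2 ^ n * lucas n = 2 * (\<Sum>k\<le>n. if even k then int (n choose k) * 5 ^ (k div 2) else 0)"
proof -
  have "real_of_int (2 ^ n * lucas n) = (1 + sqrt 5) ^ n + (1 - sqrt 5) ^ n"
    by (simp add: lucas_closed_form power_divide distrib_left)
  also have "\<dots> = (\<Sum>k\<le>n. of_nat (n choose k) * sqrt 5 ^ k + of_nat (n choose k) * (-1) ^ k * sqrt 5 ^ k)"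
    unfolding binomial_sqrt5 sum.distrib ..
  also have "\<dots> = (\<Sum>k\<le>n. 2 * (if even k then of_nat (n choose k) * 5 ^ (k div 2) else 0))"
    by (intro sum.cong) (auto simp: power_sqrt5)
  also have "\<dots> = real_of_int (2 * (\<Sum>k\<le>n. if even k then int (n choose k) * 5 ^ (k div 2) else 0))"
    by (simp add: sum_distrib_left of_int_sum if_distrib cong: if_cong)
  finally show ?thesis by (simp only: of_int_eq_iff)
qed

lemma fib_binomial:
  "2 ^ n * int (fib n) = 2 * (\<Sum>k\<le>n. if odd k then int (n choose k) * 5 ^ (k div 2) else 0)"
proof -
  have s5: "sqrt 5 \<noteq> 0" by simp
  have "real_of_int (2 ^ n * int (fib n)) * sqrt 5 = (1 + sqrt 5) ^ n - (1 - sqrt 5) ^ n"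
    by (simp add: fib_closed_form power_divide right_diff_distrib)
  also have "\<dots> = (\<Sum>k\<le>n. of_nat (n choose k) * sqrt 5 ^ k - of_nat (n choose k) * (-1) ^ k * sqrt 5 ^ k)"
    unfolding binomial_sqrt5 sum_subtractf ..
  also have "\<dots> = (\<Sum>k\<le>n. 2 * (if odd k then of_nat (n choose k) * 5 ^ (k div 2) else 0) * sqrt 5)"
    by (intro sum.cong) (auto simp: power_sqrt5)
  also have "\<dots> = real_of_int (2 * (\<Sum>k\<le>n. if odd k then int (n choose k) * 5 ^ (k div 2) else 0)) * sqrt 5"
    by (simp add: sum_distrib_left sum_distrib_right of_int_sum if_distrib cong: if_cong)
  finally show ?thesis by (simp only: mult_right_cancel[OF s5] of_int_eq_iff)
qed

lemma cong_sum_binomial_prime: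
  fixes c :: "nat \<Rightarrow> int"
  assumes r: "prime r"
  shows "[(\<Sum>k\<le>r. int (r choose k) * c k) = c 0 + c r] (mod int r)"
proof -
  have "r > 0" using r prime_gt_0_nat by blast
  have "(\<Sum>k\<le>r. int (r choose k) * c k) = c 0 + c r + (\<Sum>k\<in>{0<..<r}. int (r choose k) * c k)"
  proof -
    have "{..r} = insert 0 (insert r {0<..<r})" using \<open>r > 0\<close> by auto
    then show ?thesis using \<open>r > 0\<close> by simp
  qed
  moreover have "int r dvd (\<Sum>k\<in>{0<..<r}. int (r choose k) * c k)"
  proof (intro dvd_sum dvd_mult2)
    fix k assume "k \<in> {0<..<r}"
    then have "r dvd r choose k" using r by (intro dvd_choose_prime) auto
    then show "int r dvd int (r choose k)" by simp
  qed
  ultimately show ?thesis by (simp add: cong_iff_dvd_diff)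
qed

lemma QuadRes_iff_mod:
  assumes "p > 0"
  shows "QuadRes p a \<longleftrightarrow> (\<exists>y\<in>{0..<p}. y^2 mod p = a mod p)"
proof
  assume "QuadRes p a"
  then obtain y where "y^2 mod p = a mod p" by (auto simp: QuadRes_def cong_def)
  then show "\<exists>y\<in>{0..<p}. y^2 mod p = a mod p"
    using assms by (intro bexI[of _ "y mod p"]) (auto simp: power_mod)
qed (auto simp: QuadRes_def cong_def)

lemma Legendre_mod_5:
  "Legendre (int r) 5 = (if r mod 5 = 0 then 0 else if r mod 5 \<in> {1, 4} then 1 else -1)"
proof -
  have "{0..<5} = {0, 1, 2, 3, 4 :: int}" by auto
  then have "QuadRes 5 (int r) \<longleftrightarrow> int (r mod 5) \<in> {0, 1, 4}"
    by (auto simp: QuadRes_iff_mod zmod_int)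
  moreover have "[int r = 0] (mod 5) \<longleftrightarrow> r mod 5 = 0"
    by (simp add: cong_def flip: zmod_int) presburger
  ultimately show ?thesis by (auto simp: Legendre_def)
qed

lemma five_power_inert:
  assumes r: "prime r" and m5: "r mod 5 \<in> {2, 3}" and "r > 2"
  shows "[5 ^ ((r - 1) div 2) = -1] (mod int r)"
proof -
  have "r \<noteq> 5" using m5 by auto
  then have "Legendre 5 (int r) * Legendre (int r) 5 = (-1) ^ ((5 - 1) div 2 * ((r - 1) div 2))"
    using Quadratic_Reciprocity[of 5 r] assms by auto
  also have "\<dots> = 1" by simp
  finally have 1: "Legendre 5 (int r) * Legendre (int r) 5 = 1" .
  have "Legendre (int r) 5 = -1" using m5 by (auto simp: Legendre_mod_5)
  then have "Legendre 5 (int r) = -1" using 1 by simp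
  then show ?thesis using euler_criterion[of r 5] assms by (simp add: cong_sym)
qed

text \<open>The expansions give L_r = 1 and F_r = 5^((r-1)/2) = -1 modulo r, and 2 L_(r+1) = L_r + 5
  F_r. Conceptually, Frobenius conjugates the golden ratio, so that alpha^(r+1) is its norm
  -1.\<close>

lemma lucas_inert:
  assumes r: "prime r" and m5: "r mod 5 \<in> {2, 3}" and "r > 2"
  shows "[lucas (Suc r) = -2] (mod int r)"
proof -
  have odd: "odd r" using assms prime_odd_nat by auto
  then have odd_r: "(r - Suc 0) div 2 = r div 2" by presburger
  have "\<not> r dvd 2" using \<open>r > 2\<close> by (auto dest!: dvd_imp_le)
  then have "[2 ^ (r - 1) = 1] (mod r)" by (rule fermat_theorem[OF r])
  then have f2: "[2 ^ (r - 1) = (1::int)] (mod int r)"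
    by (metis cong_int_iff of_nat_1 of_nat_numeral of_nat_power)
  have "(2::int) ^ r = 2 * 2 ^ (r - 1)"
    using \<open>r > 2\<close> by (cases r) auto
  then have p2: "[2 ^ r = 2] (mod int r)"
    using cong_scalar_left[OF f2, of 2] by simp
  have "[2 * (\<Sum>k\<le>r. int (r choose k) * (if even k then 5 ^ (k div 2) else 0)) = 2 * ((if even (0::nat) then 5 ^ (0 div 2) else 0) + (if even r then 5 ^ (r div 2) else 0))] (mod int r)"
    by (intro cong_scalar_left cong_sum_binomial_prime r)
  then have "[2 ^ r * lucas r = 2 * 1] (mod int r)"
    unfolding lucas_binomial using odd by (simp add: if_distrib cong: if_cong)
  then have "[2 * lucas r = 2 * 1] (mod int r)"
    using p2 by (metis cong_scalar_right cong_sym cong_trans)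
  moreover have "coprime 2 (int r)" using odd by simp
  ultimately have lr: "[lucas r = 1] (mod int r)" by (metis cong_mult_lcancel)
  have "[2 * (\<Sum>k\<le>r. int (r choose k) * (if odd k then 5 ^ (k div 2) else 0)) = 2 * ((if odd (0::nat) then 5 ^ (0 div 2) else 0) + (if odd r then 5 ^ (r div 2) else 0))] (mod int r)"
    by (intro cong_scalar_left cong_sum_binomial_prime r)
  then have "[2 ^ r * int (fib r) = 2 * 5 ^ ((r - 1) div 2)] (mod int r)"
    unfolding fib_binomial using odd odd_r by (simp add: if_distrib cong: if_cong)
  then have "[2 * int (fib r) = 2 * 5 ^ ((r - 1) div 2)] (mod int r)"
    using p2 by (metis cong_scalar_right cong_sym cong_trans)
  then have "[int (fib r) = 5 ^ ((r - 1) div 2)] (mod int r)"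
    using \<open>coprime 2 (int r)\<close> by (metis cong_mult_lcancel)
  then have fr: "[int (fib r) = -1] (mod int r)"
    using five_power_inert[OF assms] cong_trans by blast
  have "[lucas r + 5 * int (fib r) = 1 + 5 * (-1)] (mod int r)"
    by (intro cong_add cong_mult lr fr cong_refl)
  moreover have "2 * lucas (Suc r) = lucas r + 5 * int (fib r)"
    using lucas_mult_add[of r 1] by simp
  ultimately have "[2 * lucas (Suc r) = 2 * (-2)] (mod int r)" by simp
  then show ?thesis using \<open>coprime 2 (int r)\<close> by (metis cong_mult_lcancel)
qed

text \<open>Write r + 1 = 2k with k even. Since L_(2k) = L_k^2 - 2, r divides L_k; by the norm
  identity r then divides F_(2k) but not F_k. So every index n with r dividing F_n contains the full
  power of 2 in r + 1.\<close>

lemma pow2_dvd_of_inert_dvd_fib: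
  assumes r: "prime r" and m5: "r mod 5 \<in> {2, 3}" and a: "a \<ge> 2" and ra: "2 ^ a dvd Suc r"
    and n: "r dvd fib n"
  shows "2 ^ a dvd n"
proof -
  have "2 ^ 2 dvd (2::nat) ^ a" using a by (intro le_imp_power_dvd)
  then have "4 dvd Suc r" using ra by auto
  then have "r > 2" using r prime_ge_2_nat[OF r] by (cases "r = 2") auto
  obtain k where k: "Suc r = 2 * k" "even k"
    using \<open>4 dvd Suc r\<close> by (elim dvdE) (auto intro: that[of "2 * _"])
  have "lucas (2 * k) = lucas k ^ 2 - 2" using k lucas_double[of k] by simp
  then have "[lucas k ^ 2 - 2 = -2] (mod int r)"
    using lucas_inert[OF r m5 \<open>r > 2\<close>] k by simp
  then have "int r dvd lucas k ^ 2" by (simp add: cong_iff_dvd_diff)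
  then have rl: "int r dvd lucas k" using r by (simp add: prime_dvd_power_iff)
  have "\<not> r dvd fib k"
  proof
    assume "r dvd fib k"
    then have "int r dvd int (fib k)" by simp
    then have "int r dvd lucas k ^ 2 - 5 * int (fib k) ^ 2"
      using rl by (intro dvd_diff dvd_mult) (auto simp: power2_eq_square)
    then have "int r dvd 2 ^ 2" unfolding lucas_fib_norm using k by simp
    then have "int r dvd 2" using r by (metis prime_dvd_power_iff prime_nat_int_transfer zero_less_numeral)
    then show False using \<open>r > 2\<close> by (auto dest!: zdvd_imp_le)
  qed
  have "int r dvd int (fib (Suc r))" using rl k by (simp add: fib_double)
  then have "r dvd fib (Suc r)" by presburger
  then have rg: "r dvd fib (gcd n (Suc r))" using n by (simp add: fib_gcd)
  define g where "g = gcd n (Suc r)"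
  define v where "v = multiplicity 2 (Suc r)"
  obtain u where u: "Suc r = 2 ^ v * u" "odd u"
    using multiplicity_decompose'[of "Suc r" 2] unfolding v_def by (metis Suc_neq_Zero not_is_unit_0 prime_elem_def prime_elem_nat_iff two_is_prime_nat prime_imp_prime_elem)
  have "a \<le> v" unfolding v_def using ra by (intro multiplicity_geI) auto
  \<comment> \<open>A divisor g of r + 1 that lacks the full power \<open>2 ^ v\<close> divides the
    half k, and then r would divide \<open>fib k\<close>.\<close>
  have "2 ^ v dvd g"
  proof (rule ccontr)
    assume "\<not> 2 ^ v dvd g"
    have "g dvd 2 ^ v * u" using u g_def by (metis gcd_dvd2)
    have "v > 0" using \<open>a \<le> v\<close> a by simp
    obtain d1 d2 where d: "g = d1 * d2" "d1 dvd 2 ^ v" "d2 dvd u"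
      using \<open>g dvd 2 ^ v * u\<close> by (metis division_decomp)
    obtain i where i: "i \<le> v" "d1 = 2 ^ i" using d(2) by (auto simp: divides_primepow_nat)
    have "i \<noteq> v" using \<open>\<not> 2 ^ v dvd g\<close> d i by auto
    then have "d1 dvd 2 ^ (v - 1)" using i by (auto intro: le_imp_power_dvd)
    then have "g dvd 2 ^ (v - 1) * u" using d by (simp add: mult_dvd_mono)
    also have "2 ^ (v - 1) * u = k"
    proof -
      have "2 * (2 ^ (v - 1) * u) = 2 * k" using u k \<open>v > 0\<close> by (metis mult.assoc power_minus_mult mult.commute)
      then show ?thesis by simp
    qed
    finally have "fib g dvd fib k" by (rule fib_dvd_mono)
    then show False using rg \<open>\<not> r dvd fib k\<close> g_def dvd_trans by blast
  qed
  then have "2 ^ a dvd g" using \<open>a \<le> v\<close> le_imp_power_dvd dvd_trans by blast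
  then show ?thesis unfolding g_def by simp
qed

section \<open>The cubic that detects divisibility of the index by 3\<close>

definition cubic_roots :: "nat \<Rightarrow> int set" where
  "cubic_roots r = {u \<in> {0..<int r}. int r dvd u ^ 3 + 3 * u - 1}"

lemma finite_cubic_roots: "finite (cubic_roots r)"
  by (rule finite_subset[of _ "{0..<int r}"]) (auto simp: cubic_roots_def)

lemma Legendre_mod_3:
  "Legendre (int r) 3 = (if r mod 3 = 0 then 0 else if r mod 3 = 1 then 1 else -1)"
proof -
  have "{0..<3} = {0, 1, 2 :: int}" by auto
  then have "QuadRes 3 (int r) \<longleftrightarrow> int (r mod 3) \<in> {0, 1}"
    by (auto simp: QuadRes_iff_mod zmod_int)
  moreover have "[int r = 0] (mod 3) \<longleftrightarrow> r mod 3 = 0"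
    by (simp add: cong_def flip: zmod_int) presburger
  ultimately show ?thesis by (auto simp: Legendre_def)
qed

text \<open>The four classes are the kernel of the Kronecker symbol of discriminant -15. The sign
  (-1)^((r-1)/2) from reciprocity for 3 cancels the one from -1.\<close>

lemma minus_15_quadratic_residue:
  assumes r: "prime r" and m: "r mod 15 \<in> {1, 2, 4, 8}" and "r > 5"
  shows "\<exists>y. [y^2 = -15] (mod int r)"
proof -
  define k where "k = (r - 1) div 2"
  have m35: "r mod 3 = (r mod 15) mod 3" "r mod 5 = (r mod 15) mod 5"
    by (simp_all add: mod_mod_cancel)
  have "Legendre 3 (int r) * Legendre (int r) 3 = (-1) ^ k"
    using Quadratic_Reciprocity[of 3 r] assms by (auto simp: k_def)
  moreover have "Legendre 5 (int r) * Legendre (int r) 5 = 1"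
    using Quadratic_Reciprocity[of 5 r] assms by auto
  moreover have "Legendre (int r) 3 * Legendre (int r) 5 = 1"
    unfolding Legendre_mod_3 Legendre_mod_5 m35 using m by auto
  ultimately have L: "Legendre 3 (int r) * Legendre 5 (int r) = (-1) ^ k"
    by (metis mult.assoc mult.commute mult.right_neutral)
  have "[Legendre (-15) (int r) = (-15) ^ k] (mod int r)"
    unfolding k_def using assms by (intro euler_criterion) auto
  also have "(-15 :: int) ^ k = (-1) ^ k * (3 ^ k * 5 ^ k)"
    by (simp flip: power_mult_distrib)
  also have "[\<dots> = (-1) ^ k * (Legendre 3 (int r) * Legendre 5 (int r))] (mod int r)"
    unfolding k_def using assms by (intro cong_mult cong_refl cong_sym[OF euler_criterion]) auto
  also have "(-1) ^ k * (Legendre 3 (int r) * Legendre 5 (int r)) = 1"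
    unfolding L by (simp flip: power_mult_distrib)
  finally have c: "[Legendre (-15) (int r) = 1] (mod int r)" .
  show ?thesis
  proof (rule ccontr)
    assume "\<not> ?thesis"
    then have "Legendre (-15) (int r) = 0 \<or> Legendre (-15) (int r) = -1"
      by (auto simp: Legendre_def QuadRes_def)
    then have "int r dvd 1 \<or> int r dvd 2"
      using c by (auto simp: cong_iff_dvd_diff dvd_diff_commute)
    then show False using \<open>r > 5\<close> by (auto dest: zdvd_imp_le)
  qed
qed

text \<open>Dividing the cubic f by X - u leaves a quadratic of discriminant -3 (u^2 + 4), and this
  times f'(u)^2 is the discriminant -135 = -15 * 3^2 of f. A square root of -15 therefore splits the
  quadratic, and r > 5 keeps the three roots distinct.\<close>

lemma three_le_card_cubic_roots:
  assumes r: "prime r" and m: "r mod 15 \<in> {1, 2, 4, 8}" and "r > 5"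
    and u: "int r dvd u ^ 3 + 3 * u - 1"
  shows "card (cubic_roots r) \<ge> 3"
proof -
  have pr: "prime (int r)" using r by simp
  have odd: "odd (int r)" using assms prime_odd_nat by auto
  then have cop2: "coprime 2 (int r)" by simp
  obtain y where y: "int r dvd y^2 + 15"
    using minus_15_quadratic_residue[OF r m \<open>r > 5\<close>] by (auto simp: cong_iff_dvd_diff)
  \<comment> \<open>The derivative of the cubic at u.\<close>
  define w where "w = 3 * (u^2 + 1)"
  have "- 3 * (u^2 + 4) * w^2 + 135 = -27 * (u ^ 3 + 3 * u + 1) * (u ^ 3 + 3 * u - 1)"
    unfolding w_def by (simp add: power2_eq_square power3_eq_cube algebra_simps)
  then have w2: "int r dvd - 3 * (u^2 + 4) * w^2 + 135" using u by (metis dvd_mult)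
  have n135: "\<not> int r dvd 135"
  proof
    assume "int r dvd 135"
    also have "(135::int) = 3 ^ 3 * 5" by simp
    finally have "int r dvd 3 \<or> int r dvd 5"
      using pr by (metis prime_dvd_mult_iff prime_dvd_power_iff zero_less_numeral)
    then show False using \<open>r > 5\<close> by (auto dest!: zdvd_imp_le)
  qed
  have nw: "\<not> int r dvd w"
  proof
    assume "int r dvd w"
    then have "int r dvd - 3 * (u^2 + 4) * w^2" by (simp add: power2_eq_square)
    then show False using w2 n135 by (metis dvd_add_right_iff)
  qed
  then have "coprime w (int r)" using pr by (metis coprime_commute prime_imp_coprime)
  then obtain w' where w': "[w * w' = 1] (mod int r)" using cong_solve_coprime_int by blast
  \<comment> \<open>A square root of the discriminant of the quadratic cofactor: z^2 = -135 / w^2 =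
    -3 (u^2 + 4) modulo r.\<close>
  define z where "z = 3 * y * w'"
  have "[z^2 = 9 * y^2 * w'^2] (mod int r)" by (simp add: z_def power_mult_distrib)
  also have "[9 * y^2 * w'^2 = - 3 * (u^2 + 4) * w^2 * w'^2] (mod int r)"
  proof (intro cong_scalar_right)
    have "9 * y^2 - - 3 * (u^2 + 4) * w^2 = 9 * (y^2 + 15) - (- 3 * (u^2 + 4) * w^2 + 135)" by simp
    also have "int r dvd \<dots>" using y w2 by (intro dvd_diff dvd_mult)
    finally show "[9 * y^2 = - 3 * (u^2 + 4) * w^2] (mod int r)" by (simp add: cong_iff_dvd_diff)
  qed
  also have "- 3 * (u^2 + 4) * w^2 * w'^2 = - 3 * (u^2 + 4) * (w * w')^2"
    by (simp add: power_mult_distrib)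
  also have "[\<dots> = - 3 * (u^2 + 4) * 1^2] (mod int r)"
    by (intro cong_scalar_left cong_pow w')
  finally have z: "int r dvd z^2 + 3 * (u^2 + 4)" by (simp add: cong_iff_dvd_diff algebra_simps)
  have nz: "\<not> int r dvd z"
  proof
    assume "int r dvd z"
    then have "int r dvd z^2" by (simp add: power2_eq_square)
    then have "int r dvd 3 * (u^2 + 4)" using z by (metis dvd_add_right_iff)
    then have "int r dvd - (3 * (u^2 + 4) * w^2)" by (metis dvd_minus_iff dvd_mult2)
    then have "int r dvd - 3 * (u^2 + 4) * w^2" by (simp only: mult_minus_left)
    then show False using w2 n135 by (metis dvd_add_right_iff)
  qed
  obtain h where h: "[2 * h = 1] (mod int r)" using cong_solve_coprime_int[OF cop2] by blast
  have dvd_q: "int r dvd (2 * x + u - s) * (2 * x + u + s) + (s^2 + 3 * (u^2 + 4))"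
    if x: "int r dvd 2 * x + u - s" "s^2 = z^2" for x s
    unfolding x(2) by (rule dvd_add[OF dvd_mult2[OF x(1)] z])
  have root: "int r dvd x ^ 3 + 3 * x - 1" if x: "int r dvd 2 * x + u - s" "s^2 = z^2" for x s
  proof -
    have "4 * (x ^ 3 + 3 * x - 1) = (x - u) * ((2 * x + u - s) * (2 * x + u + s) + (s^2 + 3 * (u^2 + 4))) + 4 * (u ^ 3 + 3 * u - 1)"
      by (simp add: power2_eq_square power3_eq_cube algebra_simps)
    also have "int r dvd \<dots>" by (intro dvd_add dvd_mult[OF dvd_q[OF x]] dvd_mult[OF u])
    finally have "int r dvd 4 * (x ^ 3 + 3 * x - 1)" .
    moreover have "coprime (int r) 4"
    proof -
      have "coprime (int r) (2 * 2)" using cop2 by (simp only: coprime_mult_right_iff coprime_commute)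
      then show ?thesis by simp
    qed
    ultimately show ?thesis using coprime_dvd_mult_right_iff by blast
  qed
  \<comment> \<open>The quadratic formula, with h as the inverse of 2.\<close>
  define x1 where "x1 = h * (z - u)"
  define x2 where "x2 = h * (- z - u)"
  have "2 * x1 + u - z = (2 * h - 1) * (z - u)" "2 * x2 + u - (- z) = (2 * h - 1) * (- z - u)"
    by (simp_all add: x1_def x2_def algebra_simps)
  then have x12: "int r dvd 2 * x1 + u - z" "int r dvd 2 * x2 + u - (- z)"
    using h by (auto simp: cong_iff_dvd_diff)
  have rt: "int r dvd x1 ^ 3 + 3 * x1 - 1" "int r dvd x2 ^ 3 + 3 * x2 - 1"
    by (rule root[OF x12(1)] root[OF x12(2)]; simp)+
  have d12: "\<not> int r dvd x1 - x2"
  proof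
    assume "int r dvd x1 - x2"
    from dvd_diff[OF dvd_mult[OF this, of 2] dvd_diff[OF x12]] have "int r dvd 2 * z"
      by (simp add: algebra_simps)
    then show False using nz cop2 by (metis coprime_commute coprime_dvd_mult_right_iff)
  qed
  have du: "\<not> int r dvd x - u" if x: "int r dvd 2 * x + u - s" "s^2 = z^2" for x s
  proof
    assume "int r dvd x - u"
    then have "int r dvd (2 * x + u - s) * (2 * x + u + s) + (s^2 + 3 * (u^2 + 4)) - (x - u) * (4 * (x + 2 * u))"
      by (rule dvd_diff[OF dvd_q[OF x] dvd_mult2])
    also have "\<dots> = 4 * w"
      unfolding w_def by (simp add: power2_eq_square algebra_simps)
    finally have "int r dvd 2 * (2 * w)" by simp
    then show False using nw cop2 by (metis coprime_commute coprime_dvd_mult_right_iff)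
  qed
  have du1: "\<not> int r dvd x1 - u" and du2: "\<not> int r dvd x2 - u"
    by (rule du[OF x12(1)] du[OF x12(2)]; simp)+
  have rpos: "int r > 0" using \<open>r > 5\<close> by simp
  have in_roots: "x mod int r \<in> cubic_roots r" if "int r dvd x ^ 3 + 3 * x - 1" for x
  proof -
    have "[(x mod int r) ^ 3 + 3 * (x mod int r) - 1 = x ^ 3 + 3 * x - 1] (mod int r)"
      by (intro cong_add cong_diff cong_pow cong_mult cong_refl) (simp_all add: cong_def)
    then show ?thesis using that rpos by (auto simp: cubic_roots_def cong_dvd_iff)
  qed
  have ne: "a mod int r \<noteq> b mod int r" if "\<not> int r dvd a - b" for a b
    using that by (simp add: mod_eq_dvd_iff)
  have "card {x1 mod int r, x2 mod int r, u mod int r} = 3"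
    using ne[OF d12] ne[OF du1] ne[OF du2] by simp
  moreover have "{x1 mod int r, x2 mod int r, u mod int r} \<subseteq> cubic_roots r"
    using in_roots rt u by auto
  ultimately show ?thesis by (metis card_mono finite_cubic_roots)
qed

lemma three_dvd_of_dvd_fib:
  assumes r: "prime r" and m: "r mod 15 \<in> {1, 2, 4, 8}" and "r > 5"
    and c: "card (cubic_roots r) < 3" and n: "r dvd fib n"
  shows "3 dvd n"
proof (rule ccontr)
  assume n3: "\<not> 3 dvd n"
  have "prime (3 :: nat)" by simp
  then have "coprime 3 n" using n3 prime_imp_coprime by blast
  moreover have "coprime 3 (4 :: nat)" using coprime_Suc_right_nat[of 3] by simp
  ultimately have "coprime 3 (4 * n)" by (simp only: coprime_mult_right_iff simp_thms)
  from cong_solve_coprime_nat[OF this] obtain j where "[3 * j = 1] (mod 4 * n)" by auto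
  have "n > 0" using n3 by (cases n) auto
  \<comment> \<open>The shift by the period makes \<open>3 * j' - 1\<close> visibly a genuine
    subtraction in the naturals. The index is odd because its triple is 1 plus a multiple of
    4.\<close>
  define j' where "j' = j + 4 * n"
  have "[3 * j' = 1] (mod 4 * n)"
  proof -
    have "[3 * j + 3 * (4 * n) = 1 + 0] (mod 4 * n)"
      using \<open>[3 * j = 1] (mod 4 * n)\<close> by (intro cong_add) (auto simp: cong_0_iff)
    then show ?thesis by (simp add: j'_def)
  qed
  moreover have "3 * j' \<ge> 1" using \<open>n > 0\<close> by (simp add: j'_def)
  ultimately have "4 * n dvd 3 * j' - 1" by (simp only: cong_altdef_nat)
  then obtain q where "3 * j' - 1 = 4 * n * q" by (rule dvdE)
  then have q: "3 * j' = 1 + 4 * n * q" using \<open>3 * j' \<ge> 1\<close> by linarith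
  have "odd j'"
  proof
    assume "even j'"
    then have "even (1 + 4 * n * q)" unfolding q[symmetric] by simp
    then show False by simp
  qed
  have odd: "odd (int r)" using assms prime_odd_nat by auto
  have "[lucas (1 + 4 * n * q) = lucas 1] (mod int r)"
    using dvd_fib_imp_lucas_periodic[OF odd, of "n * q" 1] n fib_dvd_mono[of n "n * q"]
    by (simp add: mult.assoc dvd_trans[of r "fib n"])
  moreover have "lucas (3 * j') = lucas j' ^ 3 + 3 * lucas j'"
    using \<open>odd j'\<close> by (simp add: lucas_triple)
  ultimately have "int r dvd lucas j' ^ 3 + 3 * lucas j' - 1"
    using q by (simp add: cong_iff_dvd_diff)
  then have "card (cubic_roots r) \<ge> 3" by (rule three_le_card_cubic_roots[OF r m \<open>r > 5\<close>])
  then show False using c by simp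
qed

section \<open>Brun's pure sieve\<close>

lemma alternating_binomial_partial_sum:
  "(\<Sum>j\<le>k. (-1) ^ j * int (Suc n choose j)) = (-1) ^ k * int (n choose k)"
proof (induction k)
  case (Suc k)
  then show ?case by (simp add: algebra_simps)
qed simp

lemma sum_card_Pow:
  fixes f :: "nat \<Rightarrow> 'b :: comm_semiring_1"
  assumes "finite U"
  shows "(\<Sum>D\<in>{D. D \<subseteq> U \<and> card D \<le> k}. f (card D)) = (\<Sum>j\<le>k. of_nat (card U choose j) * f j)"
proof -
  have "{D. D \<subseteq> U \<and> card D \<le> k} = (\<Union>j\<in>{..k}. {D. D \<subseteq> U \<and> card D = j})" by auto
  moreover have "(\<Sum>D\<in>(\<Union>j\<in>{..k}. {D. D \<subseteq> U \<and> card D = j}). f (card D))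
      = (\<Sum>j\<le>k. \<Sum>D\<in>{D. D \<subseteq> U \<and> card D = j}. f (card D))"
    using assms by (intro sum.UNION_disjoint) auto
  moreover have "(\<Sum>D\<in>{D. D \<subseteq> U \<and> card D = j}. f (card D)) = of_nat (card U choose j) * f j" for j
    using n_subsets[OF assms, of j] by simp
  ultimately show ?thesis by simp
qed

text \<open>For nonempty U with n + 1 elements the truncated sum is (-1)^k times
  \<open>n choose k\<close>, which is nonnegative for even k. So inclusion-exclusion cut at an even
  level overestimates.\<close>

lemma Bonferroni:
  assumes U: "finite U" and k: "even k"
  shows "(if U = {} then 1 else 0) \<le> (\<Sum>D\<in>{D. D \<subseteq> U \<and> card D \<le> k}. (-1) ^ card D :: int)"
proof (cases "U = {}")
  case True
  then have "{D. D \<subseteq> U \<and> card D \<le> k} = {{}}" by auto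
  then show ?thesis by simp
next
  case False
  then obtain n where n: "card U = Suc n" using U by (metis card_gt_0_iff gr0_conv_Suc)
  have "(\<Sum>D\<in>{D. D \<subseteq> U \<and> card D \<le> k}. (-1) ^ card D :: int) = (\<Sum>j\<le>k. int (Suc n choose j) * (-1) ^ j)"
    using sum_card_Pow[OF U, of "\<lambda>j. (-1) ^ j" k] n by simp
  also have "\<dots> = (-1) ^ k * int (n choose k)"
    using alternating_binomial_partial_sum[of n k] by (simp add: mult.commute)
  finally show ?thesis using False k by simp
qed

lemma prod_primes_dvd_iff:
  fixes D :: "nat set"
  assumes "finite D" "\<And>r. r \<in> D \<Longrightarrow> prime r"
  shows "\<Prod>D dvd m \<longleftrightarrow> (\<forall>r\<in>D. r dvd m)"
proof
  assume "\<Prod>D dvd m"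
  then show "\<forall>r\<in>D. r dvd m" using assms(1) by (meson dvd_prodI dvd_trans)
next
  assume *: "\<forall>r\<in>D. r dvd m"
  show "\<Prod>D dvd m" using assms * 
  proof (induction D rule: finite_induct)
    case (insert r D)
    have "coprime r (\<Prod>D)"
      using insert by (intro prod_coprime_right) (metis insertCI primes_coprime)
    moreover have "r dvd m" "\<Prod>D dvd m" using insert by auto
    ultimately show ?case using insert by (simp add: divides_mult)
  qed simp
qed

lemma card_multiples:
  assumes "d > 0"
  shows "card {m \<in> {1..N}. d dvd m} = N div d"
proof -
  have "{m \<in> {1..N}. d dvd m} = (\<lambda>i. d * i) ` {1..N div d}"
  proof (intro Set.set_eqI iffI)
    fix m assume "m \<in> {m \<in> {1..N}. d dvd m}"
    then obtain i where i: "m = d * i" "1 \<le> m" "m \<le> N" by auto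
    then have "i \<le> N div d" using assms by (metis div_le_mono nonzero_mult_div_cancel_left not_less0)
    moreover have "i \<ge> 1" using i by (cases i) auto
    ultimately show "m \<in> (\<lambda>i. d * i) ` {1..N div d}" using i by auto
  next
    fix m assume "m \<in> (\<lambda>i. d * i) ` {1..N div d}"
    then obtain i where "m = d * i" "i \<in> {1..N div d}" by blast
    then have i: "m = d * i" "1 \<le> i" "i \<le> N div d" by simp_all
    have "d * i \<le> d * (N div d)" using i by simp
    also have "\<dots> \<le> N" by simp
    finally have "m \<le> N" using i by simp
    moreover have "m \<ge> 1" using i assms by simp
    ultimately show "m \<in> {m \<in> {1..N}. d dvd m}" using i by auto
  qed
  moreover have "inj_on (\<lambda>i. d * i) {1..N div d}" using assms by (auto simp: inj_on_def)
  ultimately show ?thesis by (simp add: card_image)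
qed

text \<open>Giving each element of D the weight 1 / w costs at most a factor \<open>w ^ k\<close>;
  the weighted sum over all subsets is then (1 + 1 / w)^(card P) <= e <= 3.\<close>

lemma card_small_subsets_le:
  fixes w :: real
  assumes P: "finite P" and w: "real (card P) \<le> w" "w \<ge> 1"
  shows "real (card {D. D \<subseteq> P \<and> card D \<le> k}) \<le> 3 * w ^ k"
proof -
  have "real (card {D. D \<subseteq> P \<and> card D \<le> k}) = (\<Sum>D\<in>{D. D \<subseteq> P \<and> card D \<le> k}. 1)" by simp
  also have "\<dots> \<le> (\<Sum>D\<in>{D. D \<subseteq> P \<and> card D \<le> k}. w ^ k * (\<Prod>r\<in>D. 1 / w))"
  proof (intro sum_mono)
    fix D assume D: "D \<in> {D. D \<subseteq> P \<and> card D \<le> k}"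
    have "w ^ card D \<le> w ^ k" using D w by (intro power_increasing) auto
    then show "1 \<le> w ^ k * (\<Prod>r\<in>D. 1 / w)" using w by (simp add: power_one_over field_simps)
  qed
  also have "\<dots> \<le> (\<Sum>D\<in>Pow P. w ^ k * (\<Prod>r\<in>D. 1 / w))"
    using P w by (intro sum_mono2) auto
  also have "\<dots> = w ^ k * (\<Prod>r\<in>P. 1 / w + 1)"
    using prod_add[OF P, of "\<lambda>_. 1 / w" "\<lambda>_. 1"] by (simp add: sum_distrib_left)
  also have "(\<Prod>r\<in>P. 1 / w + 1) \<le> (\<Prod>r\<in>P. exp (1 / w))"
    using w by (intro prod_mono) (auto simp: add.commute)
  also have "\<dots> = exp (real (card P) / w)" by (simp flip: exp_of_nat_mult)
  also have "\<dots> \<le> exp 1" using w by simp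
  also have "exp 1 \<le> (3 :: real)" by (rule exp_le)
  finally show ?thesis using w by (simp add: mult.commute)
qed

text \<open>The full sum over subsets is the Euler product, at most exp (-V). For the subsets with
  more than k elements Rankin's factor e^(card D - k) >= 1 gives exp (e V - k), and e <= 3 with k >=
  4 V makes this at most exp (-V) too.\<close>

lemma truncated_Euler_product_le:
  fixes P :: "nat set"
  assumes P: "finite P" "\<And>r. r \<in> P \<Longrightarrow> prime r"
    and V: "V = (\<Sum>r\<in>P. 1 / real r)" and k: "real k \<ge> 4 * V"
  shows "(\<Sum>D\<in>{D. D \<subseteq> P \<and> card D \<le> k}. (-1) ^ card D / real (\<Prod>D)) \<le> 2 * exp (- V)"
proof -
  have rpos: "real r \<ge> 2" if "r \<in> P" for r
    using P(2)[OF that] prime_ge_2_nat by (metis of_nat_le_iff of_nat_numeral)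
  define S where "S = {D. D \<subseteq> P \<and> card D \<le> k}"
  have S: "S \<subseteq> Pow P" "finite (Pow P)" using P by (auto simp: S_def)
  have V0: "V \<ge> 0" unfolding V by (intro sum_nonneg) auto
  have "(\<Sum>D\<in>S. (-1) ^ card D / real (\<Prod>D)) = (\<Sum>D\<in>Pow P. (-1) ^ card D / real (\<Prod>D)) - (\<Sum>D\<in>Pow P - S. (-1) ^ card D / real (\<Prod>D))"
    using sum.subset_diff[OF S, of "\<lambda>D. (-1) ^ card D / real (\<Prod>D)"] by linarith
  moreover have "(\<Sum>D\<in>Pow P. (-1) ^ card D / real (\<Prod>D)) \<le> exp (- V)"
  proof -
    have "(\<Sum>D\<in>Pow P. (-1) ^ card D / real (\<Prod>D)) = (\<Sum>D\<in>Pow P. (\<Prod>r\<in>D. - 1 / real r))"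
      by (simp only: prod_dividef prod_constant of_nat_prod)
    also have "\<dots> = (\<Prod>r\<in>P. - 1 / real r + 1)"
      using prod_add[OF P(1), of "\<lambda>r. - 1 / real r" "\<lambda>_. 1"] by simp
    also have "\<dots> \<le> (\<Prod>r\<in>P. exp (- 1 / real r))"
    proof (intro prod_mono conjI)
      fix r assume "r \<in> P"
      then show "0 \<le> - 1 / real r + 1" using rpos[of r] by (simp add: field_simps)
      show "- 1 / real r + 1 \<le> exp (- 1 / real r)"
        using exp_ge_add_one_self[of "- 1 / real r"] by linarith
    qed
    also have "\<dots> = exp (- V)"
      unfolding V sum_negf[symmetric] using P by (simp add: exp_sum)
    finally show ?thesis .
  qed
  moreover have "- (\<Sum>D\<in>Pow P - S. (-1) ^ card D / real (\<Prod>D)) \<le> exp (- V)"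
  proof -
    have "- (\<Sum>D\<in>Pow P - S. (-1) ^ card D / real (\<Prod>D)) \<le> (\<Sum>D\<in>Pow P - S. exp (- real k) * (\<Prod>r\<in>D. exp 1 / real r))"
      unfolding sum_negf[symmetric]
    proof (intro sum_mono)
      fix D assume D: "D \<in> Pow P - S"
      then have "card D > k" by (auto simp: S_def)
      then have "1 \<le> exp (- real k) * exp (real (card D))" by (simp flip: exp_add)
      moreover have "0 < real (\<Prod>D)" using D P rpos by (auto intro!: prod_pos simp: prime_gt_0_nat)
      moreover have "- ((-1) ^ card D / real (\<Prod>D)) \<le> 1 / real (\<Prod>D)"
        using \<open>0 < real (\<Prod>D)\<close> by (cases "even (card D)") auto
      moreover have "exp (- real k) * (\<Prod>r\<in>D. exp 1 / real r) = exp (- real k) * exp (real (card D)) / real (\<Prod>D)"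
        by (simp add: prod_dividef flip: exp_of_nat_mult)
      moreover have "1 / real (\<Prod>D) \<le> exp (- real k) * exp (real (card D)) / real (\<Prod>D)"
        using calculation by (intro divide_right_mono) auto
      ultimately show "- ((-1) ^ card D / real (\<Prod>D)) \<le> exp (- real k) * (\<Prod>r\<in>D. exp 1 / real r)"
        by linarith
    qed
    also have "\<dots> \<le> (\<Sum>D\<in>Pow P. exp (- real k) * (\<Prod>r\<in>D. exp 1 / real r))"
      using P by (intro sum_mono2) (auto intro!: mult_nonneg_nonneg prod_nonneg)
    also have "\<dots> = exp (- real k) * (\<Prod>r\<in>P. exp 1 / real r + 1)"
      using prod_add[OF P(1), of "\<lambda>r. exp 1 / real r" "\<lambda>_. 1"] by (simp add: sum_distrib_left)
    also have "\<dots> \<le> exp (- real k) * (\<Prod>r\<in>P. exp (exp 1 / real r))"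
      by (intro mult_left_mono prod_mono) (auto simp: add.commute)
    also have "(\<Prod>r\<in>P. exp (exp 1 / real r)) = exp (exp 1 * V)"
      unfolding V using P by (simp add: exp_sum sum_distrib_left)
    also have "exp (- real k) * exp (exp 1 * V) = exp (exp 1 * V - real k)" by (simp flip: exp_add)
    also have "\<dots> \<le> exp (- V)"
    proof -
      have "exp 1 * V \<le> 3 * V" using exp_le V0 by (intro mult_right_mono) auto
      then show ?thesis using k by simp
    qed
    finally show ?thesis .
  qed
  ultimately show ?thesis unfolding S_def by linarith
qed

text \<open>Replacing \<open>N div \<Prod>D\<close> by N / \<open>\<Prod>D\<close> costs at most 1
  for each D, so the error is the number of subsets of size at most k, and the main term is the
  truncated Euler product.\<close>

lemma Brun_pure_sieve:
  fixes P :: "nat set" and w :: real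
  assumes P: "finite P" "\<And>r. r \<in> P \<Longrightarrow> prime r"
    and V: "V = (\<Sum>r\<in>P. 1 / real r)" and k: "even k" "real k \<ge> 4 * V"
    and w: "real (card P) \<le> w" "w \<ge> 1"
  shows "real (card {m \<in> {1..N}. \<forall>r\<in>P. \<not> r dvd m}) \<le> 2 * real N * exp (- V) + 3 * w ^ k"
proof -
  define S where "S = {D. D \<subseteq> P \<and> card D \<le> k}"
  have fS: "finite S" using P by (simp add: S_def)
  have prP: "finite D \<and> (\<forall>r\<in>D. prime r)" if "D \<in> S" for D
    using that P finite_subset by (auto simp: S_def)
  have "int (card {m \<in> {1..N}. \<forall>r\<in>P. \<not> r dvd m}) = (\<Sum>m=1..N. if \<forall>r\<in>P. \<not> r dvd m then 1 else 0)"
    by (simp add: sum.inter_filter[symmetric])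
  also have "\<dots> = (\<Sum>m=1..N. if {r\<in>P. r dvd m} = {} then 1 else 0)"
    by (intro sum.cong) auto
  also have "\<dots> \<le> (\<Sum>m=1..N. \<Sum>D\<in>{D. D \<subseteq> {r\<in>P. r dvd m} \<and> card D \<le> k}. (-1) ^ card D)"
    using P k by (intro sum_mono Bonferroni) auto
  also have "\<dots> = (\<Sum>m=1..N. \<Sum>D\<in>S. if \<Prod>D dvd m then (-1) ^ card D else 0)"
  proof (rule sum.cong[OF refl])
    fix m assume "m \<in> {1..N}"
    have "D \<subseteq> {r\<in>P. r dvd m} \<longleftrightarrow> \<Prod>D dvd m" if "D \<in> S" for D
      using prod_primes_dvd_iff[of D m] prP[OF that] that by (auto simp: S_def)
    then have "{D. D \<subseteq> {r\<in>P. r dvd m} \<and> card D \<le> k} = {D \<in> S. \<Prod>D dvd m}"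
      by (auto simp: S_def)
    then show "(\<Sum>D\<in>{D. D \<subseteq> {r\<in>P. r dvd m} \<and> card D \<le> k}. (-1) ^ card D)
        = (\<Sum>D\<in>S. if \<Prod>D dvd m then (-1) ^ card D else 0 :: int)"
      using fS by (simp add: sum.inter_filter)
  qed
  also have "\<dots> = (\<Sum>D\<in>S. \<Sum>m=1..N. if \<Prod>D dvd m then (-1) ^ card D else 0)"
    by (rule sum.swap)
  also have "\<dots> = (\<Sum>D\<in>S. (-1) ^ card D * int (N div \<Prod>D))"
  proof (rule sum.cong[OF refl])
    fix D assume "D \<in> S"
    then have "\<Prod>D > 0" using prP by (auto intro!: prod_pos simp: prime_gt_0_nat)
    then have "card {m \<in> {1..N}. \<Prod>D dvd m} = N div \<Prod>D" by (rule card_multiples)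
    moreover have "(\<Sum>m=1..N. if \<Prod>D dvd m then (-1) ^ card D else 0)
        = (\<Sum>m\<in>{m\<in>{1..N}. \<Prod>D dvd m}. (-1) ^ card D :: int)"
      by (rule sum.inter_filter[symmetric]) simp
    ultimately show "(\<Sum>m=1..N. if \<Prod>D dvd m then (-1) ^ card D else 0) = (-1) ^ card D * int (N div \<Prod>D)"
      by (simp only: sum_constant mult.commute)
  qed
  finally have "of_int (int (card {m \<in> {1..N}. \<forall>r\<in>P. \<not> r dvd m}))
      \<le> (of_int (\<Sum>D\<in>S. (-1) ^ card D * int (N div \<Prod>D)) :: real)"
    by (simp only: of_int_le_iff)
  then have "real (card {m \<in> {1..N}. \<forall>r\<in>P. \<not> r dvd m}) \<le> (\<Sum>D\<in>S. (-1) ^ card D * real (N div \<Prod>D))"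
    by simp
  also have "\<dots> \<le> (\<Sum>D\<in>S. real N * ((-1) ^ card D / real (\<Prod>D)) + 1)"
  proof (intro sum_mono)
    fix D assume "D \<in> S"
    have "real (N div \<Prod>D) \<le> real N / real (\<Prod>D)" by (rule of_nat_div_le_of_nat)
    moreover have "real N / real (\<Prod>D) \<le> real (N div \<Prod>D) + 1" 
    proof -
      have "\<Prod>D > 0" using prP[OF \<open>D \<in> S\<close>] by (auto intro!: prod_pos simp: prime_gt_0_nat)
      then have "real (N mod \<Prod>D) / real (\<Prod>D) \<le> 1"
        by (simp only: divide_le_eq_1 of_nat_0_less_iff of_nat_le_iff) (simp add: less_imp_le)
      then show ?thesis using of_nat_of_nat_div_aux[of N "\<Prod>D", where ?'a = real] by linarith
    qed
    ultimately show "(-1) ^ card D * real (N div \<Prod>D) \<le> real N * ((-1) ^ card D / real (\<Prod>D)) + 1"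
      by (cases "even (card D)") auto
  qed
  also have "\<dots> = real N * (\<Sum>D\<in>S. (-1) ^ card D / real (\<Prod>D)) + real (card S)"
    by (simp add: sum.distrib sum_distrib_left)
  also have "\<dots> \<le> real N * (2 * exp (- V)) + 3 * w ^ k"
    unfolding S_def
    by (intro add_mono mult_left_mono truncated_Euler_product_le card_small_subsets_le P V k w) auto
  finally show ?thesis by (simp add: mult_ac)
qed

text \<open>The sieve level must be at least four times the sum of reciprocals, so that sum must
  also be bounded above. Terms of size at most 1, added one by one, overshoot L by at most
  1.\<close>

lemma subset_sum_between:
  fixes f :: "'a \<Rightarrow> real"
  assumes "finite A" "\<And>x. x \<in> A \<Longrightarrow> 0 \<le> f x \<and> f x \<le> 1" "L \<ge> 0" "(\<Sum>x\<in>A. f x) \<ge> L"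
  shows "\<exists>B\<subseteq>A. L \<le> (\<Sum>x\<in>B. f x) \<and> (\<Sum>x\<in>B. f x) \<le> L + 1"
  using assms
proof (induction A rule: finite_induct)
  case (insert a A)
  show ?case
  proof (cases "(\<Sum>x\<in>A. f x) \<ge> L")
    case True
    then show ?thesis using insert by (meson insertCI subset_insertI2)
  next
    case False
    then have "(\<Sum>x\<in>insert a A. f x) \<le> L + 1" using insert.hyps insert.prems(1)[of a] by simp
    then show ?thesis using insert.prems by blast
  qed
qed auto

section \<open>Sums of negative powers\<close>

text \<open>The middle expression is the integral of t^(-s) over [x, x + 1]; the mean value theorem
  compares it with the endpoint values.\<close>

lemma powr_diff_bounds:
  fixes x s :: real
  assumes x: "x > 0" and s: "s > 1"
  shows "(x + 1) powr (- s) \<le> (x powr (1 - s) - (x + 1) powr (1 - s)) / (s - 1)"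
    and "(x powr (1 - s) - (x + 1) powr (1 - s)) / (s - 1) \<le> x powr (- s)"
proof -
  have "\<exists>z>x. z < x + 1 \<and> (x + 1) powr (1 - s) - x powr (1 - s) = (x + 1 - x) * ((1 - s) * z powr (- s))"
  proof (rule MVT2)
    fix t assume "x \<le> t" "t \<le> x + 1"
    then show "((\<lambda>t. t powr (1 - s)) has_real_derivative (1 - s) * t powr (- s)) (at t)"
      using x by (auto intro!: derivative_eq_intros)
  qed simp
  then obtain z where z: "x < z" "z < x + 1"
    "(x + 1) powr (1 - s) - x powr (1 - s) = (1 - s) * z powr (- s)" by auto
  then have eq: "(x powr (1 - s) - (x + 1) powr (1 - s)) / (s - 1) = z powr (- s)"
    using s by (simp add: field_simps)
  show "(x + 1) powr (- s) \<le> (x powr (1 - s) - (x + 1) powr (1 - s)) / (s - 1)"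
    unfolding eq using z x s by (intro powr_mono2') auto
  show "(x powr (1 - s) - (x + 1) powr (1 - s)) / (s - 1) \<le> x powr (- s)"
    unfolding eq using z x s by (intro powr_mono2') auto
qed

lemma sum_powr_le:
  fixes s :: real
  assumes s: "s > 1" and k: "k > 0"
  shows "(\<Sum>m=Suc k..n. real m powr (- s)) \<le> real k powr (1 - s) / (s - 1)"
proof (cases "k \<le> n")
  case True
  have "(\<Sum>m=Suc k..n. real m powr (- s)) \<le> (real k powr (1 - s) - real n powr (1 - s)) / (s - 1)"
    using True
  proof (induction n rule: dec_induct)
    case (step n)
    have "real (Suc n) powr (- s) \<le> (real n powr (1 - s) - real (Suc n) powr (1 - s)) / (s - 1)"
      using powr_diff_bounds(1)[of "real n" s] step k s by (simp add: add.commute)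
    then show ?case using step by (simp add: diff_divide_distrib)
  qed simp
  also have "\<dots> \<le> real k powr (1 - s) / (s - 1)"
    using s by (intro divide_right_mono) auto
  finally show ?thesis .
qed (use s in auto)

lemma sum_powr_le_zeta:
  fixes s :: real
  assumes s: "s > 1"
  shows "(\<Sum>m=1..n. real m powr (- s)) \<le> 1 + 1 / (s - 1)"
proof (cases "n = 0")
  case False
  then have "{1..n} = insert 1 {Suc 1..n}" by auto
  then have "(\<Sum>m=1..n. real m powr (- s)) = 1 + (\<Sum>m=Suc 1..n. real m powr (- s))" by simp
  also have "\<dots> \<le> 1 + 1 / (s - 1)" using sum_powr_le[OF s, of 1 n] by simp
  finally show ?thesis .
qed (use s in auto)

text \<open>The numbers C - h m have nonnegative partial sums, and by partial summation this
  persists against decreasing weights. The induction carries the partial sum times the current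
  weight as a lower bound. This turns a bound for mean values into one for a Dirichlet
  series.\<close>

lemma sum_weighted_le:
  fixes h g :: "nat \<Rightarrow> real"
  assumes h: "\<And>M. (\<Sum>m=1..M. h m) \<le> C * real M"
    and g: "\<And>m. g m \<ge> 0" "\<And>m. m \<ge> 1 \<Longrightarrow> g (Suc m) \<le> g m"
  shows "(\<Sum>m=1..M. h m * g m) \<le> C * (\<Sum>m=1..M. g m)"
proof -
  have *: "(\<Sum>m=1..M. (C - h m) * g m) \<ge> (\<Sum>m=1..M. C - h m) * g M" for M
  proof (induction M)
    case (Suc M)
    have "(\<Sum>m=1..M. C - h m) \<ge> 0"
      using h[of M] by (simp add: sum_subtractf mult.commute)
    moreover have "M = 0 \<or> g (Suc M) \<le> g M" using g(2)[of M] by linarith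
    ultimately have "(\<Sum>m=1..M. C - h m) * g (Suc M) \<le> (\<Sum>m=1..M. C - h m) * g M"
      by (auto intro: mult_left_mono)
    then show ?case using Suc.IH by (simp add: distrib_right)
  qed simp
  have "0 \<le> (\<Sum>m=1..M. C - h m) * g M"
    using h[of M] g(1) by (intro mult_nonneg_nonneg) (auto simp: sum_subtractf mult.commute)
  also note *[of M]
  finally show ?thesis by (simp add: left_diff_distrib sum_subtractf sum_distrib_left)
qed

section \<open>Primes splitting in the cubic field\<close>

text \<open>The norm of \<open>a + b u + c u\<^sup>2\<close>, where \<open>u\<^sup>3 + 3 u - 1 = 0\<close>.\<close>
definition cubic_norm :: "int \<Rightarrow> int \<Rightarrow> int \<Rightarrow> int" where
  "cubic_norm a b c = a^3 + b^3 + c^3 - 6 * a^2 * c + 9 * a * c^2 + 3 * a * b^2 + 3 * b * c^2 - 3 * a * b * c"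

text \<open>Multiplication by a + b u + c u^2 has a matrix with rows (a, b, c), (c, a - 3c, b), (b,
  c - 3b, a - 3c). Combining the rows with the cofactors of the first column leaves the determinant;
  the three right-hand summands are these rows paired with (1, x, x^2), where x^3 + 3x - 1 is not
  assumed to vanish.\<close>

lemma cubic_norm_eq:
  "cubic_norm a b c =
     ((a - 3 * c)^2 - b * (c - 3 * b)) * (a + b * x + c * x^2)
   - (b * (a - 3 * c) - c * (c - 3 * b)) * (x * (a + b * x + c * x^2) - c * (x^3 + 3 * x - 1))
   + (b^2 - c * (a - 3 * c)) * (x^2 * (a + b * x + c * x^2) - (b + c * x) * (x^3 + 3 * x - 1))"
  unfolding cubic_norm_def by (simp add: power2_eq_square power3_eq_cube algebra_simps)

lemma dvd_cubic_norm:
  assumes "m dvd x^3 + 3 * x - 1" "m dvd a + b * x + c * x^2"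
  shows "m dvd cubic_norm a b c"
  unfolding cubic_norm_eq[of a b c x] by (intro dvd_add dvd_diff dvd_mult assms)

text \<open>All cofactors in \<open>cubic_norm_eq\<close> vanish modulo \<open>r\<close>.\<close>
lemma square_dvd_cubic_norm:
  assumes r: "prime (r :: int)" and xy: "\<not> r dvd x - y"
    and x: "r dvd x^3 + 3 * x - 1" "r dvd a + b * x + c * x^2"
    and y: "r dvd y^3 + 3 * y - 1" "r dvd a + b * y + c * y^2"
  shows "r^2 dvd cubic_norm a b c"
proof -
  have "r dvd (a + b * x + c * x^2) - (a + b * y + c * y^2)" by (rule dvd_diff[OF x(2) y(2)])
  then have "r dvd (x - y) * (b + c * (x + y))" by (simp add: power2_eq_square algebra_simps)
  then have 1: "r dvd b + c * (x + y)" using r xy prime_dvd_mult_iff by blast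
  have "r dvd (x^3 + 3 * x - 1) - (y^3 + 3 * y - 1)" by (rule dvd_diff[OF x(1) y(1)])
  then have "r dvd (x - y) * (x^2 + x * y + y^2 + 3)"
    by (simp add: power2_eq_square power3_eq_cube algebra_simps)
  then have 2: "r dvd x^2 + x * y + y^2 + 3" using r xy prime_dvd_mult_iff by blast
  have 3: "r dvd a - c * (x * y)"
  proof -
    have "a - c * (x * y) = (a + b * x + c * x^2) - x * (b + c * (x + y))"
      by (simp add: power2_eq_square algebra_simps)
    also have "r dvd \<dots>" by (rule dvd_diff[OF x(2) dvd_mult[OF 1]])
    finally show ?thesis .
  qed
  \<comment> \<open>By Vieta the third root is -s, whence p = s^2 + 3 and p s = -1 modulo r.
    Expressing a, b and p through s, with explicit multiples of r, reduces every cofactor to a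
    multiple of r.\<close>
  define s p where "s = x + y" and "p = x * y"
  obtain k where "b + c * s = r * k" using 1 unfolding s_def by (rule dvdE)
  then have k: "b = r * k - c * s" by linarith
  obtain l where "a - c * p = r * l" using 3 unfolding p_def by (rule dvdE)
  then have l: "a = r * l + c * p" by linarith
  have "x^2 + x * y + y^2 + 3 = s^2 - p + 3"
    unfolding s_def p_def by (simp add: power2_eq_square algebra_simps)
  then have "r dvd s^2 - p + 3" using 2 by simp
  then obtain m where "s^2 - p + 3 = r * m" by (rule dvdE)
  then have m: "p = s^2 + 3 - r * m" by linarith
  have "p * s + 1 = x * (x^2 + x * y + y^2 + 3) - (x^3 + 3 * x - 1)"
    unfolding s_def p_def by (simp add: power2_eq_square power3_eq_cube algebra_simps)
  also have "r dvd \<dots>" by (rule dvd_diff[OF dvd_mult[OF 2] x(1)])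
  finally have ps: "r dvd p * s + 1" .
  then obtain t where t: "s^3 = r * t - 3 * s - 1"
  proof -
    have "p * s + 1 = s^3 + 3 * s + 1 - r * (m * s)"
      unfolding m by (simp add: power2_eq_square power3_eq_cube algebra_simps)
    then have "s^3 + 3 * s + 1 = (p * s + 1) + r * (m * s)" by linarith
    also have "r dvd \<dots>" by (rule dvd_add[OF ps dvd_triv_left])
    finally have "r dvd s^3 + 3 * s + 1" .
    then obtain t where "s^3 + 3 * s + 1 = r * t" by (rule dvdE)
    then show ?thesis using that[of t] by linarith
  qed
  have s4: "s^4 = (r * t - 3 * s - 1) * s" unfolding t[symmetric] by (simp add: power_eq_if)
  have A2: "r dvd b^2 - c * (a - 3 * c)"
  proof -
    have "b^2 - c * (a - 3 * c) = r * (r * k^2 - 2 * k * c * s - c * l + c^2 * m)"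
      unfolding k l m by (simp add: power2_eq_square algebra_simps)
    then show ?thesis by simp
  qed
  have A1: "r dvd b * (a - 3 * c) - c * (c - 3 * b)"
  proof -
    have "b * (a - 3 * c) - c * (c - 3 * b) = r * (k * a - c * s * l) - c^2 * (p * s + 1)"
      unfolding k l by (simp add: power2_eq_square algebra_simps)
    also have "r dvd \<dots>" by (rule dvd_diff[OF dvd_triv_left dvd_mult[OF ps]])
    finally show ?thesis .
  qed
  have A0: "r dvd (a - 3 * c)^2 - b * (c - 3 * b)"
  proof -
    have "(a - 3 * c)^2 - b * (c - 3 * b)
       = r * (l * (a - 3 * c) + l * (c * p - 3 * c) - k * c + 3 * k * b - 3 * k * c * s)
         + c^2 * ((p - 3)^2 + s + 3 * s^2)"
      unfolding k l by (simp add: power2_eq_square algebra_simps)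
    also have "(p - 3)^2 + s + 3 * s^2 = s^4 + s + 3 * s^2 + r * (r * m^2 - 2 * s^2 * m)"
      unfolding m by (simp add: power2_eq_square power4_eq_xxxx algebra_simps)
    also have "s^4 + s + 3 * s^2 = r * (t * s)"
      unfolding s4 by (simp add: power2_eq_square algebra_simps)
    finally show ?thesis by (simp only:) (intro dvd_add dvd_triv_left dvd_mult)
  qed
  have "r * r dvd cubic_norm a b c"
    unfolding cubic_norm_eq[of a b c x]
    by (rule dvd_add[OF dvd_diff[OF mult_dvd_mono[OF A0 x(2)]
          mult_dvd_mono[OF A1 dvd_diff[OF dvd_mult[OF x(2)] dvd_mult[OF x(1)]]]]
          mult_dvd_mono[OF A2 dvd_diff[OF dvd_mult[OF x(2)] dvd_mult[OF x(1)]]]])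
  then show ?thesis by (simp add: power2_eq_square)
qed

lemma even_cubic_norm_iff: "even (cubic_norm a b c) \<longleftrightarrow> even a \<and> even b \<and> even c"
  unfolding cubic_norm_def by auto

text \<open>Infinite descent at 2: the cubic is irreducible modulo 2, so an even norm forces even
  coordinates, and halving them divides the norm by 8.\<close>

lemma cubic_norm_eq_0:
  assumes "cubic_norm a b c = 0"
  shows "a = 0 \<and> b = 0 \<and> c = 0"
  using assms
proof (induction "nat (\<bar>a\<bar> + \<bar>b\<bar> + \<bar>c\<bar>)" arbitrary: a b c rule: less_induct)
  case less
  then have "even a \<and> even b \<and> even c" using even_cubic_norm_iff[of a b c] by simp
  then obtain a' b' c' where abc: "a = 2 * a'" "b = 2 * b'" "c = 2 * c'" by blast
  have "cubic_norm a b c = 8 * cubic_norm a' b' c'"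
    unfolding abc cubic_norm_def by (simp add: power_mult_distrib algebra_simps)
  then have z: "cubic_norm a' b' c' = 0" using less.prems by simp
  show ?case
  proof (rule ccontr)
    assume nz: "\<not> ?thesis"
    then have "nat (\<bar>a'\<bar> + \<bar>b'\<bar> + \<bar>c'\<bar>) < nat (\<bar>a\<bar> + \<bar>b\<bar> + \<bar>c\<bar>)" unfolding abc by auto
    then show False using less.hyps z nz abc by auto
  qed
qed

text \<open>The factor 27 is the sum of the absolute values of the coefficients of
  \<open>cubic_norm\<close>.\<close>

lemma abs_cubic_norm_le:
  assumes "\<bar>a\<bar> \<le> M" "\<bar>b\<bar> \<le> M" "\<bar>c\<bar> \<le> M"
  shows "\<bar>cubic_norm a b c\<bar> \<le> 27 * M^3"
proof -
  have t: "x * y * z \<le> M^3 \<and> - (x * y * z) \<le> M^3"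
    if "\<bar>x\<bar> \<le> M" "\<bar>y\<bar> \<le> M" "\<bar>z\<bar> \<le> M" for x y z
  proof -
    have "\<bar>x * y * z\<bar> \<le> M^3"
      using that unfolding abs_mult power3_eq_cube by (intro mult_mono) auto
    then show ?thesis by linarith
  qed
  have eq: "cubic_norm a b c = a*a*a + b*b*b + c*c*c - 6 * (a*a*c) + 9 * (a*c*c) + 3 * (a*b*b) + 3 * (b*c*c) - 3 * (a*b*c)"
    unfolding cubic_norm_def by (simp add: power2_eq_square power3_eq_cube)
  note t[OF assms(1) assms(1) assms(1)] t[OF assms(2) assms(2) assms(2)] t[OF assms(3) assms(3) assms(3)]
    t[OF assms(1) assms(1) assms(3)] t[OF assms(1) assms(3) assms(3)] t[OF assms(1) assms(2) assms(2)]
    t[OF assms(2) assms(3) assms(3)] t[OF assms(1) assms(2) assms(3)]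
  then have "cubic_norm a b c \<le> 27 * M^3" "- cubic_norm a b c \<le> 27 * M^3"
    unfolding eq by linarith+
  then show ?thesis by linarith
qed

lemma cube_floor: "\<exists>M :: nat. M ^ 3 \<le> n \<and> n < (M + 1) ^ 3"
proof (induction n)
  case (Suc n)
  then obtain M where M: "M ^ 3 \<le> n" "n < (M + 1) ^ 3" by blast
  show ?case
  proof (cases "Suc n < (M + 1) ^ 3")
    case True
    then show ?thesis using M le_SucI by blast
  next
    case False
    then have "Suc n = (M + 1) ^ 3" using M by simp
    moreover have "(M + 1) ^ 3 < (M + 1 + 1) ^ 3" by (intro power_strict_mono) auto
    ultimately show ?thesis by (metis order_refl)
  qed
qed (auto intro: exI[of _ 0])

text \<open>Choosing one root of the cubic modulo each prime in \<open>D\<close> cuts out a lattice of index \<open>\<Prod>D\<close>,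
  so the pigeonhole principle yields a short vector.\<close>
lemma short_vector_exists:
  fixes c :: "nat \<Rightarrow> int"
  assumes D: "finite D" "\<And>r. r \<in> D \<Longrightarrow> prime r" and M: "\<Prod>D < (M + 1) ^ 3"
  shows "\<exists>v0 v1 v2 :: int. \<bar>v0\<bar> \<le> int M \<and> \<bar>v1\<bar> \<le> int M \<and> \<bar>v2\<bar> \<le> int M \<and> (v0, v1, v2) \<noteq> (0, 0, 0) \<and>
    (\<forall>r\<in>D. int r dvd v0 + v1 * c r + v2 * (c r)^2)"
proof -
  define I where "I = {0..int M}"
  define f where "f = (\<lambda>(a, b, d). restrict (\<lambda>r. (a + b * c r + d * (c r)^2) mod int r) D)"
  have "f ` (I \<times> I \<times> I) \<subseteq> PiE D (\<lambda>r. {0..<int r})"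
    using D(2) prime_gt_0_nat by (fastforce simp: f_def)
  then have "card (f ` (I \<times> I \<times> I)) \<le> card (PiE D (\<lambda>r. {0..<int r}))"
    using D by (intro card_mono finite_PiE) auto
  also have "\<dots> = \<Prod>D" using D by (simp add: card_PiE)
  also have "\<dots> < (M + 1) ^ 3" by (rule M)
  also have "\<dots> = card (I \<times> I \<times> I)"
    by (simp add: I_def card_cartesian_product power3_eq_cube nat_add_distrib)
  finally have "\<not> inj_on f (I \<times> I \<times> I)" by (rule pigeonhole)
  then have "\<exists>p\<in>I \<times> I \<times> I. \<exists>q\<in>I \<times> I \<times> I. f p = f q \<and> p \<noteq> q"
    by (simp only: inj_on_def not_all not_imp bex_simps Bex_def Ball_def not_ex)
  then obtain p q where pq: "p \<in> I \<times> I \<times> I" "q \<in> I \<times> I \<times> I" "p \<noteq> q" "f p = f q"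
    by (elim bexE conjE) metis
  obtain p0 p1 p2 q0 q1 q2 where p: "p = (p0, p1, p2)" and q: "q = (q0, q1, q2)"
    by (cases p, cases q) blast
  have "int r dvd (p0 - q0) + (p1 - q1) * c r + (p2 - q2) * (c r)^2" if "r \<in> D" for r
  proof -
    have "f p r = f q r" using pq by simp
    then have "int r dvd (p0 + p1 * c r + p2 * (c r)^2) - (q0 + q1 * c r + q2 * (c r)^2)"
      using that by (simp add: f_def p q mod_eq_dvd_iff)
    then show ?thesis by (simp add: algebra_simps)
  qed
  moreover have "\<bar>p0 - q0\<bar> \<le> int M" "\<bar>p1 - q1\<bar> \<le> int M" "\<bar>p2 - q2\<bar> \<le> int M"
    using pq(1,2) by (auto simp: p q I_def)
  moreover have "(p0 - q0, p1 - q1, p2 - q2) \<noteq> (0, 0, 0)" using pq(3) by (auto simp: p q)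
  ultimately show ?thesis by blast
qed


lemma prod_primes_inject:
  assumes "finite D" "\<And>r. r \<in> D \<Longrightarrow> prime r" "finite E" "\<And>r. r \<in> E \<Longrightarrow> prime r" "\<Prod>D = \<Prod>E"
  shows "D = (E :: nat set)"
proof -
  have "{r. prime r \<and> r dvd \<Prod>A} = A" if A: "finite A" "\<And>r. r \<in> A \<Longrightarrow> prime r" for A :: "nat set"
  proof (intro Set.set_eqI iffI)
    fix r assume "r \<in> {r. prime r \<and> r dvd \<Prod>A}"
    then have r: "prime r" "r dvd \<Prod>A" by auto
    then obtain a where "a \<in> A" "r dvd a" using A(1) prime_dvd_prod_iff[of A r "\<lambda>x. x"] by auto
    then show "r \<in> A" using primes_dvd_imp_eq[OF r(1) A(2)[of a]] by simp
  qed (use A dvd_prodI[of A _ "\<lambda>x. x"] in auto)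
  from this[OF assms(1,2)] this[OF assms(3,4)] show ?thesis unfolding assms(5) by (rule trans[OF sym])
qed

text \<open>A pair (D, c) stands for the ideal of Z[u] that is the product of the primes (r, u - c
  r) for r in D, of norm \<open>\<Prod>D\<close>. It contains a short vector whose norm is, up to
  sign, k * \<open>\<Prod>D\<close> with 1 <= k <= 27. The vector together with k determines the
  pair, so it suffices to count short vectors.\<close>

lemma card_root_choices_le:
  fixes S :: "nat set" and X :: nat
  assumes S: "finite S" "\<And>r. r \<in> S \<Longrightarrow> prime r \<and> r > 27" and X: "X \<ge> 1"
  shows "card (SIGMA D:{D. D \<subseteq> S \<and> \<Prod>D \<le> X}. PiE D cubic_roots) \<le> 729 * X"
proof -
  obtain B where B: "B ^ 3 \<le> X" "X < (B + 1) ^ 3" using cube_floor by blast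
  have B1: "B \<ge> 1" using X B by (cases B) auto
  define \<Omega> where "\<Omega> = (SIGMA D:{D. D \<subseteq> S \<and> \<Prod>D \<le> X}. PiE D cubic_roots)"
  define good where "good = (\<lambda>(D, c) (v0, v1, v2) k.
     \<bar>v0\<bar> \<le> int B \<and> \<bar>v1\<bar> \<le> int B \<and> \<bar>v2\<bar> \<le> int B \<and>
     (\<forall>r\<in>D. int r dvd v0 + v1 * c r + v2 * (c r)^2) \<and>
     k \<in> {1..27::nat} \<and> \<bar>cubic_norm v0 v1 v2\<bar> = int (k * \<Prod>D))"
  have pr: "finite D \<and> (\<forall>r\<in>D. prime r \<and> r > 27 \<and> c r \<in> cubic_roots r) \<and> \<Prod>D > 0 \<and> \<Prod>D \<le> X"
    if "(D, c) \<in> \<Omega>" for D c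
  proof -
    from that have D: "D \<subseteq> S" "\<Prod>D \<le> X" "c \<in> PiE D cubic_roots" by (auto simp: \<Omega>_def)
    then have "finite D" using S finite_subset by blast
    moreover have "\<Prod>D > 0" using D S by (intro prod_pos) (auto simp: prime_gt_0_nat)
    ultimately show ?thesis using D S by auto
  qed
  have "\<exists>v k. good w v k" if "w \<in> \<Omega>" for w
  proof -
    obtain D c where w: "w = (D, c)" by force
    note p = pr[OF that[unfolded w]]
    obtain M where M: "M ^ 3 \<le> \<Prod>D" "\<Prod>D < (M + 1) ^ 3" using cube_floor by blast
    obtain v0 v1 v2 where v: "\<bar>v0\<bar> \<le> int M" "\<bar>v1\<bar> \<le> int M" "\<bar>v2\<bar> \<le> int M" "(v0, v1, v2) \<noteq> (0, 0, 0)"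
      "\<forall>r\<in>D. int r dvd v0 + v1 * c r + v2 * (c r)^2"
      using short_vector_exists[of D M c] p M by blast
    have "M \<le> B"
    proof (rule ccontr)
      assume "\<not> M \<le> B"
      then have "(B + 1) ^ 3 \<le> M ^ 3" by (intro power_mono) auto
      then show False using M B p by linarith
    qed
    define n where "n = nat \<bar>cubic_norm v0 v1 v2\<bar>"
    have n0: "n \<noteq> 0" using cubic_norm_eq_0[of v0 v1 v2] v(4) by (auto simp: n_def)
    have "\<forall>r\<in>D. r dvd n"
    proof
      fix r assume r: "r \<in> D"
      then have "int r dvd cubic_norm v0 v1 v2"
        using v(5) p by (intro dvd_cubic_norm[of _ "c r"]) (auto simp: cubic_roots_def)
      then have "int r dvd int n" by (simp add: n_def)
      then show "r dvd n" by presburger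
    qed
    then have "\<Prod>D dvd n" using prod_primes_dvd_iff[of D n] p by blast
    then obtain k where k: "n = \<Prod>D * k" by (rule dvdE)
    have "int n \<le> 27 * int M ^ 3" unfolding n_def using abs_cubic_norm_le[OF v(1-3)] by simp
    then have "int n \<le> int (27 * M ^ 3)" by simp
    then have "n \<le> 27 * M ^ 3" by (simp only: of_nat_le_iff)
    also have "\<dots> \<le> 27 * \<Prod>D" using M by simp
    finally have "\<Prod>D * k \<le> \<Prod>D * 27" using k by simp
    then have "k \<le> 27" using p by (simp only: mult_le_cancel1)
    moreover have "k \<ge> 1" using k n0 by (cases k) auto
    moreover have "\<bar>cubic_norm v0 v1 v2\<bar> = int n" by (simp add: n_def)
    then have "\<bar>cubic_norm v0 v1 v2\<bar> = int (k * \<Prod>D)" by (simp only: k mult.commute)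
    ultimately have "good w (v0, v1, v2) k"
      using v \<open>M \<le> B\<close> \<open>\<bar>cubic_norm v0 v1 v2\<bar> = int (k * \<Prod>D)\<close> by (auto simp: good_def w)
    then show ?thesis by blast
  qed
  then obtain v k where vk: "\<And>w. w \<in> \<Omega> \<Longrightarrow> good w (v w) (k w)" by metis
  define J where "J = {- int B..int B}"
  \<comment> \<open>The norm divided by k gives \<open>\<Prod>D\<close> and hence D. Two different
    roots at r would make r^2 divide k * \<open>\<Prod>D\<close>, but r divides the product only
    once, and r > 27 >= k.\<close>
  have inj: "inj_on (\<lambda>w. (v w, k w)) \<Omega>"
  proof (rule inj_onI)
    fix w1 w2 assume w: "w1 \<in> \<Omega>" "w2 \<in> \<Omega>" "(v w1, k w1) = (v w2, k w2)"
    obtain D c E d where eqs: "w1 = (D, c)" "w2 = (E, d)" by force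
    obtain v0 v1 v2 where v012: "v w1 = (v0, v1, v2)" by (cases "v w1") blast
    define k0 where "k0 = k w1"
    have g1: "good (D, c) (v0, v1, v2) k0" using vk[OF w(1)] v012 eqs k0_def by simp
    have g2: "good (E, d) (v0, v1, v2) k0" using vk[OF w(2)] v012 eqs k0_def w(3) by simp
    note p1 = pr[OF w(1)[unfolded eqs]] and p2 = pr[OF w(2)[unfolded eqs]]
    have "int (k0 * \<Prod>D) = int (k0 * \<Prod>E)" "k0 \<ge> 1" "k0 \<le> 27" using g1 g2 by (auto simp: good_def)
    then have "\<Prod>D = \<Prod>E" by (simp only: of_nat_eq_iff) auto
    then have DE: "D = E" by (intro prod_primes_inject) (use p1 p2 in auto)
    have "c r = d r" if r: "r \<in> D" for r
    proof (rule ccontr)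
      assume ne: "c r \<noteq> d r"
      have cd: "c r \<in> cubic_roots r" "d r \<in> cubic_roots r" "prime r" "r > 27" using p1 p2 r DE by auto
      have "\<not> int r dvd c r - d r"
      proof
        assume "int r dvd c r - d r"
        then have "c r mod int r = d r mod int r" by (simp add: mod_eq_dvd_iff)
        then show False using ne cd by (auto simp: cubic_roots_def)
      qed
      then have "(int r)^2 dvd cubic_norm v0 v1 v2"
        using cd g1 g2 r DE by (intro square_dvd_cubic_norm[of _ "c r" "d r"]) (auto simp: cubic_roots_def good_def)
      then have "(int r)^2 dvd \<bar>cubic_norm v0 v1 v2\<bar>" by simp
      also have "\<dots> = int (k0 * \<Prod>D)" using g1 by (auto simp: good_def)
      finally have "int (r^2) dvd int (k0 * \<Prod>D)" by simp
      then have "r^2 dvd k0 * \<Prod>D" by (simp only: int_dvd_int_iff)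
      moreover have "\<Prod>D = r * \<Prod>(D - {r})" using p1 r by (simp add: prod.remove)
      ultimately have "r * r dvd r * (k0 * \<Prod>(D - {r}))" by (simp add: power2_eq_square mult_ac)
      then have "r dvd k0 * \<Prod>(D - {r})" using cd prime_gt_0_nat by simp
      then consider "r dvd k0" | "r dvd \<Prod>(D - {r})" using cd prime_dvd_mult_iff by blast
      then show False
      proof cases
        case 1
        then show False using \<open>k0 \<ge> 1\<close> \<open>k0 \<le> 27\<close> cd by (auto dest!: dvd_imp_le)
      next
        case 2
        then obtain a where "a \<in> D - {r}" "r dvd a"
          using p1 cd(3) prime_dvd_prod_iff[of "D - {r}" r "\<lambda>x. x"] by (auto simp del: Diff_iff)
        then show False using p1 primes_dvd_imp_eq[OF cd(3), of a] by simp
      qed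
    qed
    moreover have "c \<in> extensional D" "d \<in> extensional D"
      using w eqs DE by (auto simp: \<Omega>_def PiE_def)
    ultimately have "c = d" by (intro extensionalityI)
    then show "w1 = w2" using eqs DE by simp
  qed
  have "(\<lambda>w. (v w, k w)) ` \<Omega> \<subseteq> (J \<times> J \<times> J) \<times> {1..27}"
  proof (rule image_subsetI)
    fix w assume "w \<in> \<Omega>"
    obtain D c where w: "w = (D, c)" by force
    obtain v0 v1 v2 where v012: "v w = (v0, v1, v2)" by (cases "v w") blast
    show "(v w, k w) \<in> (J \<times> J \<times> J) \<times> {1..27}"
      using vk[OF \<open>w \<in> \<Omega>\<close>] unfolding v012 w good_def by (auto simp: J_def)
  qed
  then have "card \<Omega> \<le> card ((J \<times> J \<times> J) \<times> {1..27 :: nat})"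
    by (intro card_inj_on_le[OF inj]) (auto simp: J_def)
  \<comment> \<open>Three coordinates in [-B, B] and 27 values of k; with 2 B + 1 <= 3 B this gives
    729 = 3^3 * 27.\<close>
  also have "\<dots> = (2 * B + 1) ^ 3 * 27"
    by (simp add: card_cartesian_product J_def power3_eq_cube nat_add_distrib nat_mult_distrib)
  also have "\<dots> \<le> (3 * B) ^ 3 * 27" using B1 by (intro mult_right_mono power_mono) auto
  also have "\<dots> = 729 * B ^ 3" by (simp add: power_mult_distrib)
  also have "\<dots> \<le> 729 * X" using B by simp
  finally show ?thesis unfolding \<Omega>_def .
qed

lemma sum_primes_powr_minus_2_le:
  fixes S :: "nat set"
  assumes "finite S" "\<And>r. r \<in> S \<Longrightarrow> r \<ge> 2"
  shows "(\<Sum>r\<in>S. real r powr (-2)) \<le> 1"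
proof -
  have "S \<subseteq> {Suc 1..Max (insert 1 S)}" using assms by (auto simp: numeral_2_eq_2)
  then have "(\<Sum>r\<in>S. real r powr (-2)) \<le> (\<Sum>r\<in>{Suc 1..Max (insert 1 S)}. real r powr (-2))"
    by (intro sum_mono2) auto
  also have "\<dots> \<le> real 1 powr (1 - 2) / (2 - 1)" using sum_powr_le[of 2 1] by simp
  finally show ?thesis by simp
qed

text \<open>Expanding the product of the 1 + 3 r^(-s) counts root choices, so by
  \<open>card_root_choices_le\<close> it is at most 1458 / (s - 1), where 1458 = 2 * 729. Taking
  logarithms shows that the splitting primes have density at most 1/3. The 6 exceeds (8 + 9) / 3,
  with 8 for ln 1458 and 9 for the quadratic terms of the logarithm.\<close>

lemma sum_split_cubic_le:
  fixes S :: "nat set" and s :: real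
  assumes S: "finite S" "\<And>r. r \<in> S \<Longrightarrow> prime r \<and> r > 27 \<and> card (cubic_roots r) \<ge> 3"
    and s: "1 < s" "s \<le> 2"
  shows "(\<Sum>r\<in>S. real r powr (- s)) \<le> ln (1 / (s - 1)) / 3 + 6"
proof -
  define h where "h n = (\<Sum>D\<in>{D\<in>Pow S. \<Prod>D = n}. real (card (PiE D cubic_roots)))" for n
  define M where "M = \<Prod>S"
  have fD: "finite D" if "D \<subseteq> S" for D using that S finite_subset by blast
  have pos: "0 < \<Prod>D" if "D \<subseteq> S" for D
    using that S by (intro prod_pos) (auto simp: prime_gt_0_nat)
  have leM: "\<Prod>D \<le> M" if "D \<subseteq> S" for D
  proof -
    have "\<Prod>D dvd \<Prod>S" using that S by (intro prod_dvd_prod_subset) auto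
    then show ?thesis using pos[of S] by (simp add: M_def dvd_imp_le)
  qed
  have h: "(\<Sum>n=1..X. h n) \<le> 729 * real X" for X
  proof (cases "X = 0")
    case False
    have "(\<Sum>n=1..X. h n) = (\<Sum>D\<in>{D. D \<subseteq> S \<and> \<Prod>D \<le> X}. real (card (PiE D cubic_roots)))"
    proof -
      have "(\<Sum>n=1..X. h n) = (\<Sum>n=1..X. \<Sum>D\<in>{D\<in>{D. D \<subseteq> S \<and> \<Prod>D \<le> X}. \<Prod>D = n}. real (card (PiE D cubic_roots)))"
        unfolding h_def by (rule sum.cong[OF refl], rule sum.cong) auto
      also have "\<dots> = (\<Sum>D\<in>{D. D \<subseteq> S \<and> \<Prod>D \<le> X}. real (card (PiE D cubic_roots)))"
        using S pos by (intro sum.group) (auto simp: Suc_le_eq)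
      finally show ?thesis .
    qed
    also have "\<dots> = real (card (SIGMA D:{D. D \<subseteq> S \<and> \<Prod>D \<le> X}. PiE D cubic_roots))"
      using S fD finite_cubic_roots by (subst card_SigmaI) (auto intro!: finite_PiE)
    also have "\<dots> \<le> real (729 * X)"
      using False S by (intro of_nat_mono card_root_choices_le) auto
    finally show ?thesis by simp
  qed simp
  have "(\<Prod>r\<in>S. 3 * real r powr (- s) + 1) = (\<Sum>D\<in>Pow S. \<Prod>r\<in>D. 3 * real r powr (- s))"
    using prod_add[OF S(1), of "\<lambda>r. 3 * real r powr (- s)" "\<lambda>_. 1"] by simp
  also have "\<dots> \<le> (\<Sum>D\<in>Pow S. real (card (PiE D cubic_roots)) * real (\<Prod>D) powr (- s))"
  proof (rule sum_mono)
    fix D assume D: "D \<in> Pow S"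
    have "(\<Prod>r\<in>D. 3 * real r powr (- s)) = (\<Prod>r\<in>D. 3) * (\<Prod>r\<in>D. real r powr (- s))"
      by (simp add: prod.distrib)
    also have "(\<Prod>r\<in>D. real r powr (- s)) = real (\<Prod>D) powr (- s)"
      unfolding of_nat_prod by (rule prod_powr_distrib[symmetric])
    also have "(\<Prod>r\<in>D. 3) \<le> (\<Prod>r\<in>D. real (card (cubic_roots r)))"
      using D S by (intro prod_mono) fastforce
    also have "\<dots> = real (card (PiE D cubic_roots))" using D fD by (simp add: card_PiE)
    finally show "(\<Prod>r\<in>D. 3 * real r powr (- s)) \<le> real (card (PiE D cubic_roots)) * real (\<Prod>D) powr (- s)"
      by (simp add: mult_right_mono)
  qed
  also have "\<dots> = (\<Sum>n=1..M. h n * real n powr (- s))"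
  proof -
    have "(\<Sum>n=1..M. h n * real n powr (- s)) = (\<Sum>n=1..M. \<Sum>D\<in>{D\<in>Pow S. \<Prod>D = n}. real (card (PiE D cubic_roots)) * real (\<Prod>D) powr (- s))"
      unfolding h_def sum_distrib_right by (rule sum.cong[OF refl], rule sum.cong) auto
    also have "\<dots> = (\<Sum>D\<in>Pow S. real (card (PiE D cubic_roots)) * real (\<Prod>D) powr (- s))"
      using S pos leM by (intro sum.group) (auto simp: Suc_le_eq)
    finally show ?thesis by simp
  qed
  also have "\<dots> \<le> 729 * (\<Sum>n=1..M. real n powr (- s))"
    using s h by (intro sum_weighted_le) (auto intro!: powr_mono2')
  also have "\<dots> \<le> 729 * (1 + 1 / (s - 1))"
    using sum_powr_le_zeta s by (intro mult_left_mono) auto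
  also have "\<dots> \<le> 1458 * (1 / (s - 1))"
  proof -
    have "1 \<le> 1 / (s - 1)" using s by (simp add: le_divide_eq)
    then show ?thesis by simp
  qed
  finally have P: "(\<Prod>r\<in>S. 3 * real r powr (- s) + 1) \<le> 1458 * (1 / (s - 1))" .
  have pos1: "3 * real r powr (- s) + 1 > 0" for r
    using powr_ge_zero[of "real r" "- s"] by linarith
  have small: "3 * real r powr (- s) \<le> 1" if "r \<in> S" for r
  proof -
    have "real r powr (- s) \<le> real r powr (- 1)" using S(2)[OF that] s by (intro powr_mono) auto
    also have "\<dots> = 1 / real r" using S(2)[OF that] by (subst powr_minus_divide) auto
    also have "\<dots> \<le> 1 / 3" using S(2)[OF that] by (intro divide_left_mono) auto
    finally show ?thesis by simp
  qed
  have "(\<Sum>r\<in>S. 3 * real r powr (- s)) - 9 \<le> (\<Sum>r\<in>S. 3 * real r powr (- s)) - 9 * (\<Sum>r\<in>S. real r powr (-2))"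
    using sum_primes_powr_minus_2_le[OF S(1)] S by fastforce
  also have "\<dots> \<le> (\<Sum>r\<in>S. 3 * real r powr (- s) - (3 * real r powr (- s))^2)"
    unfolding sum_subtractf sum_distrib_left
  proof (intro diff_left_mono sum_mono)
    fix r assume r: "r \<in> S"
    then have "r > 0" using S by fastforce
    have "(real r powr (- s))^2 = real r powr (- 2 * s)" 
      using \<open>r > 0\<close> by (simp add: powr_powr mult.commute flip: powr_numeral)
    also have "\<dots> \<le> real r powr (- 2)" using s \<open>r > 0\<close> by (intro powr_mono) auto
    finally show "(3 * real r powr (- s))^2 \<le> 9 * real r powr (- 2)" by (simp add: power_mult_distrib)
  qed
  also have "\<dots> \<le> (\<Sum>r\<in>S. ln (3 * real r powr (- s) + 1))"
    using small by (intro sum_mono) (subst add.commute, intro ln_one_plus_pos_lower_bound, auto)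
  also have "\<dots> = ln (\<Prod>r\<in>S. 3 * real r powr (- s) + 1)"
    by (intro ln_prod[symmetric] S less_imp_neq[OF pos1, symmetric])
  also have "\<dots> \<le> ln (1458 * (1 / (s - 1)))"
    using P pos1 by (intro ln_mono prod_pos) auto
  also have "\<dots> = ln 1458 + ln (1 / (s - 1))" using s by (intro ln_mult_pos) auto
  also have "ln 1458 \<le> (8 :: real)"
  proof -
    have "(1458 :: real) \<le> (5 / 2) ^ 8" by (simp add: power_divide)
    also have "(5 / 2 :: real) ^ 8 \<le> exp 1 ^ 8"
      by (intro power_mono) (use exp_lower_Taylor_quadratic[of 1] in auto)
    also have "\<dots> = exp 8" by (simp flip: exp_of_nat_mult)
    finally have "(1458 :: real) \<le> exp 8" .
    then have "ln 1458 \<le> ln (exp 8 :: real)" by (subst ln_le_cancel_iff) auto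
    then show ?thesis by simp
  qed
  finally show ?thesis by (simp add: sum_distrib_left[symmetric])
qed

section \<open>L-functions to the right of 1\<close>

text \<open>Vanishing at integers not coprime to q is not demanded. Thus the constant 1 is a
  character with q = 1, and characters modulo 2^a and modulo 5 * 2^a can share the modulus 5 *
  2^a.\<close>

definition dirichlet_char :: "nat \<Rightarrow> (nat \<Rightarrow> complex) \<Rightarrow> bool" where
  "dirichlet_char q ch \<longleftrightarrow> ch 1 = 1 \<and> (\<forall>m n. ch (m * n) = ch m * ch n) \<and>
     (\<forall>n. ch (n + q) = ch n) \<and> (\<forall>n. norm (ch n) \<le> 1)"

text \<open>Since \<open>0 powr a = 0\<close>, the term at \<open>n = 0\<close> vanishes.\<close>
definition L_term :: "(nat \<Rightarrow> complex) \<Rightarrow> real \<Rightarrow> nat \<Rightarrow> complex" where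
  "L_term ch s n = ch n * of_real (real n powr (- s))"

definition L_fun :: "(nat \<Rightarrow> complex) \<Rightarrow> real \<Rightarrow> complex" where
  "L_fun ch s = infsum (L_term ch s) UNIV"

lemma dirichlet_charD:
  assumes "dirichlet_char q ch"
  shows "ch (Suc 0) = 1" "ch (m * n) = ch m * ch n" "ch (n + q) = ch n" "norm (ch n) \<le> 1"
  using assms by (auto simp: dirichlet_char_def)

lemma L_term_0 [simp]: "L_term ch s 0 = 0"
  by (simp add: L_term_def)

lemma L_term_1: "dirichlet_char q ch \<Longrightarrow> L_term ch s (Suc 0) = 1"
  by (simp add: L_term_def dirichlet_charD)

lemma L_term_mult: "dirichlet_char q ch \<Longrightarrow> L_term ch s (m * n) = L_term ch s m * L_term ch s n"
  by (simp add: L_term_def dirichlet_charD powr_mult)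

lemma norm_L_term: "dirichlet_char q ch \<Longrightarrow> norm (L_term ch s n) \<le> real n powr (- s)"
  using dirichlet_charD(4)[of q ch n] by (simp add: L_term_def norm_mult mult_left_le_one_le)

lemma L_term_abs_summable:
  assumes "dirichlet_char q ch" "s > 1"
  shows "summable (\<lambda>n. norm (L_term ch s n))"
  by (rule summable_comparison_test[OF _ iffD2[OF summable_real_powr_iff[of "- s"]]])
     (use assms norm_L_term in auto)

lemma L_term_summable_on:
  assumes "dirichlet_char q ch" "s > 1"
  shows "L_term ch s summable_on A"
  using norm_summable_imp_summable_on[OF L_term_abs_summable[OF assms]]
  by (rule summable_on_subset_banach) auto

lemma L_term_sums:
  assumes "dirichlet_char q ch" "s > 1"
  shows "L_term ch s sums L_fun ch s"
  unfolding L_fun_def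
  by (intro has_sum_imp_sums has_sum_infsum L_term_summable_on[OF assms])

lemma L_fun_partial_sums:
  assumes "dirichlet_char q ch" "s > 1"
  shows "(\<lambda>N. \<Sum>n=1..N. L_term ch s n) \<longlonglongrightarrow> L_fun ch s"
proof -
  have "(\<Sum>n=1..N. L_term ch s n) = (\<Sum>n<Suc N. L_term ch s n)" for N
    by (rule sum.mono_neutral_left) (auto simp: not_less_eq_eq less_Suc_eq_le Suc_le_eq)
  then show ?thesis
    using LIMSEQ_Suc[OF L_term_sums[OF assms, unfolded sums_def]] by simp
qed

text \<open>Splitting off the multiples p * m of one prime multiplies the sum by
  \<open>1 - L_term ch s p\<close>, by complete multiplicativity.\<close>

lemma infsum_coprime:
  assumes ch: "dirichlet_char q ch" and s: "s > 1" and P: "finite P" "\<And>p. p \<in> P \<Longrightarrow> prime p"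
  shows "infsum (L_term ch s) {n. \<forall>p\<in>P. \<not> p dvd n} = L_fun ch s * (\<Prod>p\<in>P. 1 - L_term ch s p)"
  using P
proof (induction P rule: finite_induct)
  case (insert p P)
  define S where "S = {n. \<forall>p\<in>P. \<not> p dvd n}"
  define S' where "S' = {n. \<forall>p\<in>insert p P. \<not> p dvd n}"
  have p: "prime p" using insert.prems by auto
  have "S = S' \<union> (\<lambda>m. p * m) ` S"
  proof (intro equalityI subsetI)
    fix n assume n: "n \<in> S"
    show "n \<in> S' \<union> (\<lambda>m. p * m) ` S"
    proof (cases "p dvd n")
      case True
      then obtain m where m: "n = p * m" by (rule dvdE)
      have "m \<in> S" using n by (auto simp: S_def m)
      then show ?thesis using m by blast
    qed (use n in \<open>auto simp: S_def S'_def\<close>)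
  next
    fix n assume "n \<in> S' \<union> (\<lambda>m. p * m) ` S"
    then consider "n \<in> S'" | m where "n = p * m" "m \<in> S" by auto
    then show "n \<in> S"
    proof cases
      case 2
      have "\<not> r dvd p * m" if "r \<in> P" for r
      proof
        assume "r dvd p * m"
        moreover have "prime r" using that insert.prems by auto
        ultimately have "r dvd p \<or> r dvd m" using prime_dvd_mult_iff by blast
        moreover have "\<not> r dvd m" using 2 that by (auto simp: S_def)
        ultimately have "r = p" using primes_dvd_imp_eq[OF \<open>prime r\<close> p] by blast
        then show False using that insert.hyps by simp
      qed
      then show ?thesis using 2 by (auto simp: S_def)
    qed (auto simp: S_def S'_def)
  qed
  then have "infsum (L_term ch s) S = infsum (L_term ch s) (S' \<union> (\<lambda>m. p * m) ` S)" by simp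
  also have "\<dots> = infsum (L_term ch s) S' + infsum (L_term ch s) ((\<lambda>m. p * m) ` S)"
    by (intro infsum_Un_disjoint L_term_summable_on[OF ch s]) (auto simp: S'_def)
  also have "infsum (L_term ch s) ((\<lambda>m. p * m) ` S) = infsum (L_term ch s \<circ> (\<lambda>m. p * m)) S"
    using p prime_gt_0_nat by (intro infsum_reindex) (auto simp: inj_on_def)
  also have "\<dots> = infsum (\<lambda>m. L_term ch s p * L_term ch s m) S"
    by (simp add: o_def L_term_mult[OF ch])
  also have "\<dots> = L_term ch s p * infsum (L_term ch s) S" by (rule infsum_cmult_right')
  finally have "infsum (L_term ch s) S' = infsum (L_term ch s) S - L_term ch s p * infsum (L_term ch s) S"
    by (rule iffD2[OF eq_diff_eq sym])
  also have "\<dots> = (1 - L_term ch s p) * infsum (L_term ch s) S"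
    by (simp only: left_diff_distrib mult_1)
  also have "infsum (L_term ch s) S = L_fun ch s * (\<Prod>p\<in>P. 1 - L_term ch s p)"
    unfolding S_def using insert by auto
  finally show ?case using insert.hyps by (simp add: S'_def mult_ac)
qed (simp add: L_fun_def)

lemma norm_infsum_L_term_tail:
  assumes ch: "dirichlet_char q ch" and s: "s > 1" and k: "k > 0" and R: "R \<subseteq> {n. n = 0 \<or> n > k}"
  shows "norm (infsum (L_term ch s) R) \<le> real k powr (1 - s) / (s - 1)"
proof -
  have abs: "(\<lambda>n. norm (L_term ch s n)) summable_on R"
    using L_term_summable_on[OF ch s] by (simp add: summable_on_iff_abs_summable_on_complex)
  have "norm (infsum (L_term ch s) R) \<le> infsum (\<lambda>n. norm (L_term ch s n)) R"
    by (rule norm_infsum_bound) (rule abs)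
  also have "\<dots> \<le> real k powr (1 - s) / (s - 1)"
  proof (rule infsum_le_finite_sums[OF abs])
    fix F assume F: "finite F" "F \<subseteq> R"
    have "(\<Sum>n\<in>F. norm (L_term ch s n)) \<le> (\<Sum>n\<in>insert 0 {Suc k..Max (insert 0 F)}. norm (L_term ch s n))"
    proof (rule sum_mono2)
      show "F \<subseteq> insert 0 {Suc k..Max (insert 0 F)}"
      proof
        fix x assume "x \<in> F"
        then have "x = 0 \<or> x > k" "x \<le> Max (insert 0 F)" using F R by auto
        then show "x \<in> insert 0 {Suc k..Max (insert 0 F)}" by auto
      qed
    qed auto
    also have "\<dots> = (\<Sum>n\<in>{Suc k..Max (insert 0 F)}. norm (L_term ch s n))" by simp
    also have "\<dots> \<le> (\<Sum>n\<in>{Suc k..Max (insert 0 F)}. real n powr (- s))"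
      by (intro sum_mono norm_L_term[OF ch])
    also have "\<dots> \<le> real k powr (1 - s) / (s - 1)" by (rule sum_powr_le[OF s k])
    finally show "(\<Sum>n\<in>F. norm (L_term ch s n)) \<le> real k powr (1 - s) / (s - 1)" .
  qed
  finally show ?thesis .
qed

definition primes_le :: "nat \<Rightarrow> nat set" where
  "primes_le N = {p. prime p \<and> p \<le> N}"

lemma finite_primes_le [simp]: "finite (primes_le N)"
  by (rule finite_subset[of _ "{..N}"]) (auto simp: primes_le_def)

text \<open>Removing all primes up to N leaves the term 1 and a tail beyond N. With the factors kept
  on the side of L, the limit 1 yields L nonzero at once.\<close>

lemma Euler_product:
  assumes ch: "dirichlet_char q ch" and s: "s > 1"
  shows "(\<lambda>N. L_fun ch s * (\<Prod>p\<in>primes_le N. 1 - L_term ch s p)) \<longlonglongrightarrow> 1"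
proof -
  have bound: "norm (L_fun ch s * (\<Prod>p\<in>primes_le N. 1 - L_term ch s p) - 1) \<le> real N powr (1 - s) / (s - 1)"
    if N: "N > 0" for N
  proof -
    define S where "S = {n. \<forall>p\<in>primes_le N. \<not> p dvd n}"
    have 1: "Suc 0 \<in> S" by (auto simp: S_def primes_le_def)
    have R: "S - {Suc 0} \<subseteq> {n. n = 0 \<or> n > N}"
    proof
      fix n assume n: "n \<in> S - {Suc 0}"
      then obtain p where p: "prime p" "p dvd n" using prime_factor_nat[of n] by auto
      then have "\<not> p \<le> N" using n by (auto simp: S_def primes_le_def)
      then show "n \<in> {n. n = 0 \<or> n > N}" using p dvd_imp_le[of p n] by (cases "n = 0") auto
    qed
    have "infsum (L_term ch s) S = infsum (L_term ch s) ({Suc 0} \<union> (S - {Suc 0}))"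
      using 1 by (simp add: insert_absorb)
    also have "\<dots> = infsum (L_term ch s) {Suc 0} + infsum (L_term ch s) (S - {Suc 0})"
      by (intro infsum_Un_disjoint L_term_summable_on[OF ch s]) auto
    finally have "infsum (L_term ch s) S - 1 = infsum (L_term ch s) (S - {Suc 0})"
      by (simp add: L_term_1[OF ch])
    moreover have "infsum (L_term ch s) S = L_fun ch s * (\<Prod>p\<in>primes_le N. 1 - L_term ch s p)"
      unfolding S_def by (rule infsum_coprime[OF ch s]) (auto simp: primes_le_def)
    ultimately show ?thesis using norm_infsum_L_term_tail[OF ch s N R] by simp
  qed
  have "(\<lambda>N. real N powr (1 - s)) \<longlonglongrightarrow> 0"
    using s by (intro tendsto_neg_powr filterlim_real_sequentially) auto
  then have "(\<lambda>N. real N powr (1 - s) / (s - 1)) \<longlonglongrightarrow> 0"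
    by (rule tendsto_divide_zero)
  moreover have "\<forall>\<^sub>F N in sequentially. norm (L_fun ch s * (\<Prod>p\<in>primes_le N. 1 - L_term ch s p) - 1)
      \<le> real N powr (1 - s) / (s - 1)"
    by (rule eventually_mono[OF eventually_gt_at_top[of 0]]) (rule bound)
  ultimately have "(\<lambda>N. L_fun ch s * (\<Prod>p\<in>primes_le N. 1 - L_term ch s p) - 1) \<longlonglongrightarrow> 0"
    by (rule Lim_null_comparison[rotated])
  then show ?thesis by (rule LIM_zero_cancel)
qed

lemma L_fun_nonzero:
  assumes "dirichlet_char q ch" "s > 1"
  shows "L_fun ch s \<noteq> 0"
proof
  assume "L_fun ch s = 0"
  then have "(\<lambda>N. 0 :: complex) \<longlonglongrightarrow> 1" using Euler_product[OF assms] by simp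
  then show False using LIMSEQ_unique[OF tendsto_const] by (metis zero_neq_one)
qed

lemma norm_L_term_prime:
  assumes "dirichlet_char q ch" "s > 1" "prime p"
  shows "norm (L_term ch s p) \<le> 1 / 2"
proof -
  have p: "real p \<ge> 2" using prime_ge_2_nat[OF assms(3)] by simp
  have "norm (L_term ch s p) \<le> real p powr (- s)" by (rule norm_L_term[OF assms(1)])
  also have "\<dots> \<le> real p powr (- 1)" using p assms by (intro powr_mono) auto
  also have "\<dots> = 1 / real p" using p by (subst powr_minus_divide) auto
  also have "\<dots> \<le> 1 / 2" using p by (intro divide_left_mono) auto
  finally show ?thesis .
qed

lemma ln_norm_L_fun:
  assumes ch: "dirichlet_char q ch" and s: "s > 1"
  shows "(\<lambda>N. \<Sum>p\<in>primes_le N. - ln (norm (1 - L_term ch s p))) \<longlonglongrightarrow> ln (norm (L_fun ch s))"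
proof -
  have nz: "norm (1 - L_term ch s p) > 0" if "prime p" for p
    using norm_L_term_prime[OF ch s that] by (auto simp: norm_mult)
  have "(\<lambda>N. ln (norm (L_fun ch s * (\<Prod>p\<in>primes_le N. 1 - L_term ch s p)))) \<longlonglongrightarrow> ln (norm (1 :: complex))"
    by (intro tendsto_ln tendsto_norm Euler_product[OF ch s]) auto
  moreover have "ln (norm (L_fun ch s * (\<Prod>p\<in>primes_le N. 1 - L_term ch s p)))
      = ln (norm (L_fun ch s)) - (\<Sum>p\<in>primes_le N. - ln (norm (1 - L_term ch s p)))" for N
  proof -
    have pos: "0 < norm (\<Prod>p\<in>primes_le N. 1 - L_term ch s p)"
      unfolding prod_norm[symmetric] by (intro prod_pos nz) (auto simp: primes_le_def)
    have "ln (norm (\<Prod>p\<in>primes_le N. 1 - L_term ch s p)) = (\<Sum>p\<in>primes_le N. ln (norm (1 - L_term ch s p)))"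
      unfolding prod_norm[symmetric]
      by (intro ln_prod less_imp_neq[OF nz, symmetric]) (auto simp: primes_le_def)
    then show ?thesis
      unfolding norm_mult using pos L_fun_nonzero[OF ch s] by (subst ln_mult_pos) (auto simp: sum_negf)
  qed
  ultimately have "(\<lambda>N. ln (norm (L_fun ch s)) - (\<Sum>p\<in>primes_le N. - ln (norm (1 - L_term ch s p)))) \<longlonglongrightarrow> 0"
    by simp
  from tendsto_diff[OF tendsto_const[of "ln (norm (L_fun ch s))"] this] show ?thesis by simp
qed

lemma ln_norm_one_minus_approx:
  fixes z :: complex
  assumes "norm z \<le> 1 / 2"
  shows "\<bar>- ln (norm (1 - z)) - Re z\<bar> \<le> 2 * norm z ^ 2"
proof -
  have "1 - z \<noteq> 0" using assms by auto
  then have "ln (norm (1 - z)) = Re (Ln (1 + - z))" by simp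
  then have "\<bar>- ln (norm (1 - z)) - Re z\<bar> = \<bar>Re (Ln (1 + - z) - (- z))\<bar>" by simp
  also have "\<dots> \<le> norm (Ln (1 + - z) - (- z))" by (rule abs_Re_le_cmod)
  also have "\<dots> \<le> norm (- z) ^ 2 / (1 - norm (- z))" using assms by (intro Ln_approx_linear) auto
  also have "\<dots> \<le> norm z ^ 2 / (1 / 2)" using assms by (intro frac_le) auto
  finally show ?thesis by simp
qed

text \<open>T is the exact sum of -ln |1 - z| over p <= N. Replacing this logarithm by Re z costs at
  most 2 for each character, uniformly in N and s, so bounds for finite prime sums pass to ln |L|
  without any convergence statement for prime series.\<close>

lemma sum_ln_L_fun_approx:
  fixes c :: "'i \<Rightarrow> real"
  assumes I: "finite I" and ch: "\<And>i. i \<in> I \<Longrightarrow> dirichlet_char (q i) (ch i)" and s: "s > 1"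
    and c: "\<And>i. i \<in> I \<Longrightarrow> \<bar>c i\<bar> \<le> 1"
  shows "\<exists>T. T \<longlonglongrightarrow> (\<Sum>i\<in>I. c i * ln (norm (L_fun (ch i) s))) \<and>
    (\<forall>N. \<bar>T N - (\<Sum>p\<in>primes_le N. (\<Sum>i\<in>I. c i * Re (ch i p)) * real p powr (- s))\<bar> \<le> 2 * real (card I))"
proof (intro exI conjI allI)
  define T where "T N = (\<Sum>i\<in>I. c i * (\<Sum>p\<in>primes_le N. - ln (norm (1 - L_term (ch i) s p))))" for N
  show "T \<longlonglongrightarrow> (\<Sum>i\<in>I. c i * ln (norm (L_fun (ch i) s)))"
    unfolding T_def by (intro tendsto_sum tendsto_mult tendsto_const ln_norm_L_fun[OF ch s])
  fix N
  have "(\<Sum>p\<in>primes_le N. (\<Sum>i\<in>I. c i * Re (ch i p)) * real p powr (- s))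
      = (\<Sum>i\<in>I. c i * (\<Sum>p\<in>primes_le N. Re (L_term (ch i) s p)))"
    unfolding sum_distrib_right sum_distrib_left L_term_def
    by (subst sum.swap) (simp add: mult_ac)
  then have "\<bar>T N - (\<Sum>p\<in>primes_le N. (\<Sum>i\<in>I. c i * Re (ch i p)) * real p powr (- s))\<bar>
      = \<bar>\<Sum>i\<in>I. c i * (\<Sum>p\<in>primes_le N. - ln (norm (1 - L_term (ch i) s p)) - Re (L_term (ch i) s p))\<bar>"
    by (simp only: T_def sum_subtractf right_diff_distrib)
  also have "\<dots> \<le> (\<Sum>i\<in>I. 2)"
  proof (rule order_trans[OF sum_abs], rule sum_mono)
    fix i assume i: "i \<in> I"
    have "\<bar>c i * (\<Sum>p\<in>primes_le N. - ln (norm (1 - L_term (ch i) s p)) - Re (L_term (ch i) s p))\<bar>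
        \<le> 1 * (\<Sum>p\<in>primes_le N. 2 * real p powr (- 2))"
      unfolding abs_mult
    proof (intro mult_mono c i order_trans[OF sum_abs] sum_mono)
      fix p assume "p \<in> primes_le N"
      then have p: "prime p" by (auto simp: primes_le_def)
      then have p2: "real p \<ge> 2" using prime_ge_2_nat by (metis of_nat_le_iff of_nat_numeral)
      have "\<bar>- ln (norm (1 - L_term (ch i) s p)) - Re (L_term (ch i) s p)\<bar> \<le> 2 * norm (L_term (ch i) s p) ^ 2"
        by (intro ln_norm_one_minus_approx norm_L_term_prime[OF ch[OF i] s p])
      also have "norm (L_term (ch i) s p) ^ 2 \<le> (real p powr (- s)) ^ 2"
        by (intro power_mono norm_L_term[OF ch[OF i]]) auto
      also have "(real p powr (- s)) ^ 2 = real p powr (- 2 * s)"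
        using p2 by (simp add: powr_powr mult.commute flip: powr_numeral)
      also have "\<dots> \<le> real p powr (- 2)" using s p2 by (intro powr_mono) auto
      finally show "\<bar>- ln (norm (1 - L_term (ch i) s p)) - Re (L_term (ch i) s p)\<bar> \<le> 2 * real p powr (- 2)"
        by simp
    qed auto
    also have "\<dots> \<le> 2" using sum_primes_powr_minus_2_le[of "primes_le N"] prime_ge_2_nat
      by (auto simp: primes_le_def simp flip: sum_distrib_left)
    finally show "\<bar>c i * (\<Sum>p\<in>primes_le N. - ln (norm (1 - L_term (ch i) s p)) - Re (L_term (ch i) s p))\<bar> \<le> 2" .
  qed
  finally show "\<bar>T N - (\<Sum>p\<in>primes_le N. (\<Sum>i\<in>I. c i * Re (ch i p)) * real p powr (- s))\<bar> \<le> 2 * real (card I)"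
    by simp
qed

lemma sum_ln_L_fun_le:
  fixes c :: "'i \<Rightarrow> real"
  assumes "finite I" "\<And>i. i \<in> I \<Longrightarrow> dirichlet_char (q i) (ch i)" "s > 1" "\<And>i. i \<in> I \<Longrightarrow> \<bar>c i\<bar> \<le> 1"
    and B: "\<And>N. (\<Sum>p\<in>primes_le N. (\<Sum>i\<in>I. c i * Re (ch i p)) * real p powr (- s)) \<le> B"
  shows "(\<Sum>i\<in>I. c i * ln (norm (L_fun (ch i) s))) \<le> B + 2 * real (card I)"
proof -
  obtain T where T: "T \<longlonglongrightarrow> (\<Sum>i\<in>I. c i * ln (norm (L_fun (ch i) s)))"
    "\<And>N. \<bar>T N - (\<Sum>p\<in>primes_le N. (\<Sum>i\<in>I. c i * Re (ch i p)) * real p powr (- s))\<bar> \<le> 2 * real (card I)"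
    using sum_ln_L_fun_approx[of I q ch s c] assms(1-4) by blast
  have "T N \<le> B + 2 * real (card I)" for N using T(2)[of N] B[of N] by linarith
  then show ?thesis by (intro LIMSEQ_le_const2[OF T(1)]) auto
qed

lemma sum_ln_L_fun_ge:
  fixes c :: "'i \<Rightarrow> real"
  assumes "finite I" "\<And>i. i \<in> I \<Longrightarrow> dirichlet_char (q i) (ch i)" "s > 1" "\<And>i. i \<in> I \<Longrightarrow> \<bar>c i\<bar> \<le> 1"
    and B: "\<And>N. (\<Sum>p\<in>primes_le N. (\<Sum>i\<in>I. c i * Re (ch i p)) * real p powr (- s)) \<ge> B"
  shows "(\<Sum>i\<in>I. c i * ln (norm (L_fun (ch i) s))) \<ge> B - 2 * real (card I)"
proof -
  have "(\<Sum>i\<in>I. - c i * ln (norm (L_fun (ch i) s))) \<le> - B + 2 * real (card I)"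
    using assms(1-4) B by (intro sum_ln_L_fun_le) (auto simp: sum_negf)
  then show ?thesis by (simp add: sum_negf)
qed

section \<open>Size and variation of L-functions by partial summation\<close>

lemma Abel_summation:
  fixes a g :: "nat \<Rightarrow> 'a :: comm_ring"
  shows "(\<Sum>n=1..N. a n * g n) = (\<Sum>n=1..N. a n) * g N + (\<Sum>n=1..<N. (\<Sum>m=1..n. a m) * (g n - g (Suc n)))"
proof (induction N)
  case (Suc N)
  show ?case
  proof (cases "N = 0")
    case False
    then have "{1..<Suc N} = insert N {1..<N}" by auto
    then show ?thesis using Suc by (simp add: algebra_simps)
  qed simp
qed simp

lemma sum_telescope_from_1:
  fixes g :: "nat \<Rightarrow> 'a :: ab_group_add"
  shows "N \<ge> 1 \<Longrightarrow> (\<Sum>n=1..<N. g n - g (Suc n)) = g 1 - g N"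
  by (induction N rule: dec_induct) (simp_all add: algebra_simps)

lemma norm_Abel_summation_le:
  fixes a :: "nat \<Rightarrow> complex" and g :: "nat \<Rightarrow> real"
  assumes B: "\<And>N. norm (\<Sum>n=1..N. a n) \<le> B"
  shows "norm (\<Sum>n=1..N. a n * of_real (g n)) \<le> B * (\<bar>g N\<bar> + (\<Sum>n=1..<N. \<bar>g n - g (Suc n)\<bar>))"
proof -
  have "(\<Sum>n=1..N. a n * of_real (g n)) = (\<Sum>n=1..N. a n) * of_real (g N)
      + (\<Sum>n=1..<N. (\<Sum>m=1..n. a m) * of_real (g n - g (Suc n)))"
    using Abel_summation[of a "\<lambda>n. of_real (g n)" N] by simp
  also have "norm \<dots> \<le> norm ((\<Sum>n=1..N. a n) * of_real (g N))
      + (\<Sum>n=1..<N. norm ((\<Sum>m=1..n. a m) * complex_of_real (g n - g (Suc n))))"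
    by (intro norm_triangle_mono order_refl norm_sum)
  also have "\<dots> \<le> B * \<bar>g N\<bar> + (\<Sum>n=1..<N. B * \<bar>g n - g (Suc n)\<bar>)"
    unfolding norm_mult norm_of_real by (intro add_mono sum_mono mult_right_mono B) auto
  finally show ?thesis by (simp add: distrib_left sum_distrib_left)
qed

lemma norm_L_fun_le_of_partial:
  assumes "dirichlet_char q ch" "s > 1" "\<And>N. norm (\<Sum>n=1..N. L_term ch s n) \<le> C"
  shows "norm (L_fun ch s) \<le> C"
  using tendsto_norm[OF L_fun_partial_sums[OF assms(1,2)]] assms(3)
  by (intro LIMSEQ_le_const2) auto

lemma norm_L_fun_le:
  assumes ch: "dirichlet_char q ch" and s: "s > 1" and B: "\<And>N. norm (\<Sum>n=1..N. ch n) \<le> B"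
  shows "norm (L_fun ch s) \<le> B"
proof (rule norm_L_fun_le_of_partial[OF ch s])
  fix N
  define g where "g n = real n powr (- s)" for n :: nat
  have B0: "B \<ge> 0" using B[of 0] by simp
  show "norm (\<Sum>n=1..N. L_term ch s n) \<le> B"
  proof (cases "N = 0")
    case False
    have "\<bar>g n - g (Suc n)\<bar> = g n - g (Suc n)" if "n \<ge> 1" for n
      using that s unfolding g_def by (intro abs_of_nonneg) (auto intro!: powr_mono2')
    then have "(\<Sum>n=1..<N. \<bar>g n - g (Suc n)\<bar>) = (\<Sum>n=1..<N. g n - g (Suc n))"
      by (intro sum.cong) auto
    also have "\<dots> = g 1 - g N"
      using False by (intro sum_telescope_from_1) auto
    finally have "\<bar>g N\<bar> + (\<Sum>n=1..<N. \<bar>g n - g (Suc n)\<bar>) = 1" by (simp add: g_def)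
    then show ?thesis using norm_Abel_summation_le[OF B, of g N] by (simp add: L_term_def g_def)
  qed (use B0 in simp)
qed

lemma powr_diff_le:
  fixes x s :: real
  assumes "x > 0" "s > 0"
  shows "x powr (- s) - (x + 1) powr (- s) \<le> s * x powr (- s - 1)"
proof -
  have e: "1 - (s + 1) = - s" "s + 1 - 1 = s" "- (s + 1) = - s - 1" by auto
  have "(x powr (- s) - (x + 1) powr (- s)) / s \<le> x powr (- s - 1)"
    using assms by (intro powr_diff_bounds(2)[of x "s + 1", unfolded e]) auto
  then show ?thesis by (simp only: pos_divide_le_eq[OF assms(2)] mult.commute)
qed

text \<open>With d = s' - s, g n = n^(-s) (1 - n^(-d)), and the increment is split by the product
  rule into u - v. For u, 1 - n^(-d) <= d ln n <= 2 d sqrt n; for v, one difference already carries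
  d. Both are O(d n^(-3/2)), summable uniformly as s tends to 1.\<close>

lemma L_fun_Lipschitz_aux:
  fixes s s' :: real and n :: nat
  assumes s: "1 < s" "s < s'" "s' \<le> 2" and n: "n \<ge> 1"
  defines "g \<equiv> \<lambda>n. real n powr (- s) - real n powr (- s')"
  shows "\<bar>g n - g (Suc n)\<bar> \<le> 5 * (s' - s) * real n powr (- 3 / 2)"
proof -
  define x d where "x = real n" and "d = s' - s"
  have x: "x \<ge> 1" and d: "d > 0" using n s by (auto simp: x_def d_def)
  have g: "g n = x powr (- s) * (1 - x powr (- d))" "g (Suc n) = (x + 1) powr (- s) * (1 - (x + 1) powr (- d))"
  proof -
    have "y powr (- s) - y powr (- s') = y powr (- s) * (1 - y powr (- d))" if "y > 0" for y :: real
      using that by (simp add: right_diff_distrib d_def flip: powr_add)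
    from this[of x] this[of "x + 1"] show "g n = x powr (- s) * (1 - x powr (- d))"
      "g (Suc n) = (x + 1) powr (- s) * (1 - (x + 1) powr (- d))"
      using x by (simp_all add: g_def x_def add.commute)
  qed
  define u v where "u = (x powr (- s) - (x + 1) powr (- s)) * (1 - x powr (- d))"
    and "v = (x + 1) powr (- s) * (x powr (- d) - (x + 1) powr (- d))"
  have uv: "g n - g (Suc n) = u - v" unfolding g u_def v_def by (simp add: algebra_simps)
  have d1: "0 \<le> x powr (- s) - (x + 1) powr (- s)" using x s by (auto intro!: powr_mono2')
  have d2: "0 \<le> x powr (- d) - (x + 1) powr (- d)" using x d by (auto intro!: powr_mono2')
  have d3: "0 \<le> 1 - x powr (- d)"
    using x d powr_mono2'[of "- d" 1 x] by simp
  have u0: "u \<ge> 0" unfolding u_def using d1 d3 by simp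
  have v0: "v \<ge> 0" unfolding v_def using d2 by simp
  have "u \<le> (2 * x powr (- 2)) * (2 * d * x powr (1 / 2))"
    unfolding u_def
  proof (rule mult_mono[OF _ _ _ d3])
    have "x powr (- s) - (x + 1) powr (- s) \<le> s * x powr (- s - 1)"
      using x s by (intro powr_diff_le) auto
    also have "\<dots> \<le> 2 * x powr (- 2)" using x s by (intro mult_mono powr_mono) auto
    finally show "x powr (- s) - (x + 1) powr (- s) \<le> 2 * x powr (- 2)" .
    have "1 - x powr (- d) \<le> d * ln x"
      using exp_ge_add_one_self[of "- d * ln x"] x by (simp add: powr_def)
    also have "ln x \<le> 2 * x powr (1 / 2)"
    proof -
      have "ln (x powr (1 / 2)) \<le> x powr (1 / 2) - 1" using x by (intro ln_le_minus_one) auto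
      then show ?thesis using x by (simp add: ln_powr)
    qed
    finally show "1 - x powr (- d) \<le> 2 * d * x powr (1 / 2)"
      using d by (simp add: mult_ac mult_left_mono)
  qed auto
  also have "\<dots> = 4 * d * x powr (- 3 / 2)" by (simp add: mult_ac flip: powr_add)
  finally have u1: "u \<le> 4 * d * x powr (- 3 / 2)" .
  have "v \<le> x powr (- 1) * (d * x powr (- 1))"
    unfolding v_def
  proof (rule mult_mono[OF _ _ _ d2])
    have "(x + 1) powr (- s) \<le> x powr (- s)" using d1 by simp
    also have "\<dots> \<le> x powr (- 1)" using x s by (intro powr_mono) auto
    finally show "(x + 1) powr (- s) \<le> x powr (- 1)" .
    have "x powr (- d) - (x + 1) powr (- d) \<le> d * x powr (- d - 1)"
      using x d by (intro powr_diff_le) auto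
    also have "\<dots> \<le> d * x powr (- 1)" using x d by (intro mult_left_mono powr_mono) auto
    finally show "x powr (- d) - (x + 1) powr (- d) \<le> d * x powr (- 1)" .
  qed auto
  also have "\<dots> = d * (x powr (- 1) * x powr (- 1))" by (rule mult.left_commute)
  also have "x powr (- 1) * x powr (- 1) = x powr (- 2)" unfolding powr_add[symmetric] by simp
  also have "d * x powr (- 2) \<le> d * x powr (- 3 / 2)" using x d by (intro mult_left_mono powr_mono) auto
  finally have v1: "v \<le> d * x powr (- 3 / 2)" .
  have "\<bar>u - v\<bar> \<le> 5 * (d * x powr (- 3 / 2))" using u0 v0 u1 v1 by linarith
  then show ?thesis by (simp only: uv x_def d_def mult.assoc)
qed

text \<open>The constant is 30 = 2 * 5 * 3: the boundary term is at most the total variation because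
  g 1 = 0, each increment carries 5, and the sum of n^(-3/2) is at most 3.\<close>

lemma L_fun_Lipschitz:
  assumes ch: "dirichlet_char q ch" and s: "1 < s" "s < s'" "s' \<le> 2"
    and B: "\<And>N. norm (\<Sum>n=1..N. ch n) \<le> B"
  shows "norm (L_fun ch s - L_fun ch s') \<le> 30 * B * (s' - s)"
proof -
  define g where "g n = real n powr (- s) - real n powr (- s')" for n :: nat
  have B0: "B \<ge> 0" using B[of 0] by simp
  have part: "norm (\<Sum>n=1..N. ch n * of_real (g n)) \<le> 30 * B * (s' - s)" for N
  proof (cases "N = 0")
    case False
    have "(\<Sum>n=1..<N. g n - g (Suc n)) = g 1 - g N"
      using False by (intro sum_telescope_from_1) auto
    then have "\<bar>g N\<bar> = \<bar>\<Sum>n=1..<N. g n - g (Suc n)\<bar>" by (simp add: g_def)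
    also have "\<dots> \<le> (\<Sum>n=1..<N. \<bar>g n - g (Suc n)\<bar>)" by (rule sum_abs)
    finally have "\<bar>g N\<bar> \<le> (\<Sum>n=1..<N. \<bar>g n - g (Suc n)\<bar>)" .
    then have "\<bar>g N\<bar> + (\<Sum>n=1..<N. \<bar>g n - g (Suc n)\<bar>) \<le> 2 * (\<Sum>n=1..<N. \<bar>g n - g (Suc n)\<bar>)" by simp
    also have "(\<Sum>n=1..<N. \<bar>g n - g (Suc n)\<bar>) \<le> (\<Sum>n=1..<N. 5 * (s' - s) * real n powr (- 3 / 2))"
      unfolding g_def using s by (intro sum_mono L_fun_Lipschitz_aux) auto
    also have "\<dots> \<le> (\<Sum>n=1..N. 5 * (s' - s) * real n powr (- 3 / 2))"
      using s by (intro sum_mono2) auto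
    also have "\<dots> = 5 * (s' - s) * (\<Sum>n=1..N. real n powr (- (3 / 2)))"
      by (simp add: sum_distrib_left)
    also have "\<dots> \<le> 5 * (s' - s) * (1 + 1 / (3 / 2 - 1))"
      using s by (intro mult_left_mono sum_powr_le_zeta) auto
    finally have "\<bar>g N\<bar> + (\<Sum>n=1..<N. \<bar>g n - g (Suc n)\<bar>) \<le> 30 * (s' - s)" by simp
    then have "B * (\<bar>g N\<bar> + (\<Sum>n=1..<N. \<bar>g n - g (Suc n)\<bar>)) \<le> B * (30 * (s' - s))"
      using B0 by (rule mult_left_mono)
    with norm_Abel_summation_le[OF B, of g N] show ?thesis by (simp add: mult_ac)
  qed (use B0 s in auto)
  have s': "s' > 1" using s by simp
  have "(\<lambda>N. (\<Sum>n=1..N. L_term ch s n) - (\<Sum>n=1..N. L_term ch s' n)) \<longlonglongrightarrow> L_fun ch s - L_fun ch s'"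
    by (intro tendsto_diff L_fun_partial_sums[OF ch] s s')
  moreover have "(\<Sum>n=1..N. L_term ch s n) - (\<Sum>n=1..N. L_term ch s' n) = (\<Sum>n=1..N. ch n * of_real (g n))" for N
    by (simp add: L_term_def g_def right_diff_distrib sum_subtractf)
  ultimately have "(\<lambda>N. norm (\<Sum>n=1..N. ch n * of_real (g n))) \<longlonglongrightarrow> norm (L_fun ch s - L_fun ch s')"
    by (simp add: tendsto_norm)
  then show ?thesis using part by (intro LIMSEQ_le_const2) auto
qed

lemma norm_L_fun_le_zeta:
  assumes ch: "dirichlet_char q ch" and s: "s > 1"
  shows "norm (L_fun ch s) \<le> 1 + 1 / (s - 1)"
proof (rule norm_L_fun_le_of_partial[OF ch s])
  fix N
  have "norm (\<Sum>n=1..N. L_term ch s n) \<le> (\<Sum>n=1..N. real n powr (- s))"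
    by (rule order_trans[OF norm_sum sum_mono]) (rule norm_L_term[OF ch])
  then show "norm (\<Sum>n=1..N. L_term ch s n) \<le> 1 + 1 / (s - 1)"
    using sum_powr_le_zeta[OF s, of N] by linarith
qed

lemma dirichlet_char_one: "dirichlet_char 1 (\<lambda>_. 1)"
  by (simp add: dirichlet_char_def)

lemma norm_L_fun_one_ge:
  assumes s: "s > 1"
  shows "norm (L_fun (\<lambda>_. 1) s) \<ge> 1 / (s - 1)"
proof -
  have part: "norm (\<Sum>n=1..N. L_term (\<lambda>_. 1) s n) \<ge> (1 - real (Suc N) powr (1 - s)) / (s - 1)" for N
  proof -
    have "(1 - real (Suc N) powr (1 - s)) / (s - 1) \<le> (\<Sum>n=1..N. real n powr (- s))"
    proof (induction N)
      case (Suc N)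
      have "(real (Suc N) powr (1 - s) - real (Suc (Suc N)) powr (1 - s)) / (s - 1) \<le> real (Suc N) powr (- s)"
        using powr_diff_bounds(2)[of "real (Suc N)" s] s by (simp add: add.commute)
      then show ?case using Suc by (simp add: diff_divide_distrib)
    qed simp
    also have "\<dots> = norm (\<Sum>n=1..N. L_term (\<lambda>_. 1) s n)"
      unfolding L_term_def mult_1 of_real_sum[symmetric] norm_of_real
      by (intro abs_of_nonneg[symmetric] sum_nonneg) auto
    finally show ?thesis .
  qed
  have "(\<lambda>N. real N powr (1 - s)) \<longlonglongrightarrow> 0"
    using s by (intro tendsto_neg_powr filterlim_real_sequentially) auto
  then have "(\<lambda>N. (1 - real (Suc N) powr (1 - s)) / (s - 1)) \<longlonglongrightarrow> (1 - 0) / (s - 1)"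
    by (intro tendsto_divide tendsto_diff tendsto_const LIMSEQ_Suc[of "\<lambda>N. real N powr (1 - s)"])
       (use s in auto)
  moreover have "(\<lambda>N. norm (\<Sum>n=1..N. L_term (\<lambda>_. 1) s n)) \<longlonglongrightarrow> norm (L_fun (\<lambda>_. 1) s)"
    by (intro tendsto_norm L_fun_partial_sums[OF dirichlet_char_one s])
  ultimately show ?thesis using part by (simp add: LIMSEQ_le)
qed

lemma dirichlet_char_mod:
  assumes "dirichlet_char q ch"
  shows "ch (n mod q) = ch n"
proof -
  have "ch (n + k * q) = ch n" for n k
  proof (induction k)
    case (Suc k)
    have "ch (n + Suc k * q) = ch ((n + k * q) + q)" by (simp add: algebra_simps)
    then show ?case using Suc dirichlet_charD(3)[OF assms] by simp
  qed simp
  from this[of "n mod q" "n div q"] show ?thesis by (simp add: add.commute)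
qed

text \<open>Multiplication by b permutes the residues modulo q and multiplies the sum by
  \<open>ch b\<close>, which differs from 1.\<close>

lemma dirichlet_char_period_sum:
  assumes ch: "dirichlet_char q ch" and q: "q > 0" and b: "coprime b q" "ch b \<noteq> 1"
  shows "(\<Sum>n<q. ch n) = 0" and "ch 0 = 0"
proof -
  have inj: "inj_on (\<lambda>n. b * n mod q) {..<q}"
  proof (rule inj_onI)
    fix m n assume mn: "m \<in> {..<q}" "n \<in> {..<q}" "b * m mod q = b * n mod q"
    then have "[b * m = b * n] (mod q)" by (simp add: cong_def)
    then have "[m = n] (mod q)" using b(1) cong_mult_lcancel_nat by blast
    then show "m = n" using mn by (simp add: cong_def)
  qed
  have "(\<lambda>n. b * n mod q) ` {..<q} = {..<q}"
    by (rule card_subset_eq) (use q inj in \<open>auto simp: card_image\<close>)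
  then have "(\<Sum>n<q. ch n) = (\<Sum>n<q. ch (b * n mod q))"
    using sum.reindex[OF inj, of ch] by (simp add: o_def)
  also have "\<dots> = ch b * (\<Sum>n<q. ch n)"
    by (simp add: dirichlet_char_mod[OF ch] dirichlet_charD(2)[OF ch] sum_distrib_left)
  finally have "(1 - ch b) * (\<Sum>n<q. ch n) = 0" by (simp only: left_diff_distrib mult_1 right_minus_eq)
  then show "(\<Sum>n<q. ch n) = 0" using b by simp
  have "ch 0 = ch b * ch 0" using dirichlet_charD(2)[OF ch, of b 0] by simp
  then have "(1 - ch b) * ch 0 = 0" by (simp only: left_diff_distrib mult_1 right_minus_eq)
  then show "ch 0 = 0" using b by simp
qed

lemma norm_dirichlet_char_sum_le:
  assumes ch: "dirichlet_char q ch" and q: "q > 0" and b: "coprime b q" "ch b \<noteq> 1"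
  shows "norm (\<Sum>n=1..N. ch n) \<le> real q"
proof -
  have *: "norm (\<Sum>n<N. ch n) \<le> real q" for N
  proof (induction N rule: less_induct)
    case (less N)
    show ?case
    proof (cases "N < q")
      case True
      have "norm (\<Sum>n<N. ch n) \<le> (\<Sum>n<N. 1)"
        by (rule order_trans[OF norm_sum sum_mono]) (rule dirichlet_charD(4)[OF ch])
      then show ?thesis using True by simp
    next
      case False
      have "{..<N} = {..<q} \<union> (\<lambda>n. n + q) ` {..<N - q}"
      proof (intro equalityI subsetI)
        fix n assume "n \<in> {..<N}"
        then show "n \<in> {..<q} \<union> (\<lambda>n. n + q) ` {..<N - q}"
          by (cases "n < q") (auto intro!: image_eqI[of _ _ "n - q"])
      qed (use False in auto)
      then have "(\<Sum>n<N. ch n) = (\<Sum>n<q. ch n) + (\<Sum>n\<in>(\<lambda>n. n + q) ` {..<N - q}. ch n)"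
        by (simp only:) (intro sum.union_disjoint; auto)
      also have "(\<Sum>n\<in>(\<lambda>n. n + q) ` {..<N - q}. ch n) = (\<Sum>n<N - q. ch (n + q))"
        by (subst sum.reindex) (auto simp: inj_on_def)
      also have "\<dots> = (\<Sum>n<N - q. ch n)" by (simp add: dirichlet_charD(3)[OF ch])
      finally show ?thesis
        using less.IH[of "N - q"] False q dirichlet_char_period_sum(1)[OF ch q b] by simp
    qed
  qed
  have "(\<Sum>n<Suc N. ch n) = (\<Sum>n=1..N. ch n)"
    using dirichlet_char_period_sum(2)[OF ch q b]
    by (intro sum.mono_neutral_right) (auto simp: Suc_le_eq)
  then show ?thesis using *[of "Suc N"] by simp
qed

section \<open>Lower bounds for L-functions of real characters\<close>

lemma convex_powr_differences:
  assumes s: "(s :: real) > 0" and n: "n \<ge> (1 :: nat)"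
  shows "real (Suc n) powr (- s) - real (Suc (Suc n)) powr (- s) \<le> real n powr (- s) - real (Suc n) powr (- s)"
proof -
  have e: "1 - (s + 1) = - s" "s + 1 - 1 = s" by auto
  have "(real (Suc n) powr (- s) - (real (Suc n) + 1) powr (- s)) / s \<le> real (Suc n) powr (- (s + 1))"
    using s by (intro powr_diff_bounds(2)[of _ "s + 1", unfolded e]) auto
  also have "\<dots> = (real n + 1) powr (- (s + 1))" by (simp add: add.commute)
  also have "\<dots> \<le> (real n powr (- s) - (real n + 1) powr (- s)) / s"
    using s n by (intro powr_diff_bounds(1)[of _ "s + 1", unfolded e]) auto
  finally show ?thesis using s by (simp add: divide_le_cancel add.commute)
qed

text \<open>Two partial summations pair the double sums of the character with the second differences
  of n^(-s), which are nonnegative by convexity. All these terms are nonnegative, and the first is 1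
  - 2 * 2^(-s) + 3^(-s) >= 3^(-s) >= 1/9.\<close>

lemma norm_L_fun_real_ge:
  fixes x :: "nat \<Rightarrow> int"
  assumes ch: "dirichlet_char q (\<lambda>n. of_int (x n))" and s: "1 < s" "s \<le> 2"
    and B: "\<And>N. norm (\<Sum>n=1..N. complex_of_int (x n)) \<le> B"
    and D: "\<And>n. (\<Sum>m=1..n. \<Sum>k=1..m. x k) \<ge> 0"
  shows "norm (L_fun (\<lambda>n. of_int (x n)) s) \<ge> 1 / 9"
proof -
  define g where "g n = real n powr (- s)" for n :: nat
  define \<Delta> where "\<Delta> n = g n - g (Suc n)" for n :: nat
  define A where "A n = (\<Sum>k=1..n. real_of_int (x k))" for n
  have x1: "x (Suc 0) = 1" using dirichlet_charD(1)[OF ch] by simp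
  have AB: "\<bar>A N\<bar> \<le> B" for N
    using B[of N] unfolding A_def by (simp flip: of_int_sum)
  have \<Delta>: "\<Delta> n \<ge> 0" if "n \<ge> 1" for n
    unfolding \<Delta>_def g_def using that s by (auto intro!: powr_mono2')
  have \<Delta>\<Delta>: "\<Delta> n - \<Delta> (Suc n) \<ge> 0" if "n \<ge> 1" for n
    unfolding \<Delta>_def g_def using convex_powr_differences[of s n] that s by simp
  have DD: "(\<Sum>m=1..n. A m) \<ge> 0" for n
    using D[of n] unfolding A_def by (simp flip: of_int_sum)
  have first: "\<Delta> 1 - \<Delta> (Suc 1) \<ge> 1 / 9"
  proof -
    have "2 powr (- s) \<le> 2 powr (- 1 :: real)" using s by (intro powr_mono) auto
    then have 1: "2 powr (- s) \<le> (1 / 2 :: real)" by (simp add: powr_minus_divide)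
    have "3 powr (- 2 :: real) \<le> 3 powr (- s)" using s by (intro powr_mono) auto
    moreover have "3 powr (- 2 :: real) = 1 / 9" by (simp add: powr_minus_divide)
    ultimately have "1 / 9 \<le> (3 :: real) powr (- s)" by simp
    then show ?thesis using 1 unfolding \<Delta>_def g_def by simp
  qed
  have part: "1 / 9 - B * g N \<le> (\<Sum>n=1..N. real_of_int (x n) * g n)" if N: "N \<ge> 3" for N
  proof -
    obtain M where M: "N = Suc M" "M \<ge> 2" using N by (cases N) auto
    have "(\<Sum>n=1..N. real_of_int (x n) * g n) = A N * g N + (\<Sum>n=1..M. A n * \<Delta> n)"
      using Abel_summation[of "\<lambda>n. real_of_int (x n)" g N]
      by (simp only: A_def \<Delta>_def M(1) atLeastLessThanSuc_atLeastAtMost)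
    moreover have "(\<Sum>n=1..M. A n * \<Delta> n) \<ge> 1 / 9"
    proof -
      have "1 / 9 \<le> (\<Sum>m=1..1. A m) * (\<Delta> 1 - \<Delta> (Suc 1))"
        using first by (simp add: A_def x1)
      also have "\<dots> \<le> (\<Sum>n=1..<M. (\<Sum>m=1..n. A m) * (\<Delta> n - \<Delta> (Suc n)))"
      proof (rule member_le_sum)
        show "0 \<le> (\<Sum>m=1..n. A m) * (\<Delta> n - \<Delta> (Suc n))" if "n \<in> {1..<M} - {1}" for n
          using that by (intro mult_nonneg_nonneg DD \<Delta>\<Delta>) auto
      qed (use M in auto)
      also have "\<dots> \<le> (\<Sum>n=1..M. A n) * \<Delta> M + (\<Sum>n=1..<M. (\<Sum>m=1..n. A m) * (\<Delta> n - \<Delta> (Suc n)))"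
        using M DD[of M] \<Delta>[of M] by simp
      also have "\<dots> = (\<Sum>n=1..M. A n * \<Delta> n)" by (rule Abel_summation[symmetric])
      finally show ?thesis .
    qed
    moreover have "- B * g N \<le> A N * g N"
      using AB[of N] by (intro mult_right_mono) (auto simp: g_def)
    ultimately show ?thesis by linarith
  qed
  have g0: "g \<longlonglongrightarrow> 0"
    unfolding g_def using s by (intro tendsto_neg_powr filterlim_real_sequentially) auto
  have "(\<lambda>N. 1 / 9 - B * g N) \<longlonglongrightarrow> 1 / 9 - B * 0"
    by (intro tendsto_diff tendsto_const tendsto_mult g0)
  moreover have "(\<lambda>N. Re (\<Sum>n=1..N. L_term (\<lambda>n. of_int (x n)) s n)) \<longlonglongrightarrow> Re (L_fun (\<lambda>n. of_int (x n)) s)"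
    by (intro tendsto_Re L_fun_partial_sums[OF ch] s)
  moreover have "1 / 9 - B * g N \<le> Re (\<Sum>n=1..N. L_term (\<lambda>n. of_int (x n)) s n)" if "N \<ge> 3" for N
    using part[OF that] by (simp add: L_term_def g_def)
  ultimately have "1 / 9 \<le> Re (L_fun (\<lambda>n. of_int (x n)) s)"
    by (intro LIMSEQ_le[of "\<lambda>N. 1 / 9 - B * g N"]) auto
  also have "\<dots> \<le> norm (L_fun (\<lambda>n. of_int (x n)) s)" by (rule complex_Re_le_cmod)
  finally show ?thesis .
qed

text \<open>\<open>double_sums_ok x k n a d\<close> runs through \<open>k\<close> further terms of a sequence whose first
  \<open>n\<close> terms have sum \<open>a\<close> and double sum \<open>d\<close>.\<close>
primrec double_sums_ok :: "(nat \<Rightarrow> int) \<Rightarrow> nat \<Rightarrow> nat \<Rightarrow> int \<Rightarrow> int \<Rightarrow> bool" where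
  "double_sums_ok x 0 n a d \<longleftrightarrow> a = 0 \<and> d \<ge> 0"
| "double_sums_ok x (Suc k) n a d \<longleftrightarrow> d \<ge> 0 \<and>
     double_sums_ok x k (Suc n) (a + x (Suc n)) (d + (a + x (Suc n)))"

lemma double_sums_okD:
  assumes "double_sums_ok x k n (\<Sum>i=1..n. x i) (\<Sum>m=1..n. \<Sum>i=1..m. x i)"
  shows "(\<Sum>i\<in>{1..n + k}. x i) = 0 \<and> (\<forall>j\<le>k. (\<Sum>m\<in>{1..n + j}. \<Sum>i=1..m. x i) \<ge> 0)"
  using assms
proof (induction k arbitrary: n)
  case (Suc k)
  then have *: "(\<Sum>m=1..n. \<Sum>i=1..m. x i) \<ge> 0"
    "double_sums_ok x k (Suc n) (\<Sum>i=1..Suc n. x i) (\<Sum>m=1..Suc n. \<Sum>i=1..m. x i)"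
    by simp_all
  from Suc.IH[OF *(2)] have IH: "(\<Sum>i\<in>{1..Suc n + k}. x i) = 0"
    "\<And>j. j \<le> k \<Longrightarrow> (\<Sum>m\<in>{1..Suc n + j}. \<Sum>i=1..m. x i) \<ge> 0" by auto
  have "(\<Sum>m\<in>{1..n + j}. \<Sum>i=1..m. x i) \<ge> 0" if "j \<le> Suc k" for j
    using *(1) IH(2)[of "j - 1"] that by (cases j) auto
  then show ?case using IH(1) by auto
qed simp

text \<open>As the sum over a period vanishes, the simple sums are periodic and the double sums grow
  by the nonnegative \<open>D q\<close> in each period. A check over one period therefore suffices
  and can be evaluated.\<close>

lemma double_sums_nonneg:
  fixes x :: "nat \<Rightarrow> int"
  assumes per: "\<And>n. x (n + q) = x n" and q: "q > 0" and ok: "double_sums_ok x q 0 0 0"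
  shows "(\<Sum>m=1..n. \<Sum>k=1..m. x k) \<ge> 0"
proof -
  define A where "A n = (\<Sum>k=1..n. x k)" for n
  define D where "D n = (\<Sum>m=1..n. A m)" for n
  have Aq: "A q = 0" and Dn: "\<And>n. n \<le> q \<Longrightarrow> D n \<ge> 0"
    using double_sums_okD[of x q 0] ok by (auto simp: A_def D_def)
  have Aper: "A (n + q) = A n" for n
  proof (induction n)
    case (Suc n)
    have "A (Suc n + q) = A (n + q) + x (Suc n + q)" by (simp add: A_def)
    then show ?case using Suc per[of "Suc n"] by (simp add: A_def)
  qed (simp add: Aq, simp add: A_def)
  have Dper: "D (n + q) = D q + D n" for n
  proof (induction n)
    case (Suc n)
    have "D (Suc n + q) = D (n + q) + A (Suc n + q)" by (simp add: D_def)
    also have "\<dots> = D q + (D n + A (Suc n))" using Suc Aper[of "Suc n"] by simp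
    finally show ?case by (simp add: D_def)
  qed (simp add: D_def)
  have "D n \<ge> 0"
  proof (induction n rule: less_induct)
    case (less n)
    show ?case
    proof (cases "n \<le> q")
      case False
      then have "D n = D q + D (n - q)" using Dper[of "n - q"] by simp
      then show ?thesis using less[of "n - q"] Dn[of q] False q by simp
    qed (use Dn in auto)
  qed
  then show ?thesis by (simp add: D_def A_def)
qed

lemma mod_function_multiplicative:
  fixes x :: "nat \<Rightarrow> int"
  assumes x: "\<And>n. x n = x (n mod q)" and q: "q > 0"
    and ok: "\<forall>a\<in>set [0..<q]. \<forall>b\<in>set [0..<q]. x (a * b mod q) = x a * x b"
  shows "x (m * n) = x m * x n"
proof -
  have "x (m * n) = x ((m mod q) * (n mod q) mod q)" using x[of "m * n"] by (simp add: mod_mult_eq)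
  also have "\<dots> = x (m mod q) * x (n mod q)" using ok q by simp
  finally show ?thesis using x[of m] x[of n] by simp
qed

text \<open>The Kronecker symbols of discriminant 5, 8, -8 and -15.\<close>
definition jac5 :: "nat \<Rightarrow> int" where
  "jac5 n = (if n mod 5 \<in> {1, 4} then 1 else if n mod 5 \<in> {2, 3} then -1 else 0)"

definition jac8 :: "nat \<Rightarrow> int" where
  "jac8 n = (if n mod 8 \<in> {1, 7} then 1 else if n mod 8 \<in> {3, 5} then -1 else 0)"

definition jacm8 :: "nat \<Rightarrow> int" where
  "jacm8 n = (if n mod 8 \<in> {1, 3} then 1 else if n mod 8 \<in> {5, 7} then -1 else 0)"

definition jacm15 :: "nat \<Rightarrow> int" where
  "jacm15 n = (if n mod 15 \<in> {1, 2, 4, 8} then 1 else if n mod 15 \<in> {7, 11, 13, 14} then -1 else 0)"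

lemma jac5_mult: "jac5 (m * n) = jac5 m * jac5 n"
proof (rule mod_function_multiplicative[of _ 5])
  show "jac5 n = jac5 (n mod 5)" for n by (simp add: jac5_def)
  show "\<forall>a\<in>set [0..<5]. \<forall>b\<in>set [0..<5]. jac5 (a * b mod 5) = jac5 a * jac5 b" by code_simp
qed simp

lemma jacm8_mult: "jacm8 (m * n) = jacm8 m * jacm8 n"
proof (rule mod_function_multiplicative[of _ 8])
  show "jacm8 n = jacm8 (n mod 8)" for n by (simp add: jacm8_def)
  show "\<forall>a\<in>set [0..<8]. \<forall>b\<in>set [0..<8]. jacm8 (a * b mod 8) = jacm8 a * jacm8 b" by code_simp
qed simp

lemma jacm15_mult: "jacm15 (m * n) = jacm15 m * jacm15 n"
proof (rule mod_function_multiplicative[of _ 15])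
  show "jacm15 n = jacm15 (n mod 15)" for n by (simp add: jacm15_def)
  show "\<forall>a\<in>set [0..<15]. \<forall>b\<in>set [0..<15]. jacm15 (a * b mod 15) = jacm15 a * jacm15 b" by code_simp
qed simp

text \<open>The real members of the family \<open>dch\<close> below, for every a at once: the flags
  switch on the symbols of discriminant 8, -8 and 5, and even n are always killed.\<close>

definition real_char :: "bool \<Rightarrow> bool \<Rightarrow> bool \<Rightarrow> nat \<Rightarrow> int" where
  "real_char h s t n = (if even n then 0 else (if h then jac8 n else 1) * (if s then jacm8 n else 1)) * (if t then jac5 n else 1)"

lemma real_char_double_sums:
  assumes "h \<or> s \<or> t"
  shows "(\<Sum>m=1..n. \<Sum>k=1..m. real_char h s t k) \<ge> 0"
proof (rule double_sums_nonneg[of _ 40])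
  fix n :: nat
  have "(n + 40) mod 8 = n mod 8" "(n + 40) mod 5 = n mod 5"
    using mod_mult_self1[of n 5 8] mod_mult_self1[of n 8 5] by simp_all
  then show "real_char h s t (n + 40) = real_char h s t n"
    by (simp add: real_char_def jac5_def jac8_def jacm8_def)
next
  have "double_sums_ok (real_char True False False) 40 0 0 0" "double_sums_ok (real_char False True False) 40 0 0 0"
    "double_sums_ok (real_char False False True) 40 0 0 0" "double_sums_ok (real_char True True False) 40 0 0 0"
    "double_sums_ok (real_char True False True) 40 0 0 0" "double_sums_ok (real_char False True True) 40 0 0 0"
    "double_sums_ok (real_char True True True) 40 0 0 0"
    by code_simp+
  then show "double_sums_ok (real_char h s t) 40 0 0 0" using assms by (cases h; cases s; cases t) auto
qed simp

lemma jacm15_double_sums: "(\<Sum>m=1..n. \<Sum>k=1..m. jacm15 k) \<ge> 0"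
proof (rule double_sums_nonneg[of _ 15])
  show "jacm15 (n + 15) = jacm15 n" for n by (simp add: jacm15_def)
  show "double_sums_ok jacm15 15 0 0 0" by code_simp
qed simp

section \<open>Characters modulo powers of two\<close>

lemma three_power_mod_8: "(3 :: int) ^ j mod 8 = (if even j then 1 else 3)"
proof (induction j)
  case (Suc j)
  have "(3 :: int) ^ Suc j mod 8 = 3 * (3 ^ j mod 8) mod 8" by (simp add: mod_mult_right_eq)
  then show ?case using Suc by simp
qed simp

lemma eight_dvd_pow2: "a \<ge> 3 \<Longrightarrow> 8 dvd (2 ^ a :: 'a :: comm_semiring_1)"
  using le_imp_power_dvd[of 3 a "2 :: 'a"] by simp

lemma signed_three_power_mod_8:
  "((if b then -1 else 1) * 3 ^ j :: int) mod 8 = (if b then (if even j then 7 else 5) else (if even j then 1 else 3))"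
proof -
  have "(- (3 ^ j) :: int) mod 8 = (- (3 ^ j mod 8)) mod 8" by (simp add: mod_minus_eq)
  then show ?thesis by (auto simp: three_power_mod_8)
qed

lemma three_power_cong_iff:
  assumes a: "a \<ge> 3"
  shows "[(3 :: int) ^ i = 3 ^ j] (mod 2 ^ a) \<longleftrightarrow> [i = j] (mod 2 ^ (a - 2))"
proof -
  have "coprime (2 ^ a :: nat) 3" by simp
  then have "[(3 :: nat) ^ i = 3 ^ j] (mod 2 ^ a) \<longleftrightarrow> [i = j] (mod ord (2 ^ a) (3 :: nat))"
    by (rule order_divides_expdiff)
  moreover have "ord (2 ^ a) (3 :: nat) = 2 ^ (a - 2)" using ord_twopow_3_5[of a 3] a by simp
  moreover have "[(3 :: int) ^ i = 3 ^ j] (mod 2 ^ a) \<longleftrightarrow> [(3 :: nat) ^ i = 3 ^ j] (mod 2 ^ a)"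
    using cong_int_iff[of "3 ^ i" "3 ^ j" "2 ^ a"] by simp
  ultimately show ?thesis by simp
qed

text \<open>Modulo 8 the powers of 3 are 1 or 3 and their negatives 7 or 5, so the sign is visible
  there and equals \<open>jacm8\<close>. As 3 has order 2^(a-2), the signed powers are 2^(a-1)
  different odd residues, hence all of them.\<close>

lemma odd_eq_signed_three_power:
  assumes a: "a \<ge> 3" and n: "odd n"
  shows "\<exists>j. [int n = jacm8 n * 3 ^ j] (mod 2 ^ a)"
proof -
  define M where "M = (2 :: nat) ^ (a - 2)"
  define f where "f = (\<lambda>(b, j). ((if b then -1 else 1) * 3 ^ j :: int) mod 2 ^ a)"
  define odds where "odds = (\<lambda>k. 2 * k + 1) ` {0..<(2 :: int) ^ (a - 1)}"
  have a2: "(2 :: int) ^ a = 2 * 2 ^ (a - 1)" using a by (cases a) auto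
  have mod8: "f (b, j) mod 8 = ((if b then -1 else 1) * 3 ^ j :: int) mod 8" for b j
    unfolding f_def by (simp only: split_conv mod_mod_cancel[OF eight_dvd_pow2[OF a]])
  have inj: "inj_on f (UNIV \<times> {..<M})"
  proof (rule inj_onI, clarsimp)
    fix b b' j j' assume j: "j < M" "j' < M" and eq: "f (b, j) = f (b', j')"
    then have "f (b, j) mod 8 = f (b', j') mod 8" by simp
    then have "b = b'" unfolding mod8 signed_three_power_mod_8 by (auto split: if_splits)
    moreover from this eq have "[(3 :: int) ^ j = 3 ^ j'] (mod 2 ^ a)"
      by (cases b) (auto simp: f_def cong_def[symmetric] cong_minus_minus_iff)
    then have "[j = j'] (mod M)" unfolding M_def using three_power_cong_iff[OF a] by blast
    then have "j = j'" using j by (simp add: cong_def)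
    ultimately show "b = b' \<and> j = j'" by simp
  qed
  have sub: "f ` (UNIV \<times> {..<M}) \<subseteq> odds"
  proof
    fix x assume "x \<in> f ` (UNIV \<times> {..<M})"
    then obtain b j where x: "x = f (b, j)" by auto
    have "0 \<le> x" "x < 2 ^ a" unfolding x f_def by simp_all
    moreover have "odd x"
    proof -
      have "x mod 8 \<in> {1, 3, 5, 7}" unfolding x mod8 signed_three_power_mod_8 by auto
      then have "x mod 8 = 1 \<or> x mod 8 = 3 \<or> x mod 8 = 5 \<or> x mod 8 = 7" by simp
      then show ?thesis by presburger
    qed
    ultimately show "x \<in> odds" unfolding odds_def a2 by (intro image_eqI[of _ _ "x div 2"]) auto
  qed
  have "card odds = 2 ^ (a - 1)" unfolding odds_def by (subst card_image) (auto simp: inj_on_def nat_power_eq)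
  also have "\<dots> = card (f ` (UNIV \<times> {..<M}))"
  proof -
    have "(2 :: nat) ^ (a - 1) = 2 * 2 ^ (a - 2)" 
    proof -
      have "a - 1 = Suc (a - 2)" using a by simp
      then show ?thesis by simp
    qed
    then show ?thesis using inj by (simp add: card_image card_cartesian_product M_def card_UNIV_bool)
  qed
  finally have eq: "f ` (UNIV \<times> {..<M}) = odds"
    using sub by (intro card_subset_eq) (auto simp: odds_def)
  have "int n mod 2 ^ a \<in> odds"
  proof -
    have "(2 :: int) dvd 2 ^ a" unfolding a2 by simp
    then have "odd (int n mod 2 ^ a)" 
      by (simp only: dvd_mod_iff even_of_nat not_False_eq_True n)
    then obtain c where c: "int n mod 2 ^ a = 2 * c + 1" by (rule oddE)
    moreover have "0 \<le> int n mod 2 ^ a" "int n mod 2 ^ a < 2 * 2 ^ (a - 1)"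
      unfolding a2[symmetric] by simp_all
    ultimately have "c \<in> {0..<2 ^ (a - 1)}" by auto
    then show ?thesis unfolding odds_def c by (rule imageI)
  qed
  then obtain b j where bj: "int n mod 2 ^ a = f (b, j)" using eq by auto
  then have "int n mod 8 = ((if b then -1 else 1) * 3 ^ j :: int) mod 8"
    using mod8[of b j] mod_mod_cancel[OF eight_dvd_pow2[OF a], of "int n"] by simp
  then have "int (n mod 8) = (if b then (if even j then 7 else 5) else (if even j then 1 else 3))"
    unfolding signed_three_power_mod_8 by (simp add: zmod_int)
  then have "jacm8 n = (if b then -1 else 1)" by (auto simp: jacm8_def split: if_splits)
  then have "[int n = jacm8 n * 3 ^ j] (mod 2 ^ a)" using bj by (simp add: f_def cong_def)
  then show ?thesis by blast
qed

text \<open>The discrete logarithm to base 3 up to sign. Any choice will do, since it is unique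
  modulo 2^(a-2) and enters only through roots of unity of that order.\<close>

definition log3 :: "nat \<Rightarrow> nat \<Rightarrow> nat" where
  "log3 a n = (SOME j. [int n = jacm8 n * 3 ^ j] (mod 2 ^ a))"

lemma log3: "a \<ge> 3 \<Longrightarrow> odd n \<Longrightarrow> [int n = jacm8 n * 3 ^ log3 a n] (mod 2 ^ a)"
  unfolding log3_def by (rule someI_ex) (rule odd_eq_signed_three_power)

lemma jacm8_odd: "odd n \<Longrightarrow> jacm8 n * jacm8 n = 1"
proof -
  assume "odd n"
  then have "n mod 8 \<in> {1, 3, 5, 7}" by auto presburger
  then show ?thesis by (auto simp: jacm8_def)
qed

lemma log3_unique:
  assumes a: "a \<ge> 3" and n: "odd n" and j: "[int n = jacm8 n * 3 ^ j] (mod 2 ^ a)"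
  shows "[log3 a n = j] (mod 2 ^ (a - 2))"
proof -
  have "[jacm8 n * 3 ^ log3 a n = jacm8 n * 3 ^ j] (mod 2 ^ a)"
    using log3[OF a n] j cong_sym cong_trans by blast
  then have "[jacm8 n * (jacm8 n * 3 ^ log3 a n) = jacm8 n * (jacm8 n * 3 ^ j)] (mod 2 ^ a)"
    by (rule cong_scalar_left)
  then have "[(3 :: int) ^ log3 a n = 3 ^ j] (mod 2 ^ a)"
    by (simp only: mult.assoc[symmetric] jacm8_odd[OF n] mult_1)
  then show ?thesis using three_power_cong_iff[OF a] by blast
qed

lemma log3_mult:
  assumes a: "a \<ge> 3" and mn: "odd m" "odd n"
  shows "[log3 a (m * n) = log3 a m + log3 a n] (mod 2 ^ (a - 2))"
proof (rule log3_unique[OF a])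
  have "[int m * int n = (jacm8 m * 3 ^ log3 a m) * (jacm8 n * 3 ^ log3 a n)] (mod 2 ^ a)"
    by (intro cong_mult log3 a mn)
  then show "[int (m * n) = jacm8 (m * n) * 3 ^ (log3 a m + log3 a n)] (mod 2 ^ a)"
    by (simp add: jacm8_mult power_add mult_ac)
qed (use mn in simp)

lemma log3_periodic:
  assumes a: "a \<ge> 3" and n: "odd n" and q: "2 ^ a dvd q"
  shows "[log3 a (n + q) = log3 a n] (mod 2 ^ (a - 2))"
proof (rule log3_unique[OF a])
  have "8 dvd q" using eight_dvd_pow2[OF a, where ?'a = nat] q by (rule dvd_trans)
  then have 8: "(n + q) mod 8 = n mod 8" by (metis mod_add_right_eq add.right_neutral dvd_imp_mod_0)
  have "even q" using \<open>8 dvd q\<close> by auto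
  then show "odd (n + q)" using n by simp
  have "int (2 ^ a) dvd int q" using q by (simp only: int_dvd_int_iff)
  then have "[int n + int q = jacm8 n * 3 ^ log3 a n + 0] (mod 2 ^ a)"
    by (intro cong_add log3 a n) (simp add: cong_0_iff)
  moreover have "jacm8 (n + q) = jacm8 n" using 8 by (simp add: jacm8_def)
  ultimately show "[int (n + q) = jacm8 (n + q) * 3 ^ log3 a n] (mod 2 ^ a)" by simp
qed

section \<open>Roots of unity and the family of characters\<close>

definition unity :: "nat \<Rightarrow> nat \<Rightarrow> nat \<Rightarrow> complex" where
  "unity M k j = cis (2 * pi * (real k * real j / real M))"

lemma unity_add: "unity M k (i + j) = unity M k i * unity M k j"
  by (simp add: unity_def cis_mult distrib_left add_divide_distrib)

lemma unity_multiple: "M > 0 \<Longrightarrow> unity M k (M * j) = 1"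
proof -
  assume "M > 0"
  then have "real k * real (M * j) / real M = real (k * j)" by simp
  then show ?thesis unfolding unity_def by (metis Ints_of_nat cis_multiple_2pi)
qed

lemma unity_cong:
  assumes M: "M > 0" and ij: "[i = j] (mod M)"
  shows "unity M k i = unity M k j"
proof -
  have *: "unity M k i = unity M k (i mod M)" for i
    using unity_add[of M k "M * (i div M)" "i mod M"] unity_multiple[OF M, of k "i div M"] by simp
  show ?thesis using *[of i] *[of j] ij by (simp add: cong_def)
qed

lemma norm_unity [simp]: "norm (unity M k j) = 1"
  by (simp add: unity_def)

lemma unity_0 [simp]: "unity M k 0 = 1" "unity M 0 j = 1"
  by (simp_all add: unity_def)

lemma unity_commute: "unity M k j = unity M j k"
  by (simp add: unity_def mult.commute)

lemma unity_power: "unity M k j = unity M 1 j ^ k"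
proof (induction k)
  case (Suc k)
  have "unity M (Suc k) j = unity M j (k + 1)" by (simp add: unity_commute)
  also have "\<dots> = unity M k j * unity M 1 j" by (simp only: unity_add unity_commute[of M j])
  finally show ?case using Suc by simp
qed simp

lemma unity_eq_1_iff:
  assumes M: "M > 0"
  shows "unity M 1 j = 1 \<longleftrightarrow> M dvd j"
proof
  assume "unity M 1 j = 1"
  then have "cos (2 * pi * (real j / real M)) = 1" by (simp add: unity_def complex_eq_iff)
  then obtain x :: int where "2 * pi * (real j / real M) = of_int x * 2 * pi"
    unfolding cos_one_2pi_int by blast
  then have "(2 * pi) * (real j / real M) = (2 * pi) * of_int x" by (simp only: mult_ac)
  then have "real j / real M = of_int x" by (rule iffD1[OF mult_left_cancel, rotated]) simp
  then have "real j = of_int x * real M" using M by (simp add: field_simps)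
  then have "of_int (int j) = (of_int (x * int M) :: real)" by simp
  then have "int j = x * int M" by (simp only: of_int_eq_iff)
  then have "int M dvd int j" by simp
  then show "M dvd j" by simp
next
  assume "M dvd j"
  then show "unity M 1 j = 1" using unity_multiple[OF M] by (elim dvdE) simp
qed

lemma sum_unity:
  assumes M: "M > 0"
  shows "(\<Sum>k<M. unity M k j) = (if M dvd j then of_nat M else 0)"
proof (cases "M dvd j")
  case True
  then have "unity M 1 j = 1" using unity_eq_1_iff[OF M] by blast
  then have "unity M k j = 1" for k by (simp only: unity_power[of M k j] power_one)
  then show ?thesis using True by simp
next
  case False
  then have ne: "unity M 1 j \<noteq> 1" using unity_eq_1_iff[OF M] by simp
  have "(\<Sum>k<M. unity M k j) = (\<Sum>k<M. unity M 1 j ^ k)" by (intro sum.cong refl unity_power)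
  also have "\<dots> = (unity M 1 j ^ M - 1) / (unity M 1 j - 1)" by (rule geometric_sum[OF ne])
  also have "unity M 1 j ^ M = 1"
    using unity_multiple[OF M, of j 1] unity_commute[of M j M] unity_power[of M M j] by simp
  finally show ?thesis using False by simp
qed

definition dch :: "nat \<Rightarrow> nat \<Rightarrow> bool \<Rightarrow> bool \<Rightarrow> nat \<Rightarrow> complex" where
  "dch a k s t n = (if even n then 0 else unity (2 ^ (a - 2)) k (log3 a n) * (if s then of_int (jacm8 n) else 1))
     * (if t then of_int (jac5 n) else 1)"

lemma dirichlet_char_dch:
  assumes a: "a \<ge> 3" and q: "2 ^ a dvd q" "t \<longrightarrow> 5 dvd q"
  shows "dirichlet_char q (dch a k s t)"
  unfolding dirichlet_char_def
proof (intro conjI allI)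
  have M: "(2 :: nat) ^ (a - 2) > 0" by simp
  have "[log3 a 1 = 0] (mod 2 ^ (a - 2))"
    by (rule log3_unique[OF a]) (simp_all add: jacm8_def)
  then show "dch a k s t 1 = 1" using unity_cong[OF M, of "log3 a 1" 0 k]
    by (simp add: dch_def jacm8_def jac5_def)
  show "dch a k s t (m * n) = dch a k s t m * dch a k s t n" for m n
  proof (cases "odd m \<and> odd n")
    case True
    then have "unity (2 ^ (a - 2)) k (log3 a (m * n)) = unity (2 ^ (a - 2)) k (log3 a m) * unity (2 ^ (a - 2)) k (log3 a n)"
      using unity_cong[OF M log3_mult[OF a]] unity_add by simp
    then show ?thesis using True by (simp add: dch_def jacm8_mult jac5_mult)
  qed (auto simp: dch_def)
  have "8 dvd q" using eight_dvd_pow2[OF a, where ?'a = nat] q(1) by (rule dvd_trans)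
  then have 8: "(n + q) mod 8 = n mod 8" for n by (metis mod_add_right_eq add.right_neutral dvd_imp_mod_0)
  have "even q" using \<open>8 dvd q\<close> by auto
  show "dch a k s t (n + q) = dch a k s t n" for n
  proof -
    have "t \<Longrightarrow> (n + q) mod 5 = n mod 5" using q(2) by (metis mod_add_right_eq add.right_neutral dvd_imp_mod_0)
    moreover have "odd n \<Longrightarrow> unity (2 ^ (a - 2)) k (log3 a (n + q)) = unity (2 ^ (a - 2)) k (log3 a n)"
      by (intro unity_cong[OF M] log3_periodic[OF a _ q(1)])
    ultimately show ?thesis using 8[of n] \<open>even q\<close> by (simp add: dch_def jacm8_def jac5_def)
  qed
  show "norm (dch a k s t n) \<le> 1" for n
    by (simp add: dch_def norm_mult jacm8_def jac5_def)
qed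

text \<open>An argument b with value other than 1 is needed. It is 1 modulo 2^a and 2 modulo 5 if t
  holds, otherwise 2^a - 1 if s holds, and otherwise 3.\<close>

lemma norm_dch_sum_le:
  assumes a: "a \<ge> 3" and k: "k < 2 ^ (a - 2)" and np: "k \<noteq> 0 \<or> s \<or> t"
  shows "norm (\<Sum>n=1..N. dch a k s t n) \<le> 5 * 2 ^ a"
proof (cases t)
  case False
  have "\<exists>b. coprime b (2 ^ a) \<and> dch a k s t b \<noteq> 1"
  proof (cases s)
    case True
    define b where "b = (2 :: nat) ^ a - 1"
    have e: "8 dvd (2 :: nat) ^ a" using a by (rule eight_dvd_pow2)
    then obtain c where c: "(2 :: nat) ^ a = 8 * c" by (rule dvdE)
    have "c \<noteq> 0"
    proof
      assume "c = 0"
      then have "(2 :: nat) ^ a = 0" unfolding c by (rule ssubst) (rule mult_0_right)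
      then show False by (simp only: power_eq_0_iff) simp
    qed
    then obtain d where d: "c = Suc d" by (cases c) auto
    have "b = 7 + 8 * d" unfolding b_def c d by simp
    then have b8: "b mod 8 = 7" by (simp only: mod_mult_self2) simp
    then have jb: "jacm8 b = -1" by (simp add: jacm8_def)
    have ob: "odd b" using b8 by presburger
    have "int b = 2 ^ a - 1" unfolding b_def by (simp add: of_nat_diff)
    then have "[int b = jacm8 b * 3 ^ 0] (mod 2 ^ a)" unfolding jb by (simp add: cong_iff_dvd_diff)
    then have "[log3 a b = 0] (mod 2 ^ (a - 2))" by (rule log3_unique[OF a ob])
    then have "unity (2 ^ (a - 2)) k (log3 a b) = 1" using unity_cong[of "2 ^ (a - 2)" "log3 a b" 0 k] by simp
    then have "dch a k s t b = -1" using ob True False jb by (simp add: dch_def)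
    then show ?thesis using ob by (intro exI[of _ b]) simp
  next
    case sF: False
    have "[log3 a 3 = 1] (mod 2 ^ (a - 2))" by (rule log3_unique[OF a]) (simp_all add: jacm8_def)
    then have "dch a k s t 3 = unity (2 ^ (a - 2)) k 1"
      using unity_cong[of "2 ^ (a - 2)" "log3 a 3" 1 k] sF False by (simp add: dch_def)
    also have "\<dots> \<noteq> 1"
    proof -
      have "\<not> 2 ^ (a - 2) dvd k" using k np sF False by (auto dest: dvd_imp_le)
      then show ?thesis using unity_eq_1_iff[of "2 ^ (a - 2)" k] unity_commute[of "2 ^ (a - 2)" k 1] by simp
    qed
    finally show ?thesis by (intro exI[of _ 3]) simp
  qed
  then obtain b where "coprime b (2 ^ a)" "dch a k s t b \<noteq> 1" by blast
  then have "norm (\<Sum>n=1..N. dch a k s t n) \<le> real (2 ^ a)"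
    using False by (intro norm_dirichlet_char_sum_le[OF dirichlet_char_dch[OF a]]) auto
  also have "\<dots> \<le> 5 * 2 ^ a" by simp
  finally show ?thesis .
next
  case True
  have "coprime (2 ^ a) (5 :: nat)" by simp
  from binary_chinese_remainder_nat[OF this, of 1 2]
  obtain b :: nat where b: "[b = 1] (mod 2 ^ a)" "[b = 2] (mod 5)" by blast
  have "[b = 1] (mod 8)" by (rule cong_dvd_modulus_nat[OF b(1) eight_dvd_pow2[OF a]])
  then have b8: "b mod 8 = 1" by (simp add: cong_def)
  have b5: "b mod 5 = 2" using b(2) by (simp add: cong_def)
  have ob: "odd b" using b8 by presburger
  have "[int b = jacm8 b * 3 ^ 0] (mod 2 ^ a)"
    using b(1) b8 cong_int_iff[of b 1 "2 ^ a"] by (simp add: jacm8_def)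
  then have "[log3 a b = 0] (mod 2 ^ (a - 2))" by (rule log3_unique[OF a ob])
  then have "unity (2 ^ (a - 2)) k (log3 a b) = 1" using unity_cong[of "2 ^ (a - 2)" "log3 a b" 0 k] by simp
  then have "dch a k s t b = -1" using ob b5 b8 True by (simp add: dch_def jacm8_def jac5_def)
  moreover have "coprime b (5 * 2 ^ a)"
  proof -
    have "\<not> 5 dvd b" using b5 by (simp add: dvd_eq_mod_eq_0)
    moreover have "prime (5 :: nat)" by simp
    ultimately have "coprime 5 b" using prime_imp_coprime by blast
    then have "coprime b 5" by (simp add: coprime_commute)
    then show ?thesis using ob by simp
  qed
  ultimately have "norm (\<Sum>n=1..N. dch a k s t n) \<le> real (5 * 2 ^ a)"
    by (intro norm_dirichlet_char_sum_le[OF dirichlet_char_dch[OF a]]) auto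
  then show ?thesis by simp
qed

text \<open>2^(a-3) is half of the order 2^(a-2), so the root of unity becomes (-1)^(log3 n), and
  this is \<open>jac8\<close>.\<close>

lemma dch_eq_real_char:
  assumes a: "a \<ge> 3" and k: "k = 0 \<or> k = 2 ^ (a - 3)"
  shows "dch a k s t = (\<lambda>n. of_int (real_char (k \<noteq> 0) s t n))"
proof
  fix n
  show "dch a k s t n = of_int (real_char (k \<noteq> 0) s t n)"
  proof (cases "even n \<or> k = 0")
    case False
    then have n: "odd n" and k: "k = 2 ^ (a - 3)" using k by auto
    have "[int n = jacm8 n * 3 ^ log3 a n] (mod 8)"
      by (rule cong_dvd_modulus[OF log3[OF a n] eight_dvd_pow2[OF a]])
    moreover have "jacm8 n = (if n mod 8 \<in> {5, 7} then -1 else 1)"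
    proof -
      have "n mod 8 \<in> {1, 3, 5, 7}" using n by auto presburger
      then show ?thesis by (auto simp: jacm8_def)
    qed
    ultimately have "int (n mod 8) = ((if n mod 8 \<in> {5, 7} then -1 else 1) * 3 ^ log3 a n) mod 8"
      by (simp only: cong_def zmod_int of_nat_numeral)
    then have j8: "jac8 n = (if even (log3 a n) then 1 else -1)"
      unfolding signed_three_power_mod_8 by (auto simp: jac8_def split: if_splits)
    have "a - 2 = Suc (a - 3)" using a by simp
    then have h: "real k / real (2 ^ (a - 2)) = 1 / 2" using k by simp
    have "2 * pi * (real k / real (2 ^ (a - 2)) * real (log3 a n)) = real (log3 a n) * pi"
      unfolding h by simp
    then have "2 * pi * (real k * real (log3 a n) / real (2 ^ (a - 2))) = real (log3 a n) * pi"
      by (simp only: times_divide_eq_left)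
    then have "unity (2 ^ (a - 2)) k (log3 a n) = cis (real (log3 a n) * pi)"
      unfolding unity_def by (simp only:)
    also have "\<dots> = cis pi ^ log3 a n" by (rule Complex.DeMoivre[symmetric])
    also have "\<dots> = of_int (jac8 n)" unfolding j8 by simp
    finally show ?thesis using False by (simp add: dch_def real_char_def)
  qed (auto simp: dch_def real_char_def)
qed

lemma unity_conj:
  assumes "k < M"
  shows "unity M ((M - k) mod M) j = cnj (unity M k j)"
proof (cases "k = 0")
  case False
  have "unity M (M - k) j * unity M k j = unity M j (M - k + k)"
    by (simp only: unity_add unity_commute[of M j])
  also have "\<dots> = 1" using assms unity_multiple[of M j 1] by simp
  finally have *: "unity M (M - k) j * unity M k j = 1" .
  have "unity M k j * cnj (unity M k j) = 1" by (simp add: complex_norm_square[symmetric])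
  then have "unity M (M - k) j = unity M (M - k) j * (unity M k j * cnj (unity M k j))" by simp
  also have "\<dots> = cnj (unity M k j)" unfolding mult.assoc[symmetric] * by simp
  finally show ?thesis using False assms by simp
qed (use assms in auto)

lemma norm_L_fun_dch_conj:
  assumes "k < 2 ^ (a - 2)"
  shows "norm (L_fun (dch a ((2 ^ (a - 2) - k) mod 2 ^ (a - 2)) s t) x) = norm (L_fun (dch a k s t) x)"
proof -
  have "L_term (dch a ((2 ^ (a - 2) - k) mod 2 ^ (a - 2)) s t) x = (\<lambda>n. cnj (L_term (dch a k s t) x n))"
    using unity_conj[OF assms] by (intro ext) (simp add: L_term_def dch_def)
  then have "L_fun (dch a ((2 ^ (a - 2) - k) mod 2 ^ (a - 2)) s t) x = cnj (L_fun (dch a k s t) x)"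
    unfolding L_fun_def by (simp only: infsum_cnj)
  then show ?thesis by simp
qed

section \<open>Inert primes congruent to -1 modulo a power of two\<close>

definition inert_primes :: "nat \<Rightarrow> nat set" where
  "inert_primes a = {r. prime r \<and> 2 ^ a dvd Suc r \<and> r mod 5 \<in> {2, 3}}"

definition dch_index :: "nat \<Rightarrow> (nat \<times> bool \<times> bool) set" where
  "dch_index a = {..<2 ^ (a - 2)} \<times> UNIV \<times> UNIV"

definition dch' :: "nat \<Rightarrow> nat \<times> bool \<times> bool \<Rightarrow> nat \<Rightarrow> complex" where
  "dch' a = (\<lambda>(k, s, t). dch a k s t)"

text \<open>For e = 1 all weights are 1 and the weighted character sum is nonnegative. For e = -1 it
  is (1 - \<open>jacm8\<close>)(1 - \<open>jac5\<close>) on the integers congruent to 1 or -1 modulo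
  2^a, up to the factor 2^(a-2), and so singles out the inert primes.\<close>

definition sign_weight :: "real \<Rightarrow> nat \<times> bool \<times> bool \<Rightarrow> real" where
  "sign_weight e = (\<lambda>(k, s, t). (if s then e else 1) * (if t then e else 1))"

lemma finite_dch_index [simp]: "finite (dch_index a)"
  by (simp add: dch_index_def)

lemma card_dch_index: "a \<ge> 3 \<Longrightarrow> card (dch_index a) = 2 ^ a"
proof -
  assume "a \<ge> 3"
  then have "a = Suc (Suc (a - 2))" by simp
  then have "(2 :: nat) ^ a = 2 ^ Suc (Suc (a - 2))" by (rule arg_cong)
  also have "\<dots> = 4 * 2 ^ (a - 2)" by simp
  finally show ?thesis by (simp add: dch_index_def card_cartesian_product card_UNIV_bool)
qed

lemma sum_dch_index:
  "(\<Sum>i\<in>dch_index a. sign_weight e i * Re (dch' a i n)) =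
    (if even n then 0 else (if 2 ^ (a - 2) dvd log3 a n then 2 ^ (a - 2) else 0)
       * (1 + e * of_int (jacm8 n)) * (1 + e * of_int (jac5 n)))"
proof (cases "even n")
  case True
  then show ?thesis by (simp add: dch'_def dch_def case_prod_beta)
next
  case False
  define u where "u k = unity (2 ^ (a - 2)) k (log3 a n)" for k
  define x y where "x = real_of_int (jacm8 n)" and "y = real_of_int (jac5 n)"
  have d: "Re (dch a k s t n) = Re (u k) * (if s then x else 1) * (if t then y else 1)" for k s t
    using False by (auto simp: dch_def u_def x_def y_def)
  have "(\<Sum>i\<in>dch_index a. sign_weight e i * Re (dch' a i n))
      = (\<Sum>k<2 ^ (a - 2). \<Sum>s\<in>UNIV. \<Sum>t\<in>UNIV. (if s then e else 1) * (if t then e else 1) * Re (dch a k s t n))"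
    unfolding dch_index_def sum.cartesian_product by (simp add: sign_weight_def dch'_def case_prod_beta)
  also have "\<dots> = (\<Sum>k<2 ^ (a - 2). Re (u k) * ((1 + e * x) * (1 + e * y)))"
    unfolding d by (intro sum.cong refl) (simp add: UNIV_bool algebra_simps)
  also have "\<dots> = Re (\<Sum>k<2 ^ (a - 2). u k) * ((1 + e * x) * (1 + e * y))"
    by (simp add: sum_distrib_right)
  also have "(\<Sum>k<2 ^ (a - 2). u k) = (if 2 ^ (a - 2) dvd log3 a n then of_nat (2 ^ (a - 2)) else 0)"
    unfolding u_def by (rule sum_unity) simp
  finally show ?thesis using False by (auto simp: x_def y_def mult.assoc)
qed

lemma jac_bounds: "\<bar>real_of_int (jacm8 n)\<bar> \<le> 1" "\<bar>real_of_int (jac5 n)\<bar> \<le> 1"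
  by (auto simp: jacm8_def jac5_def)

lemma sum_dch_index_nonneg: "(\<Sum>i\<in>dch_index a. sign_weight 1 i * Re (dch' a i n)) \<ge> 0"
  unfolding sum_dch_index using jac_bounds[of n]
  by (auto intro!: mult_nonneg_nonneg)

lemma sum_dch_index_inert:
  assumes a: "a \<ge> 3" and p: "prime p"
  shows "(\<Sum>i\<in>dch_index a. sign_weight (-1) i * Re (dch' a i p)) \<le> (if p \<in> inert_primes a then 2 ^ a else 0)"
proof (cases "odd p \<and> 2 ^ (a - 2) dvd log3 a p \<and> jacm8 p \<noteq> 1 \<and> jac5 p \<noteq> 1")
  case False
  then have "(\<Sum>i\<in>dch_index a. sign_weight (-1) i * Re (dch' a i p)) = 0"
    unfolding sum_dch_index by auto
  then show ?thesis by simp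
next
  case True
  then have p8: "jacm8 p = -1"
  proof -
    have "odd p" using True by simp
    then have "p mod 8 = 1 \<or> p mod 8 = 3 \<or> p mod 8 = 5 \<or> p mod 8 = 7" by presburger
    then show ?thesis using True by (auto simp: jacm8_def)
  qed
  have "[log3 a p = 0] (mod 2 ^ (a - 2))" using True by (simp add: cong_0_iff)
  then have "[(3 :: int) ^ log3 a p = 3 ^ 0] (mod 2 ^ a)" using three_power_cong_iff[OF a] by blast
  then have "[jacm8 p * 3 ^ log3 a p = jacm8 p * 3 ^ 0] (mod 2 ^ a)" by (rule cong_scalar_left)
  then have "[int p = jacm8 p * 3 ^ 0] (mod 2 ^ a)"
    using log3[OF a] True cong_trans by blast
  then have "2 ^ a dvd int p + 1" unfolding p8 by (simp add: cong_iff_dvd_diff)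
  then have "int (2 ^ a) dvd int (Suc p)" by (simp add: add.commute)
  then have dvd: "2 ^ a dvd Suc p" by (simp only: int_dvd_int_iff)
  have "p mod 5 \<noteq> 0"
  proof
    assume "p mod 5 = 0"
    then have "5 dvd p" by auto
    moreover have "prime (5 :: nat)" by simp
    ultimately have "p = 5" using p primes_dvd_imp_eq by blast
    moreover have "8 dvd Suc p" using dvd eight_dvd_pow2[OF a, where ?'a = nat] dvd_trans by blast
    ultimately show False by simp
  qed
  moreover have "p mod 5 < 5" by simp
  ultimately have "p mod 5 \<in> {2, 3}" using True by (auto simp: jac5_def split: if_splits)
  then have R: "p \<in> inert_primes a" using p dvd by (simp add: inert_primes_def)
  have "(\<Sum>i\<in>dch_index a. sign_weight (-1) i * Re (dch' a i p)) = 2 ^ (a - 2) * 2 * (1 - real_of_int (jac5 p))"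
    unfolding sum_dch_index using True p8 by simp
  also have "\<dots> \<le> 2 ^ (a - 2) * 2 * 2" using jac_bounds(2)[of p] by (intro mult_left_mono) auto
  also have "\<dots> = 2 ^ a"
  proof -
    have "a = Suc (Suc (a - 2))" using a by simp
    then have "(2 :: real) ^ a = 2 ^ Suc (Suc (a - 2))" by (rule arg_cong)
    then show ?thesis by simp
  qed
  finally show ?thesis using R by simp
qed

lemma dirichlet_char_dch': "a \<ge> 3 \<Longrightarrow> dirichlet_char (5 * 2 ^ a) (dch' a i)"
  by (cases i) (auto simp: dch'_def intro!: dirichlet_char_dch)

lemma abs_sign_weight: "\<bar>e\<bar> = 1 \<Longrightarrow> \<bar>sign_weight e i\<bar> = 1"
  by (cases i) (auto simp: sign_weight_def abs_mult)

text \<open>This L-function is zeta without its factor at 2, that is zeta(s) (1 - 2^(-s)), and the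
  last factor is at least 1/2.\<close>

lemma norm_L_fun_dch_principal_ge:
  assumes a: "a \<ge> 3" and s: "s > 1"
  shows "norm (L_fun (dch' a (0, False, False)) s) \<ge> 1 / (2 * (s - 1))"
proof -
  have "L_fun (dch' a (0, False, False)) s = infsum (L_term (\<lambda>_. 1) s) {n. \<forall>p\<in>{2}. \<not> p dvd n}"
    unfolding L_fun_def by (rule infsum_cong_neutral) (auto simp: L_term_def dch'_def dch_def)
  also have "\<dots> = L_fun (\<lambda>_. 1) s * (\<Prod>p\<in>{2}. 1 - L_term (\<lambda>_. 1) s p)"
    by (rule infsum_coprime[OF dirichlet_char_one s]) auto
  finally have eq: "norm (L_fun (dch' a (0, False, False)) s) = norm (L_fun (\<lambda>_. 1) s) * norm (1 - L_term (\<lambda>_. 1) s 2)"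
    by (simp add: norm_mult)
  have "norm (L_term (\<lambda>_. 1) s 2) \<le> 1 / 2" by (rule norm_L_term_prime[OF dirichlet_char_one s]) simp
  then have "norm (1 - L_term (\<lambda>_. 1) s 2) \<ge> 1 / 2"
    using norm_triangle_ineq2[of 1 "L_term (\<lambda>_. 1) s 2"] by simp
  then have "1 / (s - 1) * (1 / 2) \<le> norm (L_fun (\<lambda>_. 1) s) * norm (1 - L_term (\<lambda>_. 1) s 2)"
    using norm_L_fun_one_ge[OF s] by (intro mult_mono) auto
  moreover have "1 / (2 * (s - 1)) = 1 / (s - 1) * (1 / 2)" by (simp add: field_simps)
  ultimately show ?thesis unfolding eq by (simp only:)
qed

lemma norm_dch'_sum_le:
  assumes a: "a \<ge> 3" and i: "i \<in> dch_index a" "i \<noteq> (0, False, False)"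
  shows "norm (\<Sum>n=1..N. dch' a i n) \<le> 5 * 2 ^ a"
proof -
  obtain k s t where i': "i = (k, s, t)" by (cases i)
  show ?thesis using norm_dch_sum_le[OF a, of k s t N] i by (auto simp: i' dch'_def dch_index_def)
qed

lemma sum_ln_L_fun_dch_ge:
  assumes a: "a \<ge> 3" and s: "s > 1"
  shows "(\<Sum>i\<in>dch_index a. ln (norm (L_fun (dch' a i) s))) \<ge> - 2 * 2 ^ a"
proof -
  have w: "sign_weight 1 i = 1" for i by (cases i) (auto simp: sign_weight_def)
  have "0 - 2 * real (card (dch_index a)) \<le> (\<Sum>i\<in>dch_index a. sign_weight 1 i * ln (norm (L_fun (dch' a i) s)))"
  proof (rule sum_ln_L_fun_ge[where q = "\<lambda>_. 5 * 2 ^ a"])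
    show "0 \<le> (\<Sum>p\<in>primes_le N. (\<Sum>i\<in>dch_index a. sign_weight 1 i * Re (dch' a i p)) * real p powr (- s))" for N
      by (intro sum_nonneg mult_nonneg_nonneg sum_dch_index_nonneg) auto
  qed (use s dirichlet_char_dch'[OF a] w in auto)
  then show ?thesis by (simp add: w card_dch_index[OF a])
qed

lemma sum_ln_L_fun_dch_le:
  assumes a: "a \<ge> 3" and s: "s > 1"
    and B: "\<And>N. (\<Sum>p\<in>primes_le N \<inter> inert_primes a. real p powr (- s)) \<le> B"
  shows "(\<Sum>i\<in>dch_index a. sign_weight (-1) i * ln (norm (L_fun (dch' a i) s))) \<le> 2 ^ a * B + 2 * 2 ^ a"
proof -
  have "(\<Sum>i\<in>dch_index a. sign_weight (-1) i * ln (norm (L_fun (dch' a i) s))) \<le> 2 ^ a * B + 2 * real (card (dch_index a))"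
  proof (rule sum_ln_L_fun_le[where q = "\<lambda>_. 5 * 2 ^ a"])
    fix N
    have "(\<Sum>p\<in>primes_le N. (\<Sum>i\<in>dch_index a. sign_weight (-1) i * Re (dch' a i p)) * real p powr (- s))
        \<le> (\<Sum>p\<in>primes_le N. (if p \<in> inert_primes a then 2 ^ a else 0) * real p powr (- s))"
      by (intro sum_mono mult_right_mono sum_dch_index_inert[OF a]) (auto simp: primes_le_def)
    also have "\<dots> = (\<Sum>p\<in>primes_le N. if p \<in> inert_primes a then 2 ^ a * real p powr (- s) else 0)"
      by (intro sum.cong) auto
    also have "\<dots> = 2 ^ a * (\<Sum>p\<in>primes_le N \<inter> inert_primes a. real p powr (- s))"
      by (simp only: sum.inter_restrict[OF finite_primes_le, symmetric] sum_distrib_left)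
    also have "\<dots> \<le> 2 ^ a * B" by (intro mult_left_mono B) auto
    finally show "(\<Sum>p\<in>primes_le N. (\<Sum>i\<in>dch_index a. sign_weight (-1) i * Re (dch' a i p)) * real p powr (- s)) \<le> 2 ^ a * B" .
  qed (use s dirichlet_char_dch'[OF a] abs_sign_weight[of "-1"] in auto)
  then show ?thesis by (simp add: card_dch_index[OF a])
qed

text \<open>The total negative part of the \<open>ln |L|\<close> is controlled at \<open>s0\<close> by positivity of the product
  of all L-functions, and then transported to \<open>s < s0\<close> by the Lipschitz bound.\<close>
lemma sum_inert_primes_ge:
  fixes s :: real
  assumes a: "a \<ge> 3" and s: "1 < s" "s - 1 < exp (- 4 * real a * 2 ^ a)"
    and B: "\<And>N. (\<Sum>p\<in>primes_le N \<inter> inert_primes a. real p powr (- s)) \<le> B"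
  shows "ln (1 / (s - 1)) \<le> 2 ^ a * B + 12 * real a * 2 ^ a"
proof -
  define X :: real where "X = 2 ^ a"
  define q :: real where "q = 5 * 2 ^ a"
  define i0 :: "nat \<times> bool \<times> bool" where "i0 = (0, False, False)"
  define I where "I = dch_index a - {i0}"
  define l where "l x i = ln (norm (L_fun (dch' a i) x))" for x i
  \<comment> \<open>Chosen so that -2 X - ln 2 - Z - X ln q >= 2 (ln (60 q) - Z). In the complex
    case this becomes |L(s0)| >= 60 q (s0 - 1), twice the Lipschitz bound on the way from s0 to
    s.\<close>
  define Z where "Z = 2 * X + X * ln q + 2 * ln (60 * q) + 1"
  define s0 where "s0 = 1 + exp (- Z)"
  have X8: "X \<ge> 8" unfolding X_def using power_increasing[OF a, of "2 :: real"] by simp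
  have a3: "real a \<ge> 3" using a by simp
  have e72: "exp 1 \<ge> (5 / 2 :: real)" using exp_lower_Taylor_quadratic[of 1] by simp
  have le_exp: "ln x \<le> real n" if "0 < x" "x \<le> (5 / 2) ^ n" for x n
  proof -
    have "x \<le> exp 1 ^ n" using that power_mono[OF e72, of n] by linarith
    then have "ln x \<le> ln (exp 1 ^ n)" using that by (subst ln_le_cancel_iff) auto
    then show ?thesis by (simp add: ln_realpow)
  qed
  have ln5: "ln 5 \<le> (2 :: real)" using le_exp[of 5 2] by (simp add: power_divide)
  have ln2: "ln 2 \<le> (1 :: real)" using le_exp[of 2 1] by simp
  have ln9: "ln 9 \<le> (3 :: real)" using le_exp[of 9 3] by (simp add: power_divide)
  have ln60: "ln 60 \<le> (5 :: real)" using le_exp[of 60 5] by (simp add: power_divide)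
  have q1: "q \<ge> 1" using X8 by (simp add: q_def X_def)
  have "ln q = ln 5 + real a * ln 2" unfolding q_def by (simp add: ln_mult_pos ln_realpow)
  also have "\<dots> \<le> 2 + real a * 1" using ln2 by (intro add_mono ln5 mult_left_mono) auto
  finally have lnq: "ln q \<le> 2 * real a" using a3 by simp
  have lnq0: "ln q \<ge> 0" using q1 by simp
  have ln60q: "ln (60 * q) = ln 60 + ln q" using q1 by (intro ln_mult_pos) auto
  have aX: "3 * X \<le> real a * X" "8 * real a \<le> real a * X"
    using a3 X8 by (auto simp: mult.commute[of 8] intro!: mult_left_mono mult_right_mono)
  have XlnqU: "X * ln q \<le> 2 * (real a * X)" using mult_left_mono[OF lnq, of X] X8 by (simp add: mult_ac)
  have Xlnq0: "X * ln q \<ge> 0" using X8 lnq0 by simp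
  have Z4: "Z \<le> 4 * (a * X)"
  proof -
    have "2 * x + w + 2 * (c + v) + 1 \<le> 4 * A" if "w \<le> 2 * A" "v \<le> 2 * b" "c \<le> 5" "3 * x \<le> A" "8 * b \<le> A" "8 \<le> x"
      for x w c v A b :: real using that by argo
    from this[OF XlnqU lnq ln60 aX X8] show ?thesis unfolding Z_def ln60q .
  qed
  have Z0: "Z > 0" unfolding Z_def ln60q using Xlnq0 lnq0 X8 by (simp add: add_nonneg_pos)
  have s0: "1 < s0" "s0 \<le> 2" using Z0 by (auto simp: s0_def)
  have "exp (- 4 * real a * 2 ^ a) \<le> exp (- Z)" using Z4 by (simp add: X_def mult.assoc)
  with s(2) have "s - 1 < exp (- Z)" by (rule less_le_trans)
  then have ss0: "s < s0" by (simp add: s0_def)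
  have i0: "i0 \<in> dch_index a" by (simp add: i0_def dch_index_def)
  have fI: "finite I" by (simp add: I_def)
  have cI: "real (card I) \<le> X"
    unfolding I_def X_def using card_dch_index[OF a] by (simp add: card_Diff_singleton_if)
  have nz: "norm (L_fun (dch' a i) x) > 0" if "x > 1" for i x
    using L_fun_nonzero[OF dirichlet_char_dch'[OF a] that] by simp
  have up: "l x i \<le> ln q" if "i \<in> I" "x > 1" for i x
  proof -
    have "norm (L_fun (dch' a i) x) \<le> q"
      unfolding q_def using that
      by (intro norm_L_fun_le[OF dirichlet_char_dch'[OF a]] norm_dch'_sum_le[OF a]) (auto simp: I_def i0_def)
    then show ?thesis unfolding l_def using nz[OF that(2), of i] q1 by (subst ln_le_cancel_iff) auto
  qed
  have up0: "l s0 i0 \<le> ln 2 + Z"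
  proof -
    have "norm (L_fun (dch' a i0) s0) \<le> 1 + 1 / (s0 - 1)"
      by (rule norm_L_fun_le_zeta[OF dirichlet_char_dch'[OF a] s0(1)])
    also have "\<dots> = 1 + exp Z" by (simp add: s0_def exp_minus divide_inverse)
    also have "\<dots> \<le> 2 * exp Z" using Z0 by simp
    finally have "l s0 i0 \<le> ln (2 * exp Z)"
      unfolding l_def using nz[OF s0(1), of i0] by (subst ln_le_cancel_iff) auto
    then show ?thesis by (simp add: ln_mult_pos)
  qed
  have split: "(\<Sum>i\<in>dch_index a. f i) = f i0 + (\<Sum>i\<in>I. f i)" for f :: "nat \<times> bool \<times> bool \<Rightarrow> real"
    unfolding I_def by (rule sum.remove[OF finite_dch_index i0])
  \<comment> \<open>Positivity bounds the sum over all characters below by -2 X, and the pole of the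
    principal one accounts for at most ln 2 + Z.\<close>
  have tot: "(\<Sum>i\<in>I. l s0 i) \<ge> - 2 * X - ln 2 - Z"
    using sum_ln_L_fun_dch_ge[OF a s0(1)] split[of "l s0"] up0 unfolding l_def X_def by linarith
  have transport: "l s i \<ge> min 0 (l s0 i) - 3" if i: "i \<in> I" for i
  proof -
    obtain k x t where kxt: "i = (k, x, t)" by (cases i)
    have kM: "k < 2 ^ (a - 2)" using i by (auto simp: I_def dch_index_def kxt)
    have BN: "norm (\<Sum>n=1..N. dch' a i n) \<le> q" for N
      unfolding q_def using i by (intro norm_dch'_sum_le[OF a]) (auto simp: I_def i0_def)
    show ?thesis
    proof (cases "k = 0 \<or> k = 2 ^ (a - 3)")
      case True
      have eq: "dch' a i = (\<lambda>n. of_int (real_char (k \<noteq> 0) x t n))"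
        using dch_eq_real_char[OF a True, of x t] by (simp add: kxt dch'_def)
      have "k \<noteq> 0 \<or> x \<or> t" using i by (auto simp: I_def i0_def kxt)
      then have "1 / 9 \<le> norm (L_fun (\<lambda>n. of_int (real_char (k \<noteq> 0) x t n)) s)"
        using dirichlet_char_dch'[OF a, of i] BN s ss0 s0 unfolding eq
        by (intro norm_L_fun_real_ge real_char_double_sums) auto
      then have "ln (1 / 9) \<le> l s i" unfolding l_def eq by (subst ln_le_cancel_iff) (auto intro: less_le_trans[of _ "1 / 9"])
      then have "- ln 9 \<le> l s i" by (simp add: ln_div)
      then show ?thesis using ln9 by linarith
    next
      case False
      \<comment> \<open>The conjugate character is a different one with the same |L|, and the others
        contribute at most ln q each, so i bears at most half of the deficit.\<close>
      define j where "j = ((2 ^ (a - 2) - k) mod 2 ^ (a - 2), x, t)"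
      have k2: "2 ^ (a - 2) - k < 2 ^ (a - 2)" using False kM by simp
      have M2: "(2 :: nat) ^ (a - 2) = 2 * 2 ^ (a - 3)"
      proof -
        have "a - 2 = Suc (a - 3)" using a by simp
        then show ?thesis by simp
      qed
      have jk: "j = (2 ^ (a - 2) - k, x, t)" using k2 by (simp add: j_def)
      have ji: "j \<noteq> i" using False kM M2 unfolding jk kxt by auto
      have jI: "j \<in> I" using kM k2 unfolding jk I_def dch_index_def i0_def by auto
      have lj: "l s0 j = l s0 i"
        unfolding l_def j_def kxt dch'_def split_conv by (simp only: norm_L_fun_dch_conj[OF kM])
      have "(\<Sum>i'\<in>I. l s0 i') = l s0 i + (l s0 j + (\<Sum>i'\<in>I - {i} - {j}. l s0 i'))"
        using fI i jI ji by (simp add: sum.remove)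
      also have "(\<Sum>i'\<in>I - {i} - {j}. l s0 i') \<le> (\<Sum>i'\<in>I - {i} - {j}. ln q)"
        using up s0 by (intro sum_mono) auto
      also have "\<dots> \<le> (\<Sum>i'\<in>I. ln q)" using fI lnq0 by (intro sum_mono2) auto
      also have "\<dots> \<le> X * ln q" using cI lnq0 by (simp add: mult_right_mono)
      finally have two: "2 * l s0 i \<ge> - 2 * X - ln 2 - Z - X * ln q" using tot lj by linarith
      have "2 * (ln (60 * q) - Z) \<le> 2 * l s0 i" using two ln2 Z_def by argo
      then have "ln (60 * q) - Z \<le> l s0 i" by simp
      then have "exp (ln (60 * q) - Z) \<le> exp (l s0 i)" by simp
      also have "exp (ln (60 * q) - Z) = 60 * q * exp (- Z)" using q1 by (simp add: exp_diff exp_minus divide_inverse)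
      also have "exp (l s0 i) = norm (L_fun (dch' a i) s0)" unfolding l_def using nz[OF s0(1), of i] by simp
      finally have big: "60 * q * exp (- Z) \<le> norm (L_fun (dch' a i) s0)" .
      have "norm (L_fun (dch' a i) s - L_fun (dch' a i) s0) \<le> 30 * q * (s0 - s)"
        using s(1) ss0 s0(2) BN by (rule L_fun_Lipschitz[OF dirichlet_char_dch'[OF a]])
      also have "\<dots> \<le> 30 * q * exp (- Z)" using s q1 by (intro mult_left_mono) (auto simp: s0_def)
      also have "\<dots> \<le> norm (L_fun (dch' a i) s0) / 2" using big by simp
      finally have "norm (L_fun (dch' a i) s0) / 2 \<le> norm (L_fun (dch' a i) s)"
        using norm_triangle_ineq2[of "L_fun (dch' a i) s0" "L_fun (dch' a i) s"] by (simp add: norm_minus_commute)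
      then have "ln (norm (L_fun (dch' a i) s0) / 2) \<le> l s i"
        unfolding l_def using nz[OF s0(1), of i] nz[OF s(1), of i] by (subst ln_le_cancel_iff) auto
      then have "l s0 i - ln 2 \<le> l s i" unfolding l_def using nz[OF s0(1), of i] by (simp add: ln_div)
      then show ?thesis using ln2 by linarith
    qed
  qed
  \<comment> \<open>The positive parts total at most X ln q, so all negative parts together cost no
    more than the total deficit. Bounding them one by one would multiply it by the number of
    characters.\<close>
  have neg: "(\<Sum>i\<in>I. min 0 (l s0 i)) \<ge> - 2 * X - ln 2 - Z - X * ln q"
  proof -
    have "(\<Sum>i\<in>I. l s0 i) \<le> (\<Sum>i\<in>I. min 0 (l s0 i) + ln q)"
      using up s0 lnq0 by (intro sum_mono) (auto simp: min_def)
    also have "\<dots> = (\<Sum>i\<in>I. min 0 (l s0 i)) + card I * ln q" by (simp add: sum.distrib)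
    also have "card I * ln q \<le> X * ln q" using cI lnq0 by (intro mult_right_mono)
    finally show ?thesis using tot by linarith
  qed
  have "(\<Sum>i\<in>I. sign_weight (-1) i * l s i) \<ge> (\<Sum>i\<in>I. min 0 (l s0 i) - (3 + ln q))"
  proof (rule sum_mono)
    fix i assume i: "i \<in> I"
    have "\<bar>sign_weight (-1) i\<bar> = 1" by (rule abs_sign_weight) simp
    then have "sign_weight (-1) i * l s i \<ge> - \<bar>l s i\<bar>"
      using abs_ge_minus_self[of "sign_weight (-1) i * l s i"] by (simp add: abs_mult)
    then show "min 0 (l s0 i) - (3 + ln q) \<le> sign_weight (-1) i * l s i"
      using transport[OF i] up[OF i s(1)] lnq0 by linarith
  qed
  moreover have "(\<Sum>i\<in>I. min 0 (l s0 i) - (3 + ln q)) = (\<Sum>i\<in>I. min 0 (l s0 i)) - card I * (3 + ln q)"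
    by (simp add: sum_subtractf)
  moreover have "card I * (3 + ln q) \<le> X * (3 + ln q)" using cI lnq0 by (intro mult_right_mono) auto
  ultimately have low: "(\<Sum>i\<in>I. sign_weight (-1) i * l s i) \<ge> - 2 * X - ln 2 - Z - X * ln q - X * (3 + ln q)"
    using neg by linarith
  have "ln (1 / (2 * (s - 1))) \<le> l s i0"
    unfolding l_def i0_def using norm_L_fun_dch_principal_ge[OF a s(1)] nz[OF s(1), of "(0, False, False)"] s
    by (subst ln_le_cancel_iff) auto
  moreover have "ln (1 / (2 * (s - 1))) = ln (1 / (s - 1)) - ln 2"
  proof -
    have "1 / (2 * (s - 1)) = (1 / (s - 1)) / 2" using s by (simp add: field_simps)
    moreover have "ln ((1 / (s - 1)) / 2) = ln (1 / (s - 1)) - ln 2"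
      by (rule ln_divide_pos) (use s in auto)
    ultimately show ?thesis by (simp only:)
  qed
  moreover have "sign_weight (-1) i0 = 1" by (simp add: i0_def sign_weight_def)
  ultimately have "ln (1 / (s - 1)) - ln 2 \<le> sign_weight (-1) i0 * l s i0" by simp
  then have "ln (1 / (s - 1)) - ln 2 - 2 * X - ln 2 - Z - X * ln q - X * (3 + ln q)
      \<le> (\<Sum>i\<in>dch_index a. sign_weight (-1) i * l s i)"
    unfolding split[of "\<lambda>i. sign_weight (-1) i * l s i"] using low by linarith
  also have "\<dots> \<le> X * B + 2 * X"
    unfolding l_def X_def by (rule sum_ln_L_fun_dch_le[OF a s(1) B])
  finally have "ln (1 / (s - 1)) \<le> X * B + (2 * ln 2 + 4 * X + Z + 2 * (X * ln q) + 3 * X)"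
    by (simp add: algebra_simps)
  also have "\<dots> \<le> X * B + 12 * (a * X)"
    using XlnqU Z4 aX ln2 X8 a3 by linarith
  finally show ?thesis by (simp add: X_def)
qed

section \<open>Primes at which the cubic does not split\<close>

lemma sum_Un_le:
  fixes f :: "'a \<Rightarrow> real"
  assumes "finite A" "finite B" "\<And>x. f x \<ge> 0"
  shows "sum f (A \<union> B) \<le> sum f A + sum f B"
  using sum.union_inter[OF assms(1,2), of f] sum_nonneg[of "A \<inter> B" f] assms(3) by simp

lemma dirichlet_char_jacm15: "dirichlet_char 15 (\<lambda>n. of_int (jacm15 n))"
  unfolding dirichlet_char_def
proof (intro conjI allI)
  show "complex_of_int (jacm15 (n + 15)) = of_int (jacm15 n)" for n by (simp add: jacm15_def)
  show "norm (complex_of_int (jacm15 n)) \<le> 1" for n by (simp add: jacm15_def)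
qed (simp_all add: jacm15_mult, simp add: jacm15_def)

text \<open>The two characters 1 and \<open>jacm15\<close> add up to 2 on the four classes and to 0
  on all other primes except 3 and 5. The 9 is 2 for 3 and 5, 4 from \<open>sum_ln_L_fun_le\<close>,
  and 3 for |L| >= 1/9.\<close>

lemma sum_primes_mod_15_ge:
  assumes s: "1 < s" "s \<le> 2"
    and B: "\<And>N. (\<Sum>p\<in>primes_le N \<inter> {p. p mod 15 \<in> {1, 2, 4, 8}}. real p powr (- s)) \<le> B"
  shows "ln (1 / (s - 1)) \<le> 2 * B + 9"
proof -
  define ch :: "bool \<Rightarrow> nat \<Rightarrow> complex" where "ch b = (if b then (\<lambda>_. 1) else (\<lambda>n. of_int (jacm15 n)))" for b
  have dc: "dirichlet_char (if b then 1 else 15) (ch b)" for b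
    using dirichlet_char_one dirichlet_char_jacm15 by (simp add: ch_def)
  have "(\<Sum>b\<in>UNIV. 1 * ln (norm (L_fun (ch b) s))) \<le> (2 * B + 2) + 2 * real (card (UNIV :: bool set))"
  proof (rule sum_ln_L_fun_le[where q = "\<lambda>b. if b then 1 else 15"])
    fix N
    let ?G = "{p :: nat. p mod 15 \<in> {1, 2, 4, 8}}"
    have "(\<Sum>p\<in>primes_le N. (\<Sum>b\<in>UNIV. 1 * Re (ch b p)) * real p powr (- s))
        \<le> (\<Sum>p\<in>primes_le N. (if p \<in> ?G then 2 * real p powr (- s) else 0) + (if p \<in> {3, 5} then 1 else 0))"
    proof (rule sum_mono)
      fix p assume "p \<in> primes_le N"
      then have p: "prime p" by (simp add: primes_le_def)
      have p1: "real p powr (- s) \<le> 1"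
      proof -
        have "real p powr (- s) \<le> real p powr 0"
          using prime_gt_0_nat[OF p] s by (intro powr_mono) auto
        then show ?thesis using prime_gt_0_nat[OF p] by simp
      qed
      have e: "(\<Sum>b\<in>UNIV. 1 * Re (ch b p)) = 1 + real_of_int (jacm15 p)"
        by (simp add: UNIV_bool ch_def)
      consider "p \<in> ?G" | "jacm15 p = -1" "p \<notin> ?G" | "p \<notin> ?G" "p = 3 \<or> p = 5"
      proof -
        have 1: "p \<in> ?G \<or> p mod 15 \<in> {7, 11, 13, 14} \<or> p mod 15 \<in> {0, 3, 5, 6, 9, 10, 12}"
        proof -
          have "m = 0 \<or> m = 1 \<or> m = 2 \<or> m = 3 \<or> m = 4 \<or> m = 5 \<or> m = 6 \<or> m = 7 \<or> m = 8 \<or> m = 9 \<or>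
            m = 10 \<or> m = 11 \<or> m = 12 \<or> m = 13 \<or> m = 14" if "m < 15" for m :: nat
            using that by presburger
          from this[of "p mod 15"] show ?thesis by auto
        qed
        have 2: "p = 3 \<or> p = 5" if "p mod 15 \<in> {0, 3, 5, 6, 9, 10, 12}"
        proof -
          have "p mod 3 = (p mod 15) mod 3" "p mod 5 = (p mod 15) mod 5" by (simp_all add: mod_mod_cancel)
          then have "p mod 3 = 0 \<or> p mod 5 = 0" using that by auto
          then have "3 dvd p \<or> 5 dvd p" by auto
          moreover have "prime (3 :: nat)" "prime (5 :: nat)" by simp_all
          ultimately show ?thesis using p primes_dvd_imp_eq by metis
        qed
        show ?thesis using 1 2 that by (auto simp: jacm15_def)
      qed
      then show "(\<Sum>b\<in>UNIV. 1 * Re (ch b p)) * real p powr (- s)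
          \<le> (if p \<in> ?G then 2 * real p powr (- s) else 0) + (if p \<in> {3, 5} then 1 else 0)"
      proof cases
        case 1
        then have "jacm15 p = 1" by (auto simp: jacm15_def)
        then show ?thesis using 1 unfolding e by simp
      next
        case 2
        then show ?thesis unfolding e by simp
      next
        case 3
        then have "jacm15 p = 0" by (auto simp: jacm15_def)
        then show ?thesis using 3 p1 unfolding e by auto
      qed
    qed
    also have "\<dots> = 2 * (\<Sum>p\<in>primes_le N \<inter> ?G. real p powr (- s)) + (\<Sum>p\<in>primes_le N \<inter> {3, 5}. 1)"
      by (simp only: sum.distrib sum.inter_restrict[OF finite_primes_le, symmetric] sum_distrib_left)
    also have "(\<Sum>p\<in>primes_le N \<inter> {3, 5}. 1 :: real) \<le> (\<Sum>p\<in>{3, 5 :: nat}. 1)" by (intro sum_mono2) auto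
    finally show "(\<Sum>p\<in>primes_le N. (\<Sum>b\<in>UNIV. 1 * Re (ch b p)) * real p powr (- s)) \<le> 2 * B + 2"
      using B[of N] by simp
  qed (use s dc in auto)
  then have "ln (norm (L_fun (\<lambda>_. 1) s)) + ln (norm (L_fun (\<lambda>n. of_int (jacm15 n)) s)) \<le> 2 * B + 6"
    by (simp add: UNIV_bool ch_def)
  moreover have "ln (1 / (s - 1)) \<le> ln (norm (L_fun (\<lambda>_. 1) s))"
    using norm_L_fun_one_ge[OF s(1)] s by (intro ln_mono) auto
  moreover have "- 3 \<le> ln (norm (L_fun (\<lambda>n. of_int (jacm15 n)) s))"
  proof -
    have "coprime 7 (15 :: nat)" by (simp add: coprime_iff_gcd_eq_1 gcd_non_0_nat)
    moreover have "complex_of_int (jacm15 7) \<noteq> 1" by (simp add: jacm15_def)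
    ultimately have "norm (\<Sum>n=1..N. complex_of_int (jacm15 n)) \<le> real 15" for N
      by (intro norm_dirichlet_char_sum_le[OF dirichlet_char_jacm15]) auto
    then have "1 / 9 \<le> norm (L_fun (\<lambda>n. of_int (jacm15 n)) s)"
      by (intro norm_L_fun_real_ge[OF dirichlet_char_jacm15 s _ jacm15_double_sums])
    then have 1: "ln (1 / 9) \<le> ln (norm (L_fun (\<lambda>n. of_int (jacm15 n)) s))"
      by (intro ln_mono) auto
    have "(9 :: real) \<le> (5 / 2) ^ 3" by (simp add: power_divide)
    also have "\<dots> \<le> exp 1 ^ 3" using exp_lower_Taylor_quadratic[of 1] by (intro power_mono) auto
    also have "\<dots> = exp 3" by (simp flip: exp_of_nat_mult)
    finally have "ln 9 \<le> ln (exp 3 :: real)" by (intro ln_mono) auto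
    then have "ln 9 \<le> (3 :: real)" by simp
    moreover have "ln (1 / 9) = - ln (9 :: real)" by (simp add: ln_div)
    ultimately show ?thesis using 1 by linarith
  qed
  ultimately show ?thesis by linarith
qed

text \<open>In these classes fewer than three roots means none. The bound 27 is the one under which
  \<open>card_root_choices_le\<close> counts the split primes.\<close>

definition cubic_primes :: "nat set" where
  "cubic_primes = {r. prime r \<and> r > 27 \<and> r mod 15 \<in> {1, 2, 4, 8} \<and> card (cubic_roots r) < 3}"

text \<open>In terms of density, half of the primes lie in the four classes and at most a third
  split, which leaves a sixth. Solving l <= 2 (B + l / 3 + 6 + 27) + 9 for l gives 6 B + 225; the 27
  pays for the integers up to 27.\<close>

lemma sum_cubic_primes_ge:
  assumes s: "1 < s" "s \<le> 2"
    and B: "\<And>N. (\<Sum>p\<in>primes_le N \<inter> cubic_primes. real p powr (- s)) \<le> B"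
  shows "ln (1 / (s - 1)) \<le> 6 * B + 225"
proof -
  define l where "l = ln (1 / (s - 1))"
  have "l \<le> 2 * (B + (l / 3 + 6) + 27) + 9"
    unfolding l_def
  proof (rule sum_primes_mod_15_ge[OF s])
    fix N
    let ?G = "{p :: nat. p mod 15 \<in> {1, 2, 4, 8}}"
    let ?S = "{p \<in> primes_le N. p > 27 \<and> card (cubic_roots p) \<ge> 3}"
    have "(\<Sum>p\<in>primes_le N \<inter> ?G. real p powr (- s))
        \<le> (\<Sum>p\<in>(primes_le N \<inter> cubic_primes) \<union> ?S \<union> {1..27}. real p powr (- s))"
    proof (rule sum_mono2)
      show "primes_le N \<inter> ?G \<subseteq> (primes_le N \<inter> cubic_primes) \<union> ?S \<union> {1..27}"
      proof
        fix p assume p: "p \<in> primes_le N \<inter> ?G"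
        then have "p \<ge> 1" using prime_ge_1_nat by (auto simp: primes_le_def)
        then show "p \<in> (primes_le N \<inter> cubic_primes) \<union> ?S \<union> {1..27}"
          using p by (cases "p > 27"; cases "card (cubic_roots p) < 3") (auto simp: primes_le_def cubic_primes_def)
      qed
    qed auto
    also have "\<dots> \<le> (\<Sum>p\<in>(primes_le N \<inter> cubic_primes) \<union> ?S. real p powr (- s)) + (\<Sum>p\<in>{1..27 :: nat}. real p powr (- s))"
      by (rule sum_Un_le) auto
    also have "(\<Sum>p\<in>(primes_le N \<inter> cubic_primes) \<union> ?S. real p powr (- s))
        \<le> (\<Sum>p\<in>primes_le N \<inter> cubic_primes. real p powr (- s)) + (\<Sum>p\<in>?S. real p powr (- s))"
      by (rule sum_Un_le) auto
    also have "(\<Sum>p\<in>?S. real p powr (- s)) \<le> ln (1 / (s - 1)) / 3 + 6"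
      by (rule sum_split_cubic_le[OF _ _ s]) (auto simp: primes_le_def)
    also have "(\<Sum>p\<in>{1..27 :: nat}. real p powr (- s)) \<le> (\<Sum>p\<in>{1..27 :: nat}. 1)"
    proof (rule sum_mono)
      fix p :: nat assume "p \<in> {1..27}"
      then show "real p powr (- s) \<le> 1" using s powr_mono[of "- s" 0 "real p"] by simp
    qed
    finally show "(\<Sum>p\<in>primes_le N \<inter> ?G. real p powr (- s)) \<le> B + (ln (1 / (s - 1)) / 3 + 6) + 27"
      using B[of N] by simp
  qed
  then show ?thesis unfolding l_def[symmetric] by argo
qed

text \<open>Passing from \<open>\<Sum> p powr (- s)\<close> to \<open>\<Sum> 1 / p\<close>: with \<open>s - 1 = 2 ln ln W / ln W\<close> the integers
  beyond \<open>W\<close> contribute at most 1.\<close>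
lemma sum_powr_le_sum_inverse:
  fixes W :: nat and R :: "nat set"
  assumes y: "ln (real W) \<ge> 4096"
  defines "s \<equiv> 1 + 2 * ln (ln (real W)) / ln (real W)"
  shows "(\<Sum>p\<in>primes_le N \<inter> R. real p powr (- s)) \<le> (\<Sum>p\<in>primes_le W \<inter> R. 1 / real p) + 1"
    and "1 < s" and "s \<le> 2" and "ln (1 / (s - 1)) \<ge> ln (ln (real W)) / 2"
proof -
  define z where "z = ln (real W)"
  have z: "z \<ge> 4096" using y by (simp add: z_def)
  have W: "W > 0" using y by (cases W) auto
  have lnz: "ln z \<ge> 1"
  proof -
    have "exp 1 \<le> (3 :: real)" by (rule exp_le)
    then have "ln (exp 1) \<le> ln z" using z by (intro ln_mono) auto
    then show ?thesis by simp
  qed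
  have s: "s - 1 = 2 * ln z / z" by (simp add: s_def z_def)
  show s1: "1 < s" using s lnz z by (metis diff_gt_0_iff_gt divide_pos_pos less_le_trans mult_pos_pos zero_less_numeral zero_less_one)
  \<comment> \<open>With the fourth root, ln z <= 4 (u - 1), so 2 ln z <= 8 u - 8 <= u^2 as soon as
    u >= 8; this is where 4096 = 8^4 comes from.\<close>
  define u where "u = z powr (1 / 4)"
  have u4: "u ^ 4 = z" using z by (simp add: u_def powr_powr flip: powr_numeral)
  have u8: "u \<ge> 8"
  proof -
    have "(8 :: real) = 4096 powr (1 / 4)"
      using powr_powr[of 8 4 "1 / 4 :: real"] by simp
    also have "\<dots> \<le> u" unfolding u_def using z by (intro powr_mono2) auto
    finally show ?thesis .
  qed
  have "ln z = 4 * ln u" using z by (simp add: u_def ln_powr)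
  also have "\<dots> \<le> 4 * (u - 1)" using u8 ln_le_minus_one[of u] by simp
  finally have "2 * ln z \<le> 8 * u - 8" by simp
  also have "\<dots> \<le> u ^ 2"
  proof -
    have "8 * u \<le> u * u" using u8 by (intro mult_right_mono) auto
    then show ?thesis by (simp add: power2_eq_square)
  qed
  finally have small: "2 * ln z \<le> u ^ 2" .
  have u2: "u ^ 2 * u ^ 2 = z" unfolding u4[symmetric] by (simp flip: power_add)
  have "s - 1 \<le> u ^ 2 / z" unfolding s using small z by (intro divide_right_mono) auto
  also have "\<dots> = 1 / u ^ 2" unfolding u2[symmetric]
    by (rule nonzero_divide_mult_cancel_left) (use u8 in auto)
  finally have s_small: "s - 1 \<le> 1 / u ^ 2" .
  have u21: "u ^ 2 \<ge> 1" using u8 by (intro one_le_power) auto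
  have "1 / u ^ 2 \<le> 1"
  proof (subst divide_le_eq_1_pos)
    show "0 < u ^ 2" using u8 by simp
  qed (rule u21)
  then show "s \<le> 2" using s_small by linarith
  have "0 < u ^ 2" "0 < s - 1" using u8 s1 by auto
  then have "u ^ 2 \<le> 1 / (s - 1)"
    using s_small by (simp only: pos_le_divide_eq mult.commute)
  then have "ln (u ^ 2) \<le> ln (1 / (s - 1))" using u8 by (intro ln_mono) auto
  moreover have "ln (u ^ 2) = ln z / 2" using u8 by (simp add: u4[symmetric] ln_realpow)
  ultimately show "ln (1 / (s - 1)) \<ge> ln (ln (real W)) / 2" by (simp add: z_def)
  have "(\<Sum>p\<in>primes_le N \<inter> R. real p powr (- s)) \<le> (\<Sum>p\<in>(primes_le W \<inter> R) \<union> {Suc W..N}. real p powr (- s))"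
    by (rule sum_mono2) (auto simp: primes_le_def)
  also have "\<dots> \<le> (\<Sum>p\<in>primes_le W \<inter> R. real p powr (- s)) + (\<Sum>p=Suc W..N. real p powr (- s))"
    by (rule sum_Un_le) auto
  also have "(\<Sum>p\<in>primes_le W \<inter> R. real p powr (- s)) \<le> (\<Sum>p\<in>primes_le W \<inter> R. 1 / real p)"
  proof (rule sum_mono)
    fix p assume "p \<in> primes_le W \<inter> R"
    then have "p > 0" using prime_gt_0_nat by (auto simp: primes_le_def)
    then have "real p powr (- s) \<le> real p powr (- 1)" using s1 by (intro powr_mono) auto
    also have "\<dots> = 1 / real p" using \<open>p > 0\<close> by (subst powr_minus_divide) auto
    finally show "real p powr (- s) \<le> 1 / real p" .
  qed
  also have "(\<Sum>p=Suc W..N. real p powr (- s)) \<le> real W powr (1 - s) / (s - 1)"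
    by (rule sum_powr_le[OF s1 W])
  also have "real W powr (1 - s) = exp (- (s - 1) * z)" using W by (simp add: powr_def z_def)
  also have "- (s - 1) * z = - 2 * ln z" unfolding s using z by simp
  also have "exp (- 2 * ln z) = 1 / z ^ 2"
  proof -
    have "exp (2 * ln z) = z ^ 2" using z by (simp add: exp_of_nat_mult[of 2 "ln z", simplified])
    moreover have "exp (- 2 * ln z) = 1 / exp (2 * ln z)" by (simp add: exp_minus divide_inverse)
    ultimately show ?thesis by simp
  qed
  also have "1 / z ^ 2 / (s - 1) = 1 / (z * (2 * ln z))"
    unfolding s using z by (simp add: power2_eq_square)
  also have "\<dots> \<le> 1"
  proof -
    have "1 * 1 \<le> z * (2 * ln z)" using z lnz by (intro mult_mono) auto
    then show ?thesis by simp
  qed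
  finally show "(\<Sum>p\<in>primes_le N \<inter> R. real p powr (- s)) \<le> (\<Sum>p\<in>primes_le W \<inter> R. 1 / real p) + 1" by simp
qed

text \<open>Since ln (1 / (s - 1)) >= ln ln W / 2, the factor 8 in the hypothesis becomes the 4 of
  \<open>sum_inert_primes_ge\<close>. Division by 2^a turns its loss into 12 a.\<close>

lemma sum_inverse_inert_primes_ge:
  assumes a: "a \<ge> 3" and W: "ln (real W) \<ge> 4096" "ln (ln (real W)) > 8 * real a * 2 ^ a"
  shows "(\<Sum>p\<in>primes_le W \<inter> inert_primes a. 1 / real p) \<ge> ln (ln (real W)) / (2 * 2 ^ a) - 12 * real a - 1"
proof -
  define s where "s = 1 + 2 * ln (ln (real W)) / ln (real W)"
  define V where "V = (\<Sum>p\<in>primes_le W \<inter> inert_primes a. 1 / real p)"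
  note S = sum_powr_le_sum_inverse[OF W(1), folded s_def]
  have "s - 1 < exp (- 4 * real a * 2 ^ a)"
  proof -
    have "ln (1 / (s - 1)) > 4 * real a * 2 ^ a" using S(4) W(2) by linarith
    then have "- ln (s - 1) > 4 * real a * 2 ^ a" using S(2) by (simp add: ln_div)
    then have "exp (ln (s - 1)) < exp (- 4 * real a * 2 ^ a)" by simp
    then show ?thesis using S(2) by simp
  qed
  then have "ln (1 / (s - 1)) \<le> 2 ^ a * (V + 1) + 12 * real a * 2 ^ a"
    using S(1)[of _ "inert_primes a"] by (intro sum_inert_primes_ge[OF a S(2)]) (auto simp: V_def)
  then have "ln (ln (real W)) / 2 \<le> (V + 1 + 12 * real a) * 2 ^ a"
    using S(4) by (simp add: algebra_simps)
  then have "ln (ln (real W)) / 2 / 2 ^ a \<le> V + 1 + 12 * real a" by (simp add: divide_le_eq)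
  then show ?thesis by (simp add: V_def)
qed

lemma sum_inverse_cubic_primes_ge:
  assumes W: "ln (real W) \<ge> 4096"
  shows "(\<Sum>p\<in>primes_le W \<inter> cubic_primes. 1 / real p) \<ge> (ln (ln (real W)) / 2 - 225) / 6 - 1"
proof -
  define s where "s = 1 + 2 * ln (ln (real W)) / ln (real W)"
  define V where "V = (\<Sum>p\<in>primes_le W \<inter> cubic_primes. 1 / real p)"
  note S = sum_powr_le_sum_inverse[OF W(1), folded s_def]
  have "ln (1 / (s - 1)) \<le> 6 * (V + 1) + 225"
    using S(1)[of _ cubic_primes] by (intro sum_cubic_primes_ge[OF S(2,3)]) (auto simp: V_def)
  then show ?thesis using S(4) unfolding V_def[symmetric] by argo
qed

section \<open>Counting\<close>

text \<open>All primes of R together might have a reciprocal sum too large for k. Sieving by a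
  subset with sum in [L, L + 1] respects the level and only enlarges the count.\<close>

lemma card_avoiding_primes_le:
  fixes R :: "nat set" and L :: real
  assumes L: "L \<ge> 0" "(\<Sum>p\<in>primes_le W \<inter> R. 1 / real p) \<ge> L"
    and k: "even k" "real k \<ge> 4 * (L + 1)" and W: "W \<ge> 1"
  shows "real (card {m \<in> {1..N}. \<forall>r\<in>primes_le W \<inter> R. \<not> r dvd m}) \<le> 2 * real N * exp (- L) + 3 * real W ^ k"
proof -
  have pr: "prime r" if "r \<in> primes_le W \<inter> R" for r using that by (auto simp: primes_le_def)
  have "\<exists>B\<subseteq>primes_le W \<inter> R. L \<le> (\<Sum>p\<in>B. 1 / real p) \<and> (\<Sum>p\<in>B. 1 / real p) \<le> L + 1"
  proof (rule subset_sum_between)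
    fix p assume "p \<in> primes_le W \<inter> R"
    then have "real p \<ge> 1" using prime_ge_1_nat[OF pr] by simp
    then show "0 \<le> 1 / real p \<and> 1 / real p \<le> 1" by simp
  next
    show "finite (primes_le W \<inter> R)" by simp
  qed (rule L)+
  then obtain B where B: "B \<subseteq> primes_le W \<inter> R" "L \<le> (\<Sum>p\<in>B. 1 / real p)" "(\<Sum>p\<in>B. 1 / real p) \<le> L + 1"
    by blast
  have fB: "finite B" by (rule finite_subset[OF B(1)]) simp
  have "B \<subseteq> {1..W}"
  proof
    fix p assume "p \<in> B"
    then have "p \<in> primes_le W \<inter> R" using B(1) by blast
    then show "p \<in> {1..W}" using prime_ge_1_nat[OF pr] by (simp add: primes_le_def)
  qed
  then have "card B \<le> card {1..W}" by (intro card_mono) auto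
  then have cB: "real (card B) \<le> real W" by simp
  have "card {m \<in> {1..N}. \<forall>r\<in>primes_le W \<inter> R. \<not> r dvd m} \<le> card {m \<in> {1..N}. \<forall>r\<in>B. \<not> r dvd m}"
    using B(1) by (intro card_mono) auto
  then have "real (card {m \<in> {1..N}. \<forall>r\<in>primes_le W \<inter> R. \<not> r dvd m}) \<le> real (card {m \<in> {1..N}. \<forall>r\<in>B. \<not> r dvd m})"
    by simp
  also have "\<dots> \<le> 2 * real N * exp (- (\<Sum>p\<in>B. 1 / real p)) + 3 * real W ^ k"
  proof (rule Brun_pure_sieve[OF fB _ refl])
    show "prime r" if "r \<in> B" for r using that B(1) pr by blast
    show "real k \<ge> 4 * (\<Sum>p\<in>B. 1 / real p)" 
      by (rule order_trans[OF mult_left_mono[OF B(3)] k(2)]) simp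
  qed (use k(1) cB W in simp_all)
  also have "\<dots> \<le> 2 * real N * exp (- L) + 3 * real W ^ k"
    using B(2) by (intro add_right_mono mult_left_mono) auto
  finally show ?thesis .
qed

text \<open>If \<open>m = gcd n (fib n)\<close> has a prime factor in each of the two sets, then \<open>3 * 2 ^ a\<close>
  divides \<open>n\<close>, so \<open>2 ^ a\<close> divides \<open>m\<close>.\<close>
lemma card_fib_gcds_le:
  assumes a: "a \<ge> 3" and L: "L \<ge> 0"
    and R: "(\<Sum>p\<in>primes_le W \<inter> inert_primes a. 1 / real p) \<ge> L"
    and T: "(\<Sum>p\<in>primes_le W \<inter> cubic_primes. 1 / real p) \<ge> L"
    and k: "even k" "real k \<ge> 4 * (L + 1)" and W: "W \<ge> 1"
  shows "real (card {m \<in> fib_gcds. m \<in> {1..N}}) \<le> real N / 2 ^ a + 4 * real N * exp (- L) + 6 * real W ^ k"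
proof -
  define A1 where "A1 = {m \<in> {1..N}. 2 ^ a dvd m}"
  define A2 where "A2 = {m \<in> {1..N}. \<forall>r\<in>primes_le W \<inter> inert_primes a. \<not> r dvd m}"
  define A3 where "A3 = {m \<in> {1..N}. \<forall>r\<in>primes_le W \<inter> cubic_primes. \<not> r dvd m}"
  have "{m \<in> fib_gcds. m \<in> {1..N}} \<subseteq> A1 \<union> (A2 \<union> A3)"
  proof
    fix m assume m: "m \<in> {m \<in> fib_gcds. m \<in> {1..N}}"
    then obtain n where n: "m = gcd n (fib n)" by (auto simp: fib_gcds_def)
    show "m \<in> A1 \<union> (A2 \<union> A3)"
    proof (cases "m \<in> A2 \<union> A3")
      case False
      then obtain r r' where r: "r \<in> inert_primes a" "r dvd m" and r': "r' \<in> cubic_primes" "r' dvd m"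
        using m by (auto simp: A2_def A3_def)
      have rn: "r dvd fib n" "r' dvd fib n" using r(2) r'(2) unfolding n by simp_all
      have r5: "prime r" "r mod 5 \<in> {2, 3}" "2 ^ a dvd Suc r"
        using r(1) by (simp_all add: inert_primes_def)
      have "2 \<le> a" using a by simp
      then have "2 ^ a dvd n" by (rule pow2_dvd_of_inert_dvd_fib[OF r5(1,2) _ r5(3) rn(1)])
      moreover have r15: "prime r'" "r' mod 15 \<in> {1, 2, 4, 8}" "5 < r'" "card (cubic_roots r') < 3"
        using r'(1) by (simp_all add: cubic_primes_def)
      have "3 dvd n" by (rule three_dvd_of_dvd_fib[OF r15 rn(2)])
      ultimately have "2 ^ a dvd m" unfolding n by (rule pow2_dvd_gcd_fib)
      then show ?thesis using m by (simp add: A1_def)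
    qed simp
  qed
  then have "card {m \<in> fib_gcds. m \<in> {1..N}} \<le> card (A1 \<union> (A2 \<union> A3))"
    by (intro card_mono) (auto simp: A1_def A2_def A3_def)
  also have "\<dots> \<le> card A1 + (card A2 + card A3)"
    by (meson add_left_mono card_Un_le le_trans)
  finally have "real (card {m \<in> fib_gcds. m \<in> {1..N}}) \<le> real (card A1) + (real (card A2) + real (card A3))"
    by (simp flip: of_nat_add)
  also have "real (card A1) \<le> real N / 2 ^ a"
    unfolding A1_def using of_nat_div_le_of_nat[of N "2 ^ a", where ?'a = real] by (subst card_multiples) auto
  also have "real (card A2) \<le> 2 * real N * exp (- L) + 3 * real W ^ k"
    unfolding A2_def by (rule card_avoiding_primes_le[OF L R k W])
  also have "real (card A3) \<le> 2 * real N * exp (- L) + 3 * real W ^ k"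
    unfolding A3_def by (rule card_avoiding_primes_le[OF L T k W])
  finally show ?thesis by simp
qed

text \<open>The choice exp (-L) = 1 / l makes both sieve terms of size x / l; k is an even number
  near 4 L and W is about x^(1/(2k)), so that W^k <= sqrt x. Multiples of 2^a, with 2^a > T / 2,
  give 2 * 104, and 218 = 208 + 4 + 6.\<close>

lemma card_fib_gcds_le_of_large:
  fixes x :: real
  defines "l \<equiv> ln (ln x)" and "L \<equiv> ln (ln (ln x))"
  assumes x: "x \<ge> 1" "ln x \<ge> 1" "l \<ge> 1" "L \<ge> 1"
    and C2: "l / (104 * L) \<ge> 8" and C3: "ln x / (4 * (4 * L + 6)) \<ge> 4096"
    and C4: "ln (ln x / (4 * (4 * L + 6))) \<ge> l / 2" and C5: "(l / 4 - 225) / 6 - 1 \<ge> L"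
    and C6: "sqrt x * l \<le> x"
  shows "real (card (real ` fib_gcds \<inter> {1..x})) \<le> 218 * (x * L / l)"
proof -
  \<comment> \<open>The inert primes must supply L beyond the loss 12 a + 1 <= 24 L + L, hence 26 L,
    and the main term is at least (l / 2) / (2 T); equality determines 104.\<close>
  define T where "T = l / (104 * L)"
  have T8: "T \<ge> 8" using C2 by (simp add: T_def)
  have "nat \<lfloor>T\<rfloor> \<ge> 1" using T8 by linarith
  then obtain a where a: "2 ^ a \<le> nat \<lfloor>T\<rfloor>" "nat \<lfloor>T\<rfloor> < 2 ^ (a + 1)"
    using ex_power_ivl1[of 2 "nat \<lfloor>T\<rfloor>"] by auto
  have "real (2 ^ a) \<le> real (nat \<lfloor>T\<rfloor>)" using a(1) by (simp only: of_nat_le_iff)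
  also have "\<dots> \<le> T" using T8 by simp
  finally have aT: "2 ^ a \<le> T" by simp
  have "T < real (nat \<lfloor>T\<rfloor>) + 1" using T8 by linarith
  also have "\<dots> \<le> real (2 ^ (a + 1))"
  proof -
    have "nat \<lfloor>T\<rfloor> + 1 \<le> 2 ^ (a + 1)" using a(2) by simp
    then have "real (nat \<lfloor>T\<rfloor> + 1) \<le> real (2 ^ (a + 1))" by (simp only: of_nat_le_iff)
    then show ?thesis by simp
  qed
  finally have Ta: "T < 2 * 2 ^ a" by simp
  have a3: "a \<ge> 3"
  proof (rule ccontr)
    assume "\<not> a \<ge> 3"
    then have "(2 :: real) ^ a \<le> 2 ^ 2" by (intro power_increasing) auto
    then show False using Ta T8 by simp
  qed
  have TL: "T * L = l / 104" using x by (simp add: T_def)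
  have "T \<le> l" unfolding T_def using x by (simp add: divide_le_eq)
  then have "(2 :: real) ^ a \<le> l" using aT by linarith
  then have "ln ((2 :: real) ^ a) \<le> ln l" by (intro ln_mono) auto
  then have "real a * ln 2 \<le> L" by (simp add: ln_realpow L_def l_def)
  moreover have "real a * (1 / 2) \<le> real a * ln 2" using ln2_ge_two_thirds by (intro mult_left_mono) auto
  ultimately have aL: "real a \<le> 2 * L" by simp
  define k where "k = 2 * nat \<lceil>2 * (L + 1)\<rceil>"
  have k: "even k" "real k \<ge> 4 * (L + 1)" "real k \<le> 4 * L + 6" "k > 0"
  proof -
    have c: "real (nat \<lceil>2 * (L + 1)\<rceil>) = of_int \<lceil>2 * (L + 1)\<rceil>" using x by simp
    have rk: "real k = 2 * of_int \<lceil>2 * (L + 1)\<rceil>" unfolding k_def of_nat_mult c by simp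
    show "even k" by (simp add: k_def)
    show "real k \<ge> 4 * (L + 1)" unfolding rk using le_of_int_ceiling[of "2 * (L + 1)"] by argo
    then show "k > 0" using x by (cases k) auto
    show "real k \<le> 4 * L + 6" unfolding rk using of_int_ceiling_le_add_one[of "2 * (L + 1)"] by argo
  qed
  define E where "E = exp (ln x / (2 * real k))"
  define W where "W = nat \<lfloor>E\<rfloor>"
  have "ln x / (2 * (4 * L + 6)) \<le> ln x / (2 * real k)"
    using x k by (intro divide_left_mono) auto
  moreover have "ln x / (2 * (4 * L + 6)) = 2 * (ln x / (4 * (4 * L + 6)))"
  proof -
    have "y / (2 * c) = 2 * (y / (4 * c))" for y c :: real by (cases "c = 0") (auto simp: field_simps)
    then show ?thesis .
  qed
  ultimately have lE: "ln E \<ge> 2 * (ln x / (4 * (4 * L + 6)))" by (simp add: E_def)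
  have E2: "E \<ge> 2"
  proof -
    have "1 \<le> ln E" using lE C3 by argo
    then have "exp 1 \<le> exp (ln E)" by simp
    moreover have "exp (ln E) = E" by (simp add: E_def)
    moreover have "exp 1 \<ge> (2 :: real)" using exp_ge_add_one_self[of 1] by simp
    ultimately show ?thesis by linarith
  qed
  have WE: "real W \<le> E" "real W \<ge> E / 2" using E2 unfolding W_def by linarith+
  have W1: "W \<ge> 1" using WE E2 by linarith
  \<comment> \<open>Rounding E down costs at most ln 2 in the logarithm; this is absorbed by the
    factor 2 between the denominators 2 (4 L + 6) and 4 (4 L + 6).\<close>
  have "ln (E / 2) \<le> ln (real W)" using WE E2 by (intro ln_mono) auto
  moreover have "ln (E / 2) = ln E - ln 2" using E2 by (intro ln_divide_pos) auto
  moreover have "ln 2 \<le> (1 :: real)" using ln_le_minus_one[of 2] by simp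
  ultimately have lW: "ln (real W) \<ge> ln x / (4 * (4 * L + 6))" using lE C3 by argo
  then have lW1: "ln (real W) \<ge> 4096" using C3 by linarith
  have "ln (ln x / (4 * (4 * L + 6))) \<le> ln (ln (real W))" using lW C3 by (intro ln_mono) auto
  then have llW: "ln (ln (real W)) \<ge> l / 2" using C4 by linarith
  have WK: "real W ^ k \<le> sqrt x"
  proof -
    have "real W ^ k \<le> E ^ k" using WE by (intro power_mono) auto
    also have "\<dots> = exp (real k * (ln x / (2 * real k)))" 
      unfolding E_def by (rule exp_of_nat_mult[symmetric])
    also have "real k * (ln x / (2 * real k)) = ln (sqrt x)" using k x by (simp add: ln_sqrt)
    also have "exp (ln (sqrt x)) = sqrt x" using x by simp
    finally show ?thesis .
  qed
  have R: "(\<Sum>p\<in>primes_le W \<inter> inert_primes a. 1 / real p) \<ge> L"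
  proof -
    have "8 * real a * 2 ^ a \<le> 8 * (2 * L) * T" using aL aT x by (intro mult_mono) auto
    also have "\<dots> = 16 * (T * L)" by simp
    also have "\<dots> < l / 2" unfolding TL using x by simp
    finally have "ln (ln (real W)) > 8 * real a * 2 ^ a" using llW by linarith
    then have "ln (ln (real W)) / (2 * 2 ^ a) - 12 * real a - 1 \<le> (\<Sum>p\<in>primes_le W \<inter> inert_primes a. 1 / real p)"
      by (rule sum_inverse_inert_primes_ge[OF a3 lW1])
    moreover have "26 * L \<le> ln (ln (real W)) / (2 * 2 ^ a)"
    proof -
      have "26 * L * (2 * 2 ^ a) \<le> 26 * L * (2 * T)" using aT x by (intro mult_left_mono) auto
      also have "\<dots> = 52 * (T * L)" by simp
      also have "\<dots> = l / 2" unfolding TL by simp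
      finally have "26 * L * (2 * 2 ^ a) \<le> ln (ln (real W))" using llW by linarith
      then show ?thesis by (simp add: pos_le_divide_eq)
    qed
    ultimately show ?thesis using aL x by argo
  qed
  have Tc: "(\<Sum>p\<in>primes_le W \<inter> cubic_primes. 1 / real p) \<ge> L"
  proof -
    have "(l / 4 - 225) / 6 - 1 \<le> (ln (ln (real W)) / 2 - 225) / 6 - 1" using llW by simp
    then show ?thesis using sum_inverse_cubic_primes_ge[OF lW1] C5 by argo
  qed
  define N where "N = nat \<lfloor>x\<rfloor>"
  have Nx: "real N \<le> x" using x by (simp add: N_def)
  have "real ` fib_gcds \<inter> {1..x} \<subseteq> real ` {m \<in> fib_gcds. m \<in> {1..N}}"
  proof
    fix y assume "y \<in> real ` fib_gcds \<inter> {1..x}"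
    then obtain m where m: "y = real m" "m \<in> fib_gcds" "1 \<le> real m" "real m \<le> x" by auto
    then have "m \<in> {1..N}" by (simp add: N_def le_nat_floor)
    then show "y \<in> real ` {m \<in> fib_gcds. m \<in> {1..N}}" using m by blast
  qed
  then have "card (real ` fib_gcds \<inter> {1..x}) \<le> card (real ` {m \<in> fib_gcds. m \<in> {1..N}})"
    by (intro card_mono) auto
  also have "\<dots> \<le> card {m \<in> fib_gcds. m \<in> {1..N}}" by (intro card_image_le) auto
  finally have "real (card (real ` fib_gcds \<inter> {1..x})) \<le> real (card {m \<in> fib_gcds. m \<in> {1..N}})" by simp
  also have "\<dots> \<le> real N / 2 ^ a + 4 * real N * exp (- L) + 6 * real W ^ k"
    using x by (intro card_fib_gcds_le[OF a3 _ R Tc k(1,2) W1]) auto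
  also have "real N / 2 ^ a \<le> 208 * (x * L / l)"
  proof -
    have "real N / 2 ^ a \<le> x / (T / 2)" using Nx Ta T8 x by (intro frac_le) auto
    also have "\<dots> = 208 * (x * L / l)" using x by (simp add: T_def)
    finally show ?thesis .
  qed
  also have "4 * real N * exp (- L) \<le> 4 * (x * L / l)"
  proof -
    have "exp L = l" unfolding L_def using x by (simp add: l_def)
    then have "exp (- L) = 1 / l" by (simp add: exp_minus divide_inverse)
    then have "4 * real N * exp (- L) = 4 * real N / l" by simp
    also have "\<dots> \<le> 4 * (x * L) / l"
      using Nx x mult_mono[of "real N" x 1 L] by (intro divide_right_mono) auto
    finally show ?thesis by simp
  qed
  also have "6 * real W ^ k \<le> 6 * (x * L / l)"
  proof -
    have "sqrt x \<le> x / l" using C6 x by (simp add: pos_le_divide_eq)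
    also have "\<dots> \<le> x * L / l" using x by (intro divide_right_mono) auto
    finally show ?thesis using WK by argo
  qed
  finally show ?thesis by (simp add: mult.commute[of L x])
qed

theorem theorem1p1:
  shows "\<exists>C x0 :: real. C > 0 \<and>
    (\<forall>x :: real. x \<ge> x0 \<longrightarrow>
      real (card (real ` fib_gcds \<inter> {1..x})) \<le> C * (x * ln (ln (ln x)) / ln (ln x)))"
proof -
  have "eventually (\<lambda>x :: real. x \<ge> 1) at_top" "eventually (\<lambda>x :: real. ln x \<ge> 1) at_top"
    "eventually (\<lambda>x :: real. ln (ln x) \<ge> 1) at_top" "eventually (\<lambda>x :: real. ln (ln (ln x)) \<ge> 1) at_top"
    "eventually (\<lambda>x :: real. ln (ln x) / (104 * ln (ln (ln x))) \<ge> 8) at_top"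
    "eventually (\<lambda>x :: real. ln x / (4 * (4 * ln (ln (ln x)) + 6)) \<ge> 4096) at_top"
    "eventually (\<lambda>x :: real. ln (ln x / (4 * (4 * ln (ln (ln x)) + 6))) \<ge> ln (ln x) / 2) at_top"
    "eventually (\<lambda>x :: real. (ln (ln x) / 4 - 225) / 6 - 1 \<ge> ln (ln (ln x))) at_top"
    "eventually (\<lambda>x :: real. sqrt x * ln (ln x) \<le> x) at_top"
    by real_asymp+
  then have "eventually (\<lambda>x :: real. real (card (real ` fib_gcds \<inter> {1..x})) \<le> 218 * (x * ln (ln (ln x)) / ln (ln x))) at_top"
    by eventually_elim (rule card_fib_gcds_le_of_large)
  then obtain x0 where "\<forall>x\<ge>x0. real (card (real ` fib_gcds \<inter> {1..x})) \<le> 218 * (x * ln (ln (ln x)) / ln (ln x))"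
    unfolding eventually_at_top_linorder by blast
  then show ?thesis by (intro exI[of _ 218] exI[of _ x0]) auto
qed

end
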